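(* Let $\varepsilon>0$ be a constant and let $t\ge 1$ be any constant. There exists a randomized one-pass dynamic streaming algorithm that, given a graph $G$ on vertex set $[n]=\{1,\dots,n\}$ presented as a stream of edge insertions and deletions, estimates the number of connected components of $G$ of size at most $1/\varepsilon$ within an additive error $\varepsilon^t n$, using $O(e^t n^{1-\varepsilon}\cdot\mathrm{poly}\log n)$ space and post-processing time. The update time (time to process each stream element) is $O(\mathrm{poly}\log n)$.
   Context: In the dynamic streaming model, the input graph on the fixed vertex set $[n]$ is defined by a sequence of edge insertions and deletions; the algorithm makes a single pass over the stream. Post-processing time is the time needed after the stream ends to produce the output. The algorithm is randomized and succeeds with constant probability (at least $2/3$). The size of a connected component is its number of vertices. An estimate $Y$ of a quantity $X$ has additive error at most $\delta$ if $|Y-X|\le\delta$. *)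

theory Defs
  imports "HOL-Probability.Probability"
begin

section \<open>Graphs and connected components\<close>

text \<open>A graph on the vertex set \<open>{1..n}\<close> is given by its set of edges, an edge being a
  two-element vertex set \<open>{u, v}\<close>.\<close>

definition adjacency :: "nat set set \<Rightarrow> (nat \<times> nat) set" where
  "adjacency E = {(u, v). {u, v} \<in> E}"

definition components :: "nat \<Rightarrow> nat set set \<Rightarrow> nat set set" where
  "components n E = {1..n} // (adjacency E)\<^sup>*"

definition num_small_components :: "real \<Rightarrow> nat \<Rightarrow> nat set set \<Rightarrow> nat" where
  "num_small_components \<epsilon> n E = card {C \<in> components n E. real (card C) \<le> 1 / \<epsilon>}"

section \<open>Dynamic graph streams\<close>

datatype edge_update = Insert nat nat | Delete nat nat

fun apply_update :: "nat set set \<Rightarrow> edge_update \<Rightarrow> nat set set" where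
  "apply_update E (Insert u v) = insert {u, v} E"
| "apply_update E (Delete u v) = E - {{u, v}}"

text \<open>The streamed graph is simple at every time: only absent edges are inserted and only
  present edges are deleted, and there are no loops.\<close>

fun valid_update :: "nat \<Rightarrow> nat set set \<Rightarrow> edge_update \<Rightarrow> bool" where
  "valid_update n E (Insert u v) \<longleftrightarrow> u \<in> {1..n} \<and> v \<in> {1..n} \<and> u \<noteq> v \<and> {u, v} \<notin> E"
| "valid_update n E (Delete u v) \<longleftrightarrow> u \<in> {1..n} \<and> v \<in> {1..n} \<and> u \<noteq> v \<and> {u, v} \<in> E"

definition stream_graph :: "edge_update list \<Rightarrow> nat set set" where
  "stream_graph \<sigma> = foldl apply_update {} \<sigma>"

definition valid_stream :: "nat \<Rightarrow> edge_update list \<Rightarrow> bool" where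
  "valid_stream n \<sigma> \<longleftrightarrow>
     (\<forall>i < length \<sigma>. valid_update n (stream_graph (take i \<sigma>)) (\<sigma> ! i))"

section \<open>A randomized word RAM\<close>

text \<open>Programs are structured, finite, and cannot depend on \<open>n\<close>. The memory is a sequence of
  words of \<open>w\<close> bits each; a cell with a constant address plays the role of a register.
  The input words are read-only. Every command counts as one time step (a loop: one step per
  evaluation of its test), and all arithmetic is modulo \<open>2 ^ w\<close>.\<close>

datatype loc = Direct nat | Indirect nat

datatype operand = Const nat | Input nat | At loc

datatype binop = Plus | Minus | Times | Div | Mod

datatype test = Equal operand operand | Less operand operand

datatype cmd =
    Assign loc binop operand operand
  | Random loc
  | Cond test "cmd list" "cmd list"
  | While test "cmd list"

type_synonym memory = "nat \<Rightarrow> nat"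

fun address :: "memory \<Rightarrow> loc \<Rightarrow> nat" where
  "address m (Direct a) = a"
| "address m (Indirect a) = m a"

fun operand_val :: "nat \<Rightarrow> nat list \<Rightarrow> memory \<Rightarrow> operand \<Rightarrow> nat" where
  "operand_val w inp m (Const k) = k mod 2 ^ w"
| "operand_val w inp m (Input i) = (if i < length inp then inp ! i else 0)"
| "operand_val w inp m (At l) = m (address m l)"

fun binop_val :: "nat \<Rightarrow> binop \<Rightarrow> nat \<Rightarrow> nat \<Rightarrow> nat" where
  "binop_val w Plus x y = (x + y) mod 2 ^ w"
| "binop_val w Minus x y = (x + 2 ^ w - y) mod 2 ^ w"
| "binop_val w Times x y = (x * y) mod 2 ^ w"
| "binop_val w Div x y = x div y"
| "binop_val w Mod x y = x mod y"

fun test_val :: "nat \<Rightarrow> nat list \<Rightarrow> memory \<Rightarrow> test \<Rightarrow> bool" where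
  "test_val w inp m (Equal x y) \<longleftrightarrow> operand_val w inp m x = operand_val w inp m y"
| "test_val w inp m (Less x y) \<longleftrightarrow> operand_val w inp m x < operand_val w inp m y"

text \<open>A configuration consists of the list of commands still to be executed and the memory;
  it is halted if no command is left.\<close>

fun step :: "nat \<Rightarrow> nat list \<Rightarrow> cmd list \<times> memory \<Rightarrow> (cmd list \<times> memory) pmf" where
  "step w inp ([], m) = return_pmf ([], m)"
| "step w inp (Assign l f x y # cs, m) =
     return_pmf (cs, m(address m l := binop_val w f (operand_val w inp m x) (operand_val w inp m y)))"
| "step w inp (Random l # cs, m) =
     map_pmf (\<lambda>r. (cs, m(address m l := r))) (pmf_of_set {..<2 ^ w})"
| "step w inp (Cond b as bs # cs, m) =
     return_pmf ((if test_val w inp m b then as else bs) @ cs, m)"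
| "step w inp (While b bs # cs, m) =
     return_pmf (if test_val w inp m b then bs @ While b bs # cs else cs, m)"

primrec run :: "nat \<Rightarrow> nat list \<Rightarrow> nat \<Rightarrow> cmd list \<times> memory \<Rightarrow> (cmd list \<times> memory) pmf" where
  "run w inp 0 c = return_pmf c"
| "run w inp (Suc T) c = bind_pmf (step w inp c) (run w inp T)"

definition halts_within :: "nat \<Rightarrow> nat list \<Rightarrow> cmd list \<Rightarrow> memory \<Rightarrow> nat \<Rightarrow> bool" where
  "halts_within w inp P m T \<longleftrightarrow> (\<forall>c \<in> set_pmf (run w inp T (P, m)). fst c = [])"

text \<open>Distribution of the final memory; only meaningful if the program halts for all outcomes
  of the random choices within a common number of steps.\<close>

definition exec :: "nat \<Rightarrow> nat list \<Rightarrow> cmd list \<Rightarrow> memory \<Rightarrow> memory pmf" where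
  "exec w inp P m = map_pmf snd (run w inp (LEAST T. halts_within w inp P m T) (P, m))"

definition runs_in_time :: "nat \<Rightarrow> nat list \<Rightarrow> cmd list \<Rightarrow> memory \<Rightarrow> real \<Rightarrow> bool" where
  "runs_in_time w inp P m B \<longleftrightarrow> (\<exists>T. real T \<le> B \<and> halts_within w inp P m T)"

text \<open>Space is counted in bits. All memory is initially zero, so a run fits into the first
  \<open>s\<close> cells, i.e. into \<open>w * s\<close> bits, if every cell with address at least \<open>s\<close>
  is zero in all reachable configurations.\<close>

definition runs_in_space :: "nat \<Rightarrow> nat list \<Rightarrow> cmd list \<Rightarrow> memory \<Rightarrow> real \<Rightarrow> bool" where
  "runs_in_space w inp P m B \<longleftrightarrow>
     (\<forall>T. \<forall>c \<in> set_pmf (run w inp T (P, m)). \<forall>a. snd c a \<noteq> 0 \<longrightarrow> real (w * Suc a) \<le> B)"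

section \<open>One-pass dynamic streaming algorithms\<close>

text \<open>\<open>init_prog\<close> runs once before the stream starts, \<open>update_prog\<close> once for each stream
  element, in order, and \<open>report_prog\<close> once after the end of the stream. Only the memory is
  carried over from one of these runs to the next.\<close>

record stream_alg =
  init_prog :: "cmd list"
  update_prog :: "cmd list"
  report_prog :: "cmd list"

fun update_input :: "nat \<Rightarrow> edge_update \<Rightarrow> nat list" where
  "update_input n (Insert u v) = [n, 1, u, v]"
| "update_input n (Delete u v) = [n, 0, u, v]"

text \<open>Words have \<open>\<Theta>(log n)\<close> bits; for \<open>c \<ge> 1\<close> they can hold all numbers up to \<open>n\<close>.\<close>

definition word_length :: "nat \<Rightarrow> nat \<Rightarrow> nat" where
  "word_length c n = c * nat \<lceil>log 2 (real (n + 1))\<rceil>"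

definition memory_after :: "nat \<Rightarrow> nat \<Rightarrow> stream_alg \<Rightarrow> edge_update list \<Rightarrow> memory pmf" where
  "memory_after w n A \<sigma> =
     foldl (\<lambda>M u. bind_pmf M (exec w (update_input n u) (update_prog A)))
       (exec w [n] (init_prog A) (\<lambda>_. 0)) \<sigma>"

text \<open>The output is a nonnegative rational number, given by its numerator (cell 0) and
  denominator (cell 1); a zero denominator yields the output 0.\<close>

definition output_dist :: "nat \<Rightarrow> nat \<Rightarrow> stream_alg \<Rightarrow> edge_update list \<Rightarrow> real pmf" where
  "output_dist w n A \<sigma> =
     map_pmf (\<lambda>m. real (m 0) / real (m 1))
       (bind_pmf (memory_after w n A \<sigma>) (exec w [n] (report_prog A)))"

definition init_terminates :: "nat \<Rightarrow> nat \<Rightarrow> stream_alg \<Rightarrow> bool" where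
  "init_terminates w n A \<longleftrightarrow> (\<exists>T. halts_within w [n] (init_prog A) (\<lambda>_. 0) T)"

definition has_update_time :: "nat \<Rightarrow> nat \<Rightarrow> stream_alg \<Rightarrow> real \<Rightarrow> bool" where
  "has_update_time w n A B \<longleftrightarrow>
     (\<forall>\<sigma> u. valid_stream n (\<sigma> @ [u]) \<longrightarrow>
        (\<forall>m \<in> set_pmf (memory_after w n A \<sigma>).
           runs_in_time w (update_input n u) (update_prog A) m B))"

definition has_report_time :: "nat \<Rightarrow> nat \<Rightarrow> stream_alg \<Rightarrow> real \<Rightarrow> bool" where
  "has_report_time w n A B \<longleftrightarrow>
     (\<forall>\<sigma>. valid_stream n \<sigma> \<longrightarrow>
        (\<forall>m \<in> set_pmf (memory_after w n A \<sigma>). runs_in_time w [n] (report_prog A) m B))"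

definition has_space :: "nat \<Rightarrow> nat \<Rightarrow> stream_alg \<Rightarrow> real \<Rightarrow> bool" where
  "has_space w n A B \<longleftrightarrow>
     runs_in_space w [n] (init_prog A) (\<lambda>_. 0) B \<and>
     (\<forall>\<sigma> u. valid_stream n (\<sigma> @ [u]) \<longrightarrow>
        (\<forall>m \<in> set_pmf (memory_after w n A \<sigma>).
           runs_in_space w (update_input n u) (update_prog A) m B)) \<and>
     (\<forall>\<sigma>. valid_stream n \<sigma> \<longrightarrow>
        (\<forall>m \<in> set_pmf (memory_after w n A \<sigma>). runs_in_space w [n] (report_prog A) m B))"

definition estimates_small_components ::
    "nat \<Rightarrow> nat \<Rightarrow> stream_alg \<Rightarrow> real \<Rightarrow> real \<Rightarrow> bool" where
  "estimates_small_components w n A \<epsilon> \<delta> \<longleftrightarrow>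
     (\<forall>\<sigma>. valid_stream n \<sigma> \<longrightarrow>
        measure_pmf.prob (output_dist w n A \<sigma>)
          {Y. \<bar>Y - real (num_small_components \<epsilon> n (stream_graph \<sigma>))\<bar> \<le> \<delta>} \<ge> 2 / 3)"

end

theory Submission
  imports Defs
begin

text \<open>
  If \<open>\<epsilon> \<ge> 1\<close> the allowed error is at least \<open>n\<close>, so the empty program, which outputs 0, suffices. Otherwise
  let \<open>k = \<lfloor>1 / \<epsilon>\<rfloor>\<close> and let \<open>q\<close> be a power of two of order \<open>(\<epsilon> powr (2 * t) * n) powr (1 / k)\<close>. Every vertex
  is sampled with probability \<open>1 / q\<close>. A component \<open>C\<close> with \<open>card C \<le> k\<close> is entirely sampled with
  probability \<open>1 / q ^ card C\<close>, so the sum of \<open>q ^ card C\<close> over the entirely sampled small components is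
  an unbiased estimate. Distinct components are sampled independently, hence the variance is at most
  \<open>n * q ^ k\<close> and Chebyshev's inequality gives the error bound. The sample has about
  \<open>n / q = O(exp t * n powr (1 - \<epsilon>))\<close> vertices, because \<open>(1 / \<epsilon>) powr (2 * \<epsilon>) \<le> exp 1\<close>.

  A vertex of a component of size at most \<open>k\<close> has fewer than \<open>k\<close> neighbours, and a deterministic linear
  sketch of polylogarithmic size recovers such a neighbourhood: for every modulus \<open>m = O(k * log n)\<close> and
  every residue \<open>r\<close>, the number and the sum of the neighbours \<open>u\<close> with \<open>u mod m = r\<close>. For every neighbour
  \<open>u\<close> some \<open>m\<close> divides none of the differences to the other neighbours, since the least common
  multiple of \<open>1, \<dots>, N\<close> is at least \<open>2 ^ (N - 1)\<close>; in that bucket \<open>u\<close> is alone. After the stream, a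
  breadth-first search from every sampled vertex over recovered neighbours finds the entirely sampled
  small components.
\<close>

section \<open>Verification of RAM programs\<close>

text \<open>All randomness is spent on the sample, which is drawn before the stream. The sketch is
  exact, so updates and report are deterministic, and the output distribution is the image of
  \<open>sample\<close> under \<open>estimate\<close>; hence it suffices to relate runs to a
  reference distribution. Polylogarithmic update time forbids scanning the sample, and the space
  bound forbids an array over all vertices: sampled vertices are stored in increasing order and
  found by binary search. A sampled vertex sketches its whole neighbourhood, unsampled neighbours
  included, because such a neighbour must be noticed as a failure. Space is a worst-case bound, so
  the sample is truncated at a capacity of about six times its mean; truncation and Chebyshev error
  each cost probability 1/6. The exponent \<open>2 * t\<close> comes from the variance condition
  \<open>q ^ k - 1 \<le> \<delta>\<^sup>2 * n / 6\<close> with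
  \<open>\<delta> = \<epsilon> powr t\<close>. The parameter \<open>t\<close> enters the programs
  only as the number \<open>\<sigma>\<close> of halvings of \<open>n\<close> during initialisation,
  hence \<open>K\<close>, \<open>d\<close> and \<open>c\<close> can be chosen before
  \<open>t\<close>.\<close>

definition fits :: "nat \<Rightarrow> memory \<Rightarrow> bool" where
  "fits A m \<longleftrightarrow> (\<forall>a. m a \<noteq> 0 \<longrightarrow> a < A)"

lemma rel_pmf_fst: "rel_pmf R p q \<Longrightarrow> x \<in> set_pmf p \<Longrightarrow> \<exists>y. R x y"
  by (drule rel_pmf_imp_rel_set) (auto simp: rel_set_def)

locale ram =
  fixes w :: nat and inp :: "nat list" and A :: nat
begin

text \<open>Relating the final memories to a reference distribution \<open>D\<close> by \<open>rel_pmf\<close> covers randomized programs;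
  \<open>D = return_pmf ()\<close> yields ordinary total correctness.\<close>

definition reaches ::
    "cmd list \<Rightarrow> nat \<Rightarrow> memory \<Rightarrow> 'd pmf \<Rightarrow> (memory \<Rightarrow> 'd \<Rightarrow> bool) \<Rightarrow> bool" where
  "reaches P T m D R \<longleftrightarrow>
     (\<forall>T'. \<forall>c \<in> set_pmf (run w inp T' (P, m)). fits A (snd c)) \<and>
     rel_pmf (\<lambda>c d. fst c = [] \<and> R (snd c) d) (run w inp T (P, m)) D"

abbreviation wp :: "cmd list \<Rightarrow> nat \<Rightarrow> memory \<Rightarrow> (memory \<Rightarrow> bool) \<Rightarrow> bool" where
  "wp P T m Q \<equiv> reaches P T m (return_pmf ()) (\<lambda>m' _. Q m')"

lemma run_halted [simp]: "run w inp T ([], m) = return_pmf ([], m)"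
  by (induction T) (auto simp: bind_return_pmf)

lemma run_add: "run w inp (T1 + T2) c = bind_pmf (run w inp T1 c) (run w inp T2)"
proof (induction T1 arbitrary: c)
  case (Suc T1)
  have "run w inp (T1 + T2) = (\<lambda>c. bind_pmf (run w inp T1 c) (run w inp T2))"
    using Suc by blast
  then show ?case by (simp add: bind_assoc_pmf)
qed (simp add: bind_return_pmf)

lemma reaches_fits: "reaches P T m D R \<Longrightarrow> fits A m"
  unfolding reaches_def by (metis run.simps(1) set_return_pmf singletonI snd_conv)

text \<open>A halted configuration is a fixed point of \<open>step\<close>, so running longer
  changes nothing.\<close>

lemma reaches_mono_time:
  assumes "reaches P T m D R" "T \<le> T'"
  shows "reaches P T' m D R"
proof -
  have halted: "c \<in> set_pmf (run w inp T (P, m)) \<Longrightarrow> fst c = []" for c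
    using assms(1) rel_pmf_fst[of _ "run w inp T (P, m)" D c] unfolding reaches_def by blast
  have "run w inp T' (P, m) = bind_pmf (run w inp T (P, m)) (run w inp (T' - T))"
    using run_add[of T "T' - T"] assms(2) by simp
  also have "\<dots> = bind_pmf (run w inp T (P, m)) return_pmf"
    by (rule bind_pmf_cong) (auto dest!: halted)
  finally show ?thesis
    using assms(1) by (simp add: reaches_def bind_return_pmf')
qed

lemma reaches_Nil: "reaches [] T m (return_pmf d) R \<longleftrightarrow> fits A m \<and> R m d"
  by (auto simp: reaches_def)

lemma reaches_step:
  assumes "step w inp (c # cs, m) = return_pmf (P, m')" "fits A m" "0 < T"
  shows "reaches (c # cs) T m D R \<longleftrightarrow> reaches P (T - 1) m' D R"
proof -
  obtain T0 where T0: "T = Suc T0" using assms(3) by (cases T) auto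
  have run_Suc: "run w inp (Suc S) (c # cs, m) = run w inp S (P, m')" for S
    using assms(1) by (simp add: bind_return_pmf)
  have "(\<forall>S. \<forall>x \<in> set_pmf (run w inp S (c # cs, m)). fits A (snd x)) \<longleftrightarrow>
      (\<forall>S. \<forall>x \<in> set_pmf (run w inp S (P, m')). fits A (snd x))" (is "(\<forall>S. ?X S) \<longleftrightarrow> (\<forall>S. ?Y S)")
  proof -
    have "?X 0" using assms(2) by simp
    moreover have "?X (Suc S) \<longleftrightarrow> ?Y S" for S by (simp only: run_Suc)
    ultimately show ?thesis by (metis not0_implies_Suc)
  qed
  then show ?thesis by (simp only: T0 reaches_def run_Suc diff_Suc_1)
qed

text \<open>The side conditions exclude overflow, so that arithmetic modulo \<open>2 ^ w\<close>
  becomes arithmetic on naturals. As conditional rewrite rules these equations let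
  \<open>simp\<close> execute straight-line code symbolically.\<close>

lemma reaches_Plus:
  assumes "fits A m" "0 < T" "operand_val w inp m x + operand_val w inp m y < 2 ^ w"
  shows "reaches (Assign l Plus x y # cs) T m D R \<longleftrightarrow>
    reaches cs (T - 1) (m(address m l := operand_val w inp m x + operand_val w inp m y)) D R"
  using assms by (intro reaches_step) auto

lemma reaches_Minus:
  assumes "fits A m" "0 < T" "operand_val w inp m y \<le> operand_val w inp m x" "operand_val w inp m x < 2 ^ w"
  shows "reaches (Assign l Minus x y # cs) T m D R \<longleftrightarrow>
    reaches cs (T - 1) (m(address m l := operand_val w inp m x - operand_val w inp m y)) D R"
proof -
  have "(a + 2 ^ w - b) mod 2 ^ w = a - b" if "b \<le> a" "a < 2 ^ w" for a b :: nat
  proof -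
    have "a + 2 ^ w - b = (a - b) + 2 ^ w" using that by simp
    then have "(a + 2 ^ w - b) mod 2 ^ w = (a - b) mod 2 ^ w" by (simp only: mod_add_self2)
    then show ?thesis using that by simp
  qed
  then show ?thesis using assms by (intro reaches_step) auto
qed

lemma reaches_Times:
  assumes "fits A m" "0 < T" "operand_val w inp m x * operand_val w inp m y < 2 ^ w"
  shows "reaches (Assign l Times x y # cs) T m D R \<longleftrightarrow>
    reaches cs (T - 1) (m(address m l := operand_val w inp m x * operand_val w inp m y)) D R"
  using assms by (intro reaches_step) auto

lemma reaches_Div:
  assumes "fits A m" "0 < T"
  shows "reaches (Assign l Div x y # cs) T m D R \<longleftrightarrow>
    reaches cs (T - 1) (m(address m l := operand_val w inp m x div operand_val w inp m y)) D R"
  using assms by (intro reaches_step) auto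

lemma reaches_Mod:
  assumes "fits A m" "0 < T"
  shows "reaches (Assign l Mod x y # cs) T m D R \<longleftrightarrow>
    reaches cs (T - 1) (m(address m l := operand_val w inp m x mod operand_val w inp m y)) D R"
  using assms by (intro reaches_step) auto

lemma reaches_Cond:
  assumes "fits A m" "0 < T"
  shows "reaches (Cond b as bs # cs) T m D R \<longleftrightarrow>
    (if test_val w inp m b then reaches (as @ cs) (T - 1) m D R else reaches (bs @ cs) (T - 1) m D R)"
  using assms reaches_step[of "Cond b as bs" cs m "(if test_val w inp m b then as else bs) @ cs" m T D R]
  by simp

lemmas reaches_simps =
  reaches_Nil reaches_Plus reaches_Minus reaches_Times reaches_Div reaches_Mod reaches_Cond

lemma reaches_While_True:
  assumes "fits A m" "0 < T" "test_val w inp m b" "reaches (bs @ While b bs # cs) (T - 1) m D R"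
  shows "reaches (While b bs # cs) T m D R"
  using assms by (subst reaches_step) auto

lemma reaches_While_False:
  assumes "fits A m" "0 < T" "\<not> test_val w inp m b" "reaches cs (T - 1) m D R"
  shows "reaches (While b bs # cs) T m D R"
  using assms by (subst reaches_step) auto

text \<open>Couples the first step with the reference distribution: the same outcome
  \<open>x\<close> of \<open>p\<close> selects the successor configuration \<open>g x\<close> and
  the remaining reference \<open>f x\<close>.\<close>

lemma reaches_bind:
  assumes "\<And>S c. c \<in> set_pmf (run w inp S (P, m)) \<Longrightarrow> S = 0 \<Longrightarrow> fits A (snd c)"
    and "step w inp (P, m) = map_pmf g p"
    and "0 < T"
    and "\<And>x. x \<in> set_pmf p \<Longrightarrow> reaches (fst (g x)) (T - 1) (snd (g x)) (f x) R"
  shows "reaches P T m (bind_pmf p f) R"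
proof -
  obtain T0 where T0: "T = Suc T0" using assms(3) by (cases T) auto
  have run_Suc: "run w inp (Suc S) (P, m) = bind_pmf p (\<lambda>x. run w inp S (g x))" for S
    using assms(2) by (simp add: bind_map_pmf)
  have "fits A (snd x)" if "x \<in> set_pmf (run w inp S (P, m))" for S x
  proof (cases S)
    case 0
    then show ?thesis using that assms(1) by blast
  next
    case (Suc S')
    with that have "x \<in> set_pmf (bind_pmf p (\<lambda>x. run w inp S' (g x)))"
      by (simp only: run_Suc)
    then obtain y where y: "y \<in> set_pmf p" "x \<in> set_pmf (run w inp S' (g y))"
      by auto
    then show ?thesis using assms(4)[OF y(1)] by (auto simp: reaches_def)
  qed
  moreover have "rel_pmf (\<lambda>c d. fst c = [] \<and> R (snd c) d)
      (bind_pmf p (\<lambda>x. run w inp T0 (g x))) (bind_pmf p f)"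
  proof (rule rel_pmf_bindI[where R = "\<lambda>x y. x = y \<and> x \<in> set_pmf p"])
    show "rel_pmf (\<lambda>x y. x = y \<and> x \<in> set_pmf p) p p" by (rule rel_pmf_reflI) simp
  qed (use assms(4) in \<open>auto simp: reaches_def T0\<close>)
  ultimately show ?thesis by (auto simp: T0 reaches_def run_Suc simp del: run.simps(2))
qed

lemma reaches_Random:
  assumes "fits A m" "0 < T"
    "\<And>r. r < 2 ^ w \<Longrightarrow> reaches cs (T - 1) (m(address m l := r)) (f r) R"
  shows "reaches (Random l # cs) T m (bind_pmf (pmf_of_set {..<2 ^ w}) f) R"
  by (rule reaches_bind[where g = "\<lambda>r. (cs, m(address m l := r))"])
     (use assms in \<open>auto simp: set_pmf_of_set lessThan_empty_iff\<close>)

section \<open>Sequential composition and loops\<close>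

lemma step_append:
  "P \<noteq> [] \<Longrightarrow> step w inp (P @ P', m) = map_pmf (\<lambda>c. (fst c @ P', snd c)) (step w inp (P, m))"
  by (cases P; cases "hd P") (auto simp: pmf.map_comp o_def)

lemma reaches_append:
  assumes "wp P T1 m Q" "\<And>m'. Q m' \<Longrightarrow> reaches P' T2 m' D R"
  shows "reaches (P @ P') (T1 + T2) m D R"
  using assms(1)
proof (induction T1 arbitrary: P m)
  case 0
  then have "P = [] \<and> Q m" by (auto simp: reaches_def)
  then show ?case using assms(2) by simp
next
  case (Suc T1)
  show ?case
  proof (cases "P = []")
    case True
    then have "Q m" using Suc.prems by (auto simp: reaches_def bind_return_pmf)
    then have "reaches P' T2 m D R" by (rule assms(2))
    then show ?thesis using reaches_mono_time[of P' T2 m D R "Suc (T1 + T2)"] True by simp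
  next
    case False
    have IH: "reaches (fst c @ P') (T1 + T2) (snd c) D R" if c: "c \<in> set_pmf (step w inp (P, m))" for c
    proof (rule Suc.IH)
      have "fits A (snd x)" if "x \<in> set_pmf (run w inp S c)" for S x
      proof -
        have "x \<in> set_pmf (run w inp (Suc S) (P, m))" using c that by auto
        then show ?thesis using Suc.prems unfolding reaches_def by blast
      qed
      moreover have "fst x = [] \<and> Q (snd x)" if "x \<in> set_pmf (run w inp T1 c)" for x
      proof -
        have "x \<in> set_pmf (run w inp (Suc T1) (P, m))" using c that by auto
        then show ?thesis using Suc.prems unfolding reaches_def by (simp add: rel_pmf_return_pmf2 del: run.simps)
      qed
      ultimately show "wp (fst c) T1 (snd c) Q"
        by (simp add: reaches_def rel_pmf_return_pmf2)
    qed
    have "reaches (P @ P') (Suc (T1 + T2)) m (bind_pmf (step w inp (P, m)) (\<lambda>_. D)) R"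
      by (rule reaches_bind[where g = "\<lambda>c. (fst c @ P', snd c)"])
        (use False Suc.prems IH reaches_fits[OF Suc.prems] in \<open>auto simp: step_append\<close>)
    then show ?thesis by simp
  qed
qed

lemma reaches_append_le:
  assumes "wp P T1 m Q" "\<And>m'. Q m' \<Longrightarrow> reaches P' (T - T1) m' D R" "T1 \<le> T"
  shows "reaches (P @ P') T m D R"
  using reaches_append[OF assms(1,2)] assms(3) by simp

lemma wp_conseq:
  assumes "wp P T m Q" "\<And>m'. Q m' \<Longrightarrow> Q' m'"
  shows "wp P T m Q'"
  using assms by (auto simp: reaches_def rel_pmf_return_pmf2)

text \<open>The index of \<open>I\<close> bounds the number of remaining iterations. Each costs the
  body and one evaluation of the test, hence \<open>Suc Tb\<close>; \<open>Suc Tc\<close> covers the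
  final test and the continuation.\<close>

lemma reaches_While:
  assumes "I j m" "\<And>j m. I j m \<Longrightarrow> fits A m"
    and "\<And>j m. I j m \<Longrightarrow> test_val w inp m b \<Longrightarrow> wp bs Tb m (\<lambda>m'. \<exists>i<j. I i m')"
    and "\<And>j m. I j m \<Longrightarrow> \<not> test_val w inp m b \<Longrightarrow> reaches cs Tc m D R"
  shows "reaches (While b bs # cs) (j * Suc Tb + Suc Tc) m D R"
  using assms(1)
proof (induction j arbitrary: m rule: less_induct)
  case (less j)
  show ?case
  proof (cases "test_val w inp m b")
    case True
    from assms(3)[OF less.prems True]
    have body: "wp bs Tb m (\<lambda>m'. \<exists>i<j. I i m')" .
    \<comment> \<open>At index 0 the body would have to establish an unsatisfiable postcondition,
      but the support of a \<open>pmf\<close> is nonempty.\<close>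
    have "j > 0"
    proof (rule ccontr)
      assume "\<not> j > 0"
      then have "wp bs Tb m (\<lambda>m'. False)" using body by simp
      then show False by (auto simp: reaches_def rel_pmf_return_pmf2 set_pmf_not_empty)
    qed
    then obtain j' where j': "j = Suc j'" by (cases j) auto
    have "reaches (bs @ While b bs # cs) (Tb + (j' * Suc Tb + Suc Tc)) m D R"
    proof (rule reaches_append[OF body])
      fix m' assume "\<exists>i<j. I i m'"
      then obtain i where i: "i < j" "I i m'" by blast
      have "i * Suc Tb \<le> j' * Suc Tb" using i(1) j' by (intro mult_right_mono) auto
      then show "reaches (While b bs # cs) (j' * Suc Tb + Suc Tc) m' D R"
        by (intro reaches_mono_time[OF less.IH[OF i]]) auto
    qed
    then have "reaches (bs @ While b bs # cs) (j * Suc Tb + Suc Tc - 1) m D R"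
      by (rule reaches_mono_time) (simp add: j')
    then show ?thesis
      by (intro reaches_While_True assms(2)[OF less.prems] True) auto
  next
    case False
    from reaches_mono_time[OF assms(4)[OF less.prems False]]
    show ?thesis
      by (intro reaches_While_False assms(2)[OF less.prems] False) auto
  qed
qed

section \<open>From the relational predicate to \<open>exec\<close> and the resource
  predicates\<close>

lemma reaches_halts: "reaches P T m D R \<Longrightarrow> halts_within w inp P m T"
  using rel_pmf_fst[of _ "run w inp T (P, m)" D] unfolding reaches_def halts_within_def by blast

text \<open>\<open>exec\<close> stops at the least common halting time; from then on nothing
  changes, so the later bound \<open>T\<close> yields the same distribution.\<close>

lemma reaches_exec:
  assumes "reaches P T m D R"
  shows "rel_pmf R (exec w inp P m) D"
proof -
  define T0 where "T0 = (LEAST T. halts_within w inp P m T)"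
  have halts: "halts_within w inp P m T0" and "T0 \<le> T"
    unfolding T0_def using reaches_halts[OF assms] by (auto intro: LeastI Least_le)
  have "run w inp T (P, m) = bind_pmf (run w inp T0 (P, m)) (run w inp (T - T0))"
    using run_add[of T0 "T - T0"] \<open>T0 \<le> T\<close> by simp
  also have "\<dots> = bind_pmf (run w inp T0 (P, m)) return_pmf"
    using halts unfolding halts_within_def by (intro bind_pmf_cong) auto
  finally have "exec w inp P m = map_pmf snd (run w inp T (P, m))"
    by (simp add: exec_def T0_def bind_return_pmf')
  moreover have "rel_pmf (\<lambda>c. R (snd c)) (run w inp T (P, m)) D"
    using assms unfolding reaches_def by (blast intro: pmf.rel_mono_strong)
  ultimately show ?thesis by (simp add: pmf.rel_map)
qed

lemma wp_exec: "wp P T m Q \<Longrightarrow> m' \<in> set_pmf (exec w inp P m) \<Longrightarrow> Q m'"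
  by (drule reaches_exec) (simp add: rel_pmf_return_pmf2)

lemma reaches_runs_in_time: "reaches P T m D R \<Longrightarrow> real T \<le> B \<Longrightarrow> runs_in_time w inp P m B"
  using reaches_halts unfolding runs_in_time_def by blast

lemma reaches_runs_in_space:
  assumes "reaches P T m D R" "real (w * A) \<le> B"
  shows "runs_in_space w inp P m B"
  unfolding runs_in_space_def
proof (intro allI ballI impI)
  fix T' c a assume c: "c \<in> set_pmf (run w inp T' (P, m))" "snd c a \<noteq> 0"
  then have "a < A" using assms(1) unfolding reaches_def fits_def by blast
  then have "w * Suc a \<le> w * A" by (intro mult_left_mono) auto
  then have "real (w * Suc a) \<le> real (w * A)" by (rule of_nat_mono)
  then show "real (w * Suc a) \<le> B" using assms(2) by simp
qed

end

section \<open>Sparse neighbourhoods and small components\<close>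

text \<open>The reciprocals of \<open>m * (N choose m)\<close> form the Leibniz triangle, in which every entry is a
  difference of two entries of smaller \<open>m\<close>; this is the induction below after multiplying by \<open>D\<close>.\<close>

lemma binomial_dvd_if_all_dvd:
  fixes D :: nat
  assumes "0 < m" "m \<le> N" "\<And>j. 0 < j \<Longrightarrow> j \<le> N \<Longrightarrow> j dvd D"
  shows "m * (N choose m) dvd D"
  using assms
proof (induction m arbitrary: N rule: nat_induct_non_zero)
  case 1
  then show ?case by simp
next
  case (Suc m)
  define a where "a = (N - 1 choose m)"
  have N: "N = Suc (N - 1)" using Suc.prems by simp
  have eq1: "Suc m * (N choose Suc m) = N * a"
    using Suc_times_binomial[of m "N - 1"] N by (simp add: a_def)
  have eq2: "(N - m) * (N choose m) = N * a"
    using binomial_absorb_comp[of N m] by (simp add: a_def)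
  have "m * a dvd D" unfolding a_def using Suc.prems by (intro Suc.IH) auto
  then obtain x where x: "D = m * a * x" by auto
  have "m * (N choose m) dvd D" using Suc.prems by (intro Suc.IH) auto
  then obtain y where y: "D = m * (N choose m) * y" by auto
  have eq2': "(int N - int m) * int (N choose m) = int N * int a"
    using arg_cong[OF eq2, of int] Suc.prems by (simp add: of_nat_diff)
  \<comment> \<open>\<open>x - y\<close> is the witness for \<open>N * a dvd D\<close>, and
    \<open>eq1\<close> identifies \<open>N * a\<close> with the wanted entry. The integers serve to
    form this difference.\<close>
  have "int m * (int N * int a * (int x - int y)) = int N * int (m * a * x) - int m * (int N * int a) * int y"
    by (simp add: algebra_simps)
  also have "\<dots> = int N * int D - (int N - int m) * int (m * (N choose m) * y)"
    unfolding eq2'[symmetric] x[symmetric] by (simp add: algebra_simps)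
  also have "\<dots> = int m * int D"
    unfolding y[symmetric] by (simp add: algebra_simps)
  finally have "int N * int a * (int x - int y) = int D"
    using Suc.hyps by simp
  then have "int (N * a) dvd int D" by (metis dvd_triv_left of_nat_mult)
  then show ?case unfolding eq1 by (simp only: int_dvd_int_iff)
qed

text \<open>\<open>Suc N * (N choose m)\<close> divides \<open>D\<close> for each
  \<open>m \<le> N\<close> and is thus at most \<open>D\<close>; adding up the binomial row gives
  \<open>Suc N * 2 ^ N \<le> Suc N * D\<close>.\<close>

lemma power2_le_if_all_dvd:
  fixes D :: nat
  assumes "0 < D" "\<And>j. 0 < j \<Longrightarrow> j \<le> Suc N \<Longrightarrow> j dvd D"
  shows "2 ^ N \<le> D"
proof -
  have "Suc N * (N choose m) \<le> D" if "m \<le> N" for m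
  proof (rule dvd_imp_le)
    have "Suc m * (Suc N choose Suc m) dvd D"
      using that assms(2) by (intro binomial_dvd_if_all_dvd) auto
    then show "Suc N * (N choose m) dvd D" by (simp only: Suc_times_binomial)
  qed (fact assms(1))
  then have "(\<Sum>m\<le>N. Suc N * (N choose m)) \<le> (\<Sum>m\<le>N. D)" by (intro sum_mono) auto
  then have "Suc N * 2 ^ N \<le> Suc N * D"
    by (simp only: sum_distrib_left[symmetric] choose_row_sum sum_constant) simp
  then show ?thesis by (simp only: mult_le_cancel1)
qed

section \<open>Graphs and the bucket sketch of a neighbourhood\<close>

definition nbrs :: "nat set set \<Rightarrow> nat \<Rightarrow> nat set" where
  "nbrs E v = {u. {v, u} \<in> E}"

definition graph_on :: "nat \<Rightarrow> nat set set \<Rightarrow> bool" where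
  "graph_on n E \<longleftrightarrow> (\<forall>e \<in> E. \<exists>u \<in> {1..n}. \<exists>v \<in> {1..n}. u \<noteq> v \<and> e = {u, v})"

definition component :: "nat set set \<Rightarrow> nat \<Rightarrow> nat set" where
  "component E v = (adjacency E)\<^sup>* `` {v}"

text \<open>Buckets are numbered by \<open>j = m * Q + r\<close> with modulus \<open>m\<close> and residue \<open>r\<close>; those with \<open>m = 0\<close>
  stay empty.\<close>

definition cell :: "nat \<Rightarrow> nat set \<Rightarrow> nat \<Rightarrow> nat set" where
  "cell Q X j = {u \<in> X. 0 < j div Q \<and> u mod (j div Q) = j mod Q}"

lemma nbrs_subset: "graph_on n E \<Longrightarrow> nbrs E v \<subseteq> {1..n} - {v}"
  unfolding graph_on_def nbrs_def by (fastforce simp: doubleton_eq_iff)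

lemma finite_nbrs: "graph_on n E \<Longrightarrow> finite (nbrs E v)"
  using nbrs_subset[of n E v] by (rule finite_subset) auto

lemma cell_subset: "cell Q X j \<subseteq> X"
  by (auto simp: cell_def)

lemma finite_cell: "finite X \<Longrightarrow> finite (cell Q X j)"
  using cell_subset by (rule finite_subset)

text \<open>Bucket number \<open>Q\<close> has modulus 1 and residue 0, so the sketch contains the
  degree without an extra counter.\<close>

lemma cell_degree: "1 < Q \<Longrightarrow> cell Q X Q = X"
  by (auto simp: cell_def)

text \<open>The product \<open>D\<close> of the distances from \<open>u\<close> to the other
  elements is smaller than \<open>2 ^ (L * k)\<close>, so some positive number up to
  \<open>L * k + 1\<close> does not divide it. Such a modulus divides no single distance and
  therefore isolates \<open>u\<close>. The value \<open>L * k + 2\<close> of \<open>Q\<close> leaves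
  room for all these moduli.\<close>

lemma ex_singleton_cell:
  assumes "X \<subseteq> {1..n}" "n < 2 ^ L" "u \<in> X" "card X \<le> k"
  shows "\<exists>j < (L * k + 2) * (L * k + 2). cell (L * k + 2) X j = {u}"
proof -
  define Q where "Q = L * k + 2"
  define D where "D = (\<Prod>x \<in> X - {u}. nat \<bar>int u - int x\<bar>)"
  note sub = assms(1)
  have fin: "finite X" using sub by (rule finite_subset) simp
  have "D > 0" unfolding D_def using fin by (intro prod_pos) auto
  have "D \<le> (\<Prod>x \<in> X - {u}. 2 ^ L)"
    unfolding D_def
  proof (intro prod_mono conjI)
    fix x assume "x \<in> X - {u}"
    then have "x \<in> {1..n}" "u \<in> {1..n}" using sub assms(3) by auto
    then have "nat \<bar>int u - int x\<bar> \<le> n" by auto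
    then show "nat \<bar>int u - int x\<bar> \<le> 2 ^ L" using assms(2) by linarith
  qed simp
  also have "\<dots> = (2 ^ L) ^ (card X - 1)"
    using assms(3) fin by simp
  also have "\<dots> < (2 ^ L) ^ k"
  proof (rule power_strict_increasing)
    have "card X > 0" using assms(3) fin by (auto simp: card_gt_0_iff)
    then show "card X - 1 < k" using assms(4) by linarith
    have "u \<in> {1..n}" using assms(3) sub by blast
    then have "L \<noteq> 0" using assms(2) by (intro notI) simp
    then show "1 < (2::nat) ^ L" by (intro one_less_power) auto
  qed
  finally have "\<not> 2 ^ (L * k) \<le> D" by (simp add: power_mult)
  then obtain m where m: "0 < m" "m \<le> Suc (L * k)" "\<not> m dvd D"
    using power2_le_if_all_dvd[OF \<open>D > 0\<close>, of "L * k"] by blast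
  have mQ: "m < Q" using m(2) by (simp add: Q_def)
  have sep: "x mod m \<noteq> u mod m" if "x \<in> X" "x \<noteq> u" for x
  proof
    assume "x mod m = u mod m"
    then have "int m dvd int u - int x"
      by (metis mod_eq_dvd_iff of_nat_mod)
    then have "m dvd nat \<bar>int u - int x\<bar>" by (simp add: int_dvd_int_iff[symmetric] del: int_dvd_int_iff)
    also have "\<dots> dvd D" unfolding D_def using that fin by (intro dvd_prodI) auto
    finally show False using m(3) by simp
  qed
  have um: "u mod m < Q" using m(1) mQ by (meson less_trans mod_less_divisor)
  have "(m * Q + u mod m) div Q = m" "(m * Q + u mod m) mod Q = u mod m"
    using um by auto
  then have "cell Q X (m * Q + u mod m) = {u}"
    using assms(3) sep m(1) by (auto simp: cell_def)
  moreover have "m * Q + u mod m < Q * Q"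
  proof -
    have "m * Q + u mod m < Suc m * Q" using um by simp
    also have "\<dots> \<le> Q * Q" using mQ by (intro mult_right_mono) auto
    finally show ?thesis .
  qed
  ultimately show ?thesis unfolding Q_def by blast
qed

lemma cell_eq_singleton: "card (cell Q X j) = 1 \<Longrightarrow> cell Q X j = {\<Sum>(cell Q X j)}"
  by (erule card_1_singletonE) simp

section \<open>Connected components and their least vertices\<close>

lemma sym_adjacency: "sym (adjacency E)"
  by (auto simp: sym_def adjacency_def insert_commute)

lemma equiv_adjacency: "equiv UNIV ((adjacency E)\<^sup>*)"
  by (intro equivI) (auto simp: refl_rtrancl trans_rtrancl sym_rtrancl sym_adjacency)

lemma self_in_component [simp]: "v \<in> component E v"
  by (auto simp: component_def)

lemma component_nbrs: "x \<in> component E v \<Longrightarrow> nbrs E x \<subseteq> component E v"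
  by (auto simp: component_def nbrs_def adjacency_def intro: rtrancl_into_rtrancl)

lemma component_eq: "x \<in> component E v \<Longrightarrow> component E x = component E v"
  unfolding component_def using equiv_class_eq[OF equiv_adjacency, of v x] by auto

lemma component_minimal:
  assumes "v \<in> X" "\<And>x. x \<in> X \<Longrightarrow> nbrs E x \<subseteq> X"
  shows "component E v \<subseteq> X"
proof
  fix y assume "y \<in> component E v"
  then have "(v, y) \<in> (adjacency E)\<^sup>*" by (simp add: component_def)
  then show "y \<in> X"
    by (induction rule: rtrancl_induct) (use assms in \<open>auto simp: adjacency_def nbrs_def\<close>)
qed

lemma component_subset: "graph_on n E \<Longrightarrow> v \<in> {1..n} \<Longrightarrow> component E v \<subseteq> {1..n}"
  by (rule component_minimal) (use nbrs_subset in blast)+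

lemma components_eq: "components n E = component E ` {1..n}"
  by (auto simp: components_def component_def quotient_def)

lemma components_disjoint:
  assumes "C \<in> components n E" "C' \<in> components n E" "C \<noteq> C'"
  shows "C \<inter> C' = {}"
  using assms component_eq unfolding components_eq by blast

definition small_comps :: "nat \<Rightarrow> nat \<Rightarrow> nat set set \<Rightarrow> nat set set" where
  "small_comps k n E = {C \<in> components n E. card C \<le> k}"

definition estimate :: "nat \<Rightarrow> nat \<Rightarrow> nat \<Rightarrow> nat set set \<Rightarrow> nat set \<Rightarrow> nat" where
  "estimate k q n E S = (\<Sum>C | C \<in> small_comps k n E \<and> C \<subseteq> S. q ^ card C)"

definition leader :: "nat \<Rightarrow> nat set set \<Rightarrow> nat set \<Rightarrow> nat \<Rightarrow> bool" where
  "leader k E S v \<longleftrightarrow> component E v \<subseteq> S \<and> card (component E v) \<le> k \<and> (\<forall>u \<in> component E v. v \<le> u)"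

lemma finite_small_comps: "finite (small_comps k n E)"
  by (auto simp: small_comps_def components_eq)

text \<open>A component is determined by its least vertex: \<open>Min\<close> and
  \<open>component E\<close> are mutually inverse between the counted components and their leaders.
  The report program sums over leaders, as it only meets individual vertices.\<close>

lemma estimate_leaders:
  assumes "graph_on n E" "S \<subseteq> {1..n}"
  shows "estimate k q n E S = (\<Sum>v | v \<in> S \<and> leader k E S v. q ^ card (component E v))"
proof -
  have eq: "component E (Min C) = C \<and> Min C \<in> C" if "C \<in> small_comps k n E" for C
  proof -
    have "C \<in> component E ` {1..n}" using that by (simp add: small_comps_def components_eq)
    then obtain v where v: "C = component E v" "v \<in> {1..n}" by (rule imageE)
    have "finite C" using component_subset[OF assms(1) v(2)] v(1) by (auto intro: finite_subset)
    moreover have "C \<noteq> {}" using v(1) self_in_component by blast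
    ultimately have "Min C \<in> C" by (rule Min_in)
    then show ?thesis using component_eq v(1) by metis
  qed
  show ?thesis unfolding estimate_def
  proof (rule sum.reindex_bij_witness[where i = "component E" and j = Min])
    fix C assume C: "C \<in> {C \<in> small_comps k n E. C \<subseteq> S}"
    then have "finite C" using assms(2) by (auto intro: finite_subset)
    then show "component E (Min C) = C" "Min C \<in> {v \<in> S. leader k E S v}"
        "q ^ card (component E (Min C)) = q ^ card C"
      using C eq[of C] by (auto simp: leader_def small_comps_def)
  next
    fix v assume v: "v \<in> {v \<in> S. leader k E S v}"
    then have "finite (component E v)" using assms(2) by (auto simp: leader_def intro: finite_subset)
    then show "Min (component E v) = v" "component E v \<in> {C \<in> small_comps k n E. C \<subseteq> S}"
      using v assms(2) by (auto simp: leader_def small_comps_def components_eq intro!: Min_eqI)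
  qed
qed

lemma num_small_components_eq:
  assumes "k = nat \<lfloor>1 / \<epsilon>\<rfloor>" "0 < \<epsilon>"
  shows "num_small_components \<epsilon> n E = card (small_comps k n E)"
proof -
  have "real (card C) \<le> 1 / \<epsilon> \<longleftrightarrow> card C \<le> k" for C :: "nat set"
    using assms by (simp add: le_nat_iff le_floor_iff)
  then show ?thesis by (simp add: num_small_components_def small_comps_def)
qed

lemma card_small_comps: "card (small_comps k n E) \<le> n"
proof -
  have "card (small_comps k n E) \<le> card (component E ` {1..n})"
    by (rule card_mono) (auto simp: small_comps_def components_eq)
  also have "\<dots> \<le> n" using card_image_le[of "{1..n}" "component E"] by simp
  finally show ?thesis .
qed

lemma valid_stream_snoc:
  "valid_stream n (\<sigma> @ [u]) \<longleftrightarrow> valid_stream n \<sigma> \<and> valid_update n (stream_graph \<sigma>) u"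
  unfolding valid_stream_def by (auto simp: nth_append less_Suc_eq)

lemma graph_on_update:
  "graph_on n E \<Longrightarrow> valid_update n E u \<Longrightarrow> graph_on n (apply_update E u)"
  by (cases u) (fastforce simp: graph_on_def)+

lemma graph_on_stream: "valid_stream n \<sigma> \<Longrightarrow> graph_on n (stream_graph \<sigma>)"
proof (induction \<sigma> rule: rev_induct)
  case Nil
  then show ?case by (simp add: stream_graph_def graph_on_def)
next
  case (snoc u \<sigma>)
  then show ?case
    using graph_on_update[of n "stream_graph \<sigma>" u] by (simp add: valid_stream_snoc stream_graph_def)
qed

section \<open>Sampling\<close>

text \<open>The accumulator and the raw \<open>w\<close>-bit word make the recursion unfold in
  lockstep with the initialisation loop. Sampled vertices are appended, which keeps the list
  increasing.\<close>

fun sample :: "nat \<Rightarrow> nat \<Rightarrow> nat list \<Rightarrow> nat list \<Rightarrow> nat list pmf" where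
  "sample w q [] xs = return_pmf xs"
| "sample w q (v # vs) xs = bind_pmf (pmf_of_set {..<2 ^ w})
     (\<lambda>r. sample w q vs (if r mod q = 0 then xs @ [v] else xs))"

lemma finite_set_pmf_sample: "finite (set_pmf (sample w q vs xs))"
  by (induction vs arbitrary: xs) (auto simp: set_pmf_of_set lessThan_empty_iff)

text \<open>By divisibility exactly \<open>2 ^ w div q\<close> words are multiples of
  \<open>q\<close>, so the coin has no rounding error. This is the reason for taking a power of two
  as \<open>q\<close>.\<close>

lemma coin_bernoulli:
  assumes "q dvd 2 ^ w"
  shows "map_pmf (\<lambda>r. r mod q = 0) (pmf_of_set {..<2 ^ w}) = bernoulli_pmf (1 / real q)"
proof (rule pmf_eqI)
  fix b
  have q: "q > 0" using assms by (auto intro!: gr0I)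
  obtain z where z: "2 ^ w = q * z" using assms by auto
  have "{r. r < 2 ^ w \<and> r mod q = 0} = (\<lambda>i. q * i) ` {..<z}"
    using q by (auto simp: z mod_eq_0_iff_dvd elim!: dvdE)
  then have "card {r. r < 2 ^ w \<and> r mod q = 0} = z"
    using q by (simp add: card_image inj_on_def)
  then have "measure_pmf.prob (pmf_of_set {..<2 ^ w}) {r. r mod q = 0} = real z / real (2 ^ w)"
    by (subst measure_pmf_of_set) (auto simp: lessThan_empty_iff Int_def)
  also have "\<dots> = 1 / real q"
    using q z by (auto simp: z[symmetric] field_simps simp flip: of_nat_mult)
  finally have True: "pmf (map_pmf (\<lambda>r. r mod q = 0) (pmf_of_set {..<2 ^ w})) True = 1 / real q"
    by (simp add: pmf_map vimage_def)
  show "pmf (map_pmf (\<lambda>r. r mod q = 0) (pmf_of_set {..<2 ^ w})) b = pmf (bernoulli_pmf (1 / real q)) b"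
    using q True by (cases b) (auto simp: pmf_False_conv_True)
qed

lemma sample_bernoulli:
  assumes "q dvd 2 ^ w"
  shows "sample w q (v # vs) xs =
    bind_pmf (bernoulli_pmf (1 / real q)) (\<lambda>b. sample w q vs (if b then xs @ [v] else xs))"
  by (simp add: coin_bernoulli[OF assms, symmetric] bind_map_pmf)

lemma set_pmf_sample:
  "ys \<in> set_pmf (sample w q vs xs) \<Longrightarrow> sorted_wrt (<) (xs @ vs) \<Longrightarrow>
     sorted_wrt (<) ys \<and> set ys \<subseteq> set xs \<union> set vs"
proof (induction vs arbitrary: xs ys)
  case (Cons v vs)
  then obtain r where "ys \<in> set_pmf (sample w q vs (if r mod q = 0 then xs @ [v] else xs))"
    by auto
  moreover have "sorted_wrt (<) ((xs @ [v]) @ vs)" "sorted_wrt (<) (xs @ vs)"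
    using Cons.prems(2) by (auto simp: sorted_wrt_append)
  ultimately show ?case
    using Cons.IH[of ys "xs @ [v]"] Cons.IH[of ys xs] by (cases "r mod q = 0") auto
qed simp

lemma prob_bind_bernoulli:
  assumes "0 \<le> p" "p \<le> 1"
  shows "measure_pmf.prob (bind_pmf (bernoulli_pmf p) f) X =
    p * measure_pmf.prob (f True) X + (1 - p) * measure_pmf.prob (f False) X"
proof -
  have prob_eq: "measure_pmf.prob M X = pmf (map_pmf (\<lambda>x. x \<in> X) M) True" for M
    by (simp add: pmf_map vimage_def)
  show ?thesis
    unfolding prob_eq map_bind_pmf pmf_bind using assms by simp
qed

text \<open>Each vertex of \<open>C\<close> not yet in \<open>xs\<close> costs a factor
  \<open>1 / q\<close>, and a vertex of \<open>C\<close> in neither list makes the event impossible.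
  Inclusion probabilities of sets replace an explicit notion of independence.\<close>

lemma prob_sample_superset:
  assumes "q dvd 2 ^ w" "distinct vs" "set vs \<inter> set xs = {}" "finite C"
  shows "measure_pmf.prob (sample w q vs xs) {ys. C \<subseteq> set ys} =
    (if C \<subseteq> set xs \<union> set vs then (1 / real q) ^ card (C - set xs) else 0)"
  using assms(2,3)
proof (induction vs arbitrary: xs)
  case Nil
  then show ?case by (auto simp: Diff_eq_empty_iff[THEN iffD2])
next
  case (Cons v vs)
  define p where "p = 1 / real q"
  have "q > 0" using assms(1) by (auto intro!: gr0I)
  then have p: "0 \<le> p" "p \<le> 1" by (auto simp: p_def)
  have "measure_pmf.prob (sample w q (v # vs) xs) {ys. C \<subseteq> set ys} =
    p * measure_pmf.prob (sample w q vs (xs @ [v])) {ys. C \<subseteq> set ys} +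
    (1 - p) * measure_pmf.prob (sample w q vs xs) {ys. C \<subseteq> set ys}"
    using p by (simp add: sample_bernoulli[OF assms(1)] prob_bind_bernoulli p_def del: sample.simps)
  also have "\<dots> = (if C \<subseteq> set xs \<union> set (v # vs) then p ^ card (C - set xs) else 0)"
  proof (cases "C \<subseteq> set xs \<union> set (v # vs)")
    case True
    show ?thesis
    proof (cases "v \<in> C")
      case v: True
      have "C - set xs = insert v (C - set (xs @ [v]))" using v Cons.prems by auto
      moreover have "card (insert v (C - set (xs @ [v]))) = Suc (card (C - set (xs @ [v])))"
        using assms(4) by (intro card_insert_disjoint) auto
      ultimately have "card (C - set xs) = Suc (card (C - set (xs @ [v])))"
        by (simp only:)
      moreover have "\<not> C \<subseteq> set xs \<union> set vs" using v Cons.prems by auto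
      moreover have "C \<subseteq> set (xs @ [v]) \<union> set vs" using True by auto
      ultimately show ?thesis using True Cons.prems by (simp add: Cons.IH p_def)
    next
      case v: False
      then have "C - set (xs @ [v]) = C - set xs" "C \<subseteq> set xs \<union> set vs" using True by auto
      moreover have "C \<subseteq> set (xs @ [v]) \<union> set vs" using True by auto
      ultimately show ?thesis using True Cons.prems
        by (simp add: Cons.IH p_def[symmetric]) (simp add: algebra_simps)
    qed
  next
    case False
    then have "\<not> C \<subseteq> set (xs @ [v]) \<union> set vs" "\<not> C \<subseteq> set xs \<union> set vs" by auto
    then show ?thesis using False Cons.prems by (simp add: Cons.IH)
  qed
  finally show ?case by (simp add: p_def)
qed


lemma prob_sample_superset_upt:
  assumes "q dvd 2 ^ w" "C \<subseteq> {1..n}"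
  shows "measure_pmf.prob (sample w q [1..<Suc n] []) {ys. C \<subseteq> set ys} = 1 / real q ^ card C"
proof -
  have "finite C" "C \<subseteq> set [1..<Suc n]" using assms(2) by (auto intro: finite_subset)
  then show ?thesis
    using prob_sample_superset[OF assms(1), of "[1..<Suc n]" "[]" C]
    by (simp add: power_one_over del: upt_Suc)
qed

text \<open>The square expands into pairs of components, and the product of two indicators is the
  indicator of the union. For distinct, hence disjoint, components
  \<open>card (C \<union> C') = card C + card C'\<close>, so the mixed terms vanish and the diagonal
  remains.\<close>

lemma estimate_mean_square:
  assumes "graph_on n E" "q dvd 2 ^ w"
  shows "measure_pmf.expectation (sample w q [1..<Suc n] [])
      (\<lambda>ys. (real (estimate k q n E (set ys)) - real (card (small_comps k n E)))\<^sup>2) =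
    (\<Sum>C \<in> small_comps k n E. real q ^ card C - 1)"
proof -
  define M where "M = sample w q [1..<Suc n] []"
  define F where "F = small_comps k n E"
  define b where "b C ys = indicat_real {ys. C \<subseteq> set ys} ys" for C and ys :: "nat list"
  have int: "integrable (measure_pmf M) f" for f :: "nat list \<Rightarrow> real"
    unfolding M_def by (intro integrable_measure_pmf_finite finite_set_pmf_sample)
  have "q > 0" using assms(2) by (auto intro!: gr0I)
  have F: "C \<subseteq> {1..n}" if "C \<in> F" for C
    using that component_subset[OF assms(1)] unfolding F_def small_comps_def components_eq by blast
  have finF: "finite F" unfolding F_def by (rule finite_small_comps)
  have Eb: "measure_pmf.expectation M (b C) = 1 / real q ^ card C" if "C \<subseteq> {1..n}" for C
    unfolding b_def M_def using prob_sample_superset_upt[OF assms(2) that] by simp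
  have est: "real (estimate k q n E (set ys)) = (\<Sum>C \<in> F. real q ^ card C * b C ys)" for ys
  proof -
    have "(\<Sum>C \<in> F. real q ^ card C * b C ys) = (\<Sum>C \<in> {C \<in> F. C \<subseteq> set ys}. real q ^ card C * b C ys)"
      by (rule sum.mono_neutral_right) (auto simp: finF b_def)
    also have "\<dots> = (\<Sum>C \<in> {C \<in> F. C \<subseteq> set ys}. real q ^ card C)"
      by (rule sum.cong) (auto simp: b_def)
    finally show ?thesis by (simp add: estimate_def F_def)
  qed
  have sq: "(real (estimate k q n E (set ys)) - real (card F))\<^sup>2 =
      (\<Sum>C \<in> F. \<Sum>C' \<in> F. real q ^ (card C + card C') * b (C \<union> C') ys
         - real q ^ card C * b C ys - real q ^ card C' * b C' ys + 1)" for ys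
  proof -
    have "real (estimate k q n E (set ys)) - real (card F) = (\<Sum>C \<in> F. real q ^ card C * b C ys - 1)"
      by (simp add: est sum_subtractf)
    moreover have "b (C \<union> C') ys = b C ys * b C' ys" for C C'
      by (auto simp: b_def indicator_def)
    ultimately show ?thesis
      by (simp add: power2_eq_square sum_product algebra_simps power_add)
  qed
  have cov: "measure_pmf.expectation M (\<lambda>ys. real q ^ (card C + card C') * b (C \<union> C') ys
         - real q ^ card C * b C ys - real q ^ card C' * b C' ys + 1) =
      (if C = C' then real q ^ card C - 1 else 0)" if CC: "C \<in> F" "C' \<in> F" for C C'
  proof -
    have "measure_pmf.expectation M (\<lambda>ys. real q ^ (card C + card C') * b (C \<union> C') ys
         - real q ^ card C * b C ys - real q ^ card C' * b C' ys + 1) =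
       real q ^ (card C + card C') * measure_pmf.expectation M (b (C \<union> C'))
         - real q ^ card C * measure_pmf.expectation M (b C)
         - real q ^ card C' * measure_pmf.expectation M (b C') + 1"
      by (simp add: int)
    \<comment> \<open>The last three summands are \<open>- 1 - 1 + 1\<close>, as each weighted
      indicator has expectation 1.\<close>
    also have "\<dots> = real q ^ (card C + card C') / real q ^ card (C \<union> C') - 1"
      using F[OF CC(1)] F[OF CC(2)] \<open>q > 0\<close> by (simp add: Eb)
    also have "\<dots> = (if C = C' then real q ^ card C - 1 else 0)"
    proof (cases "C = C'")
      case True
      then show ?thesis using \<open>q > 0\<close> by (simp add: power_add)
    next
      case False
      then have "C \<inter> C' = {}"
        using CC unfolding F_def small_comps_def by (intro components_disjoint[of C n E]) auto
      then have "card (C \<union> C') = card C + card C'"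
        using F CC by (intro card_Un_disjoint) (auto intro: finite_subset)
      then show ?thesis using False \<open>q > 0\<close> by simp
    qed
    finally show ?thesis .
  qed
  have "measure_pmf.expectation M (\<lambda>ys. (real (estimate k q n E (set ys)) - real (card F))\<^sup>2) =
      (\<Sum>C \<in> F. \<Sum>C' \<in> F. if C = C' then real q ^ card C - 1 else 0)"
    unfolding sq by (simp only: Bochner_Integration.integral_sum int cov cong: sum.cong)
  also have "\<dots> = (\<Sum>C \<in> F. real q ^ card C - 1)"
    using finF by simp
  finally show ?thesis by (simp add: M_def F_def)
qed

lemma sample_length_mean:
  assumes "q dvd 2 ^ w"
  shows "measure_pmf.expectation (sample w q [1..<Suc n] []) (\<lambda>ys. real (length ys)) = real n / real q"
proof -
  define M where "M = sample w q [1..<Suc n] []"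
  have int: "integrable (measure_pmf M) f" for f :: "nat list \<Rightarrow> real"
    unfolding M_def by (intro integrable_measure_pmf_finite finite_set_pmf_sample)
  have len: "real (length ys) = (\<Sum>v \<in> {1..n}. indicat_real {ys. {v} \<subseteq> set ys} ys)"
    if ys: "ys \<in> set_pmf M" for ys
  proof -
    have *: "sorted_wrt (<) ys \<and> set ys \<subseteq> {1..n}"
      using set_pmf_sample[OF ys[unfolded M_def]] by (auto simp: subset_iff simp del: upt_Suc)
    then have "distinct ys" by (simp add: strict_sorted_iff)
    then have "length ys = card (set ys)" by (simp add: distinct_card)
    also have "set ys = {v \<in> {1..n}. v \<in> set ys}" using * by auto
    finally show ?thesis by (simp add: indicator_def sum.If_cases Int_def)
  qed
  have "measure_pmf.expectation M (\<lambda>ys. real (length ys)) =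
      measure_pmf.expectation M (\<lambda>ys. \<Sum>v \<in> {1..n}. indicat_real {ys. {v} \<subseteq> set ys} ys)"
    by (rule integral_cong_AE) (auto simp: AE_measure_pmf_iff len)
  also have "\<dots> = (\<Sum>v \<in> {1..n}. measure_pmf.prob M {ys. {v} \<subseteq> set ys})"
    by (subst Bochner_Integration.integral_sum) (auto simp: int)
  also have "\<dots> = (\<Sum>v \<in> {1..n}. 1 / real q)"
    unfolding M_def by (intro sum.cong refl, subst prob_sample_superset_upt[OF assms]) auto
  finally show ?thesis by (simp add: M_def)
qed

text \<open>Two bad events of probability at most 1/6 each: a large error of the untruncated
  estimate (Chebyshev) and a sample of at least \<open>cap\<close> vertices (Markov). Outside the
  second one \<open>take cap\<close> is the identity. This fixes both constants 6.\<close>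

lemma sample_concentration:
  assumes "graph_on n E" "q dvd 2 ^ w" "0 < n" "0 < \<delta>"
    and "real q ^ k - 1 \<le> \<delta>\<^sup>2 * real n / 6" "6 * n \<le> q * cap"
  shows "2 / 3 \<le> measure_pmf.prob (sample w q [1..<Suc n] [])
     {ys. \<bar>real (estimate k q n E (set (take cap ys))) - real (card (small_comps k n E))\<bar> \<le> \<delta> * real n}"
    (is "_ \<le> measure_pmf.prob ?M ?G")
proof -
  define err where "err ys = real (estimate k q n E (set ys)) - real (card (small_comps k n E))" for ys
  have int: "integrable (measure_pmf ?M) f" for f :: "nat list \<Rightarrow> real"
    by (intro integrable_measure_pmf_finite finite_set_pmf_sample)
  have "q > 0" using assms(2) by (auto intro!: gr0I)
  have "cap > 0" using assms(3,6) by (auto intro!: gr0I)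
  have "measure_pmf.prob ?M {ys. (err ys)\<^sup>2 \<ge> (\<delta> * real n)\<^sup>2} \<le>
      measure_pmf.expectation ?M (\<lambda>ys. (err ys)\<^sup>2) / (\<delta> * real n)\<^sup>2"
    using integral_Markov_inequality_measure[OF int, of "{}" "\<lambda>ys. (err ys)\<^sup>2" "(\<delta> * real n)\<^sup>2"] assms(3,4)
    by (simp del: upt_Suc)
  also have "measure_pmf.expectation ?M (\<lambda>ys. (err ys)\<^sup>2) = (\<Sum>C \<in> small_comps k n E. real q ^ card C - 1)"
    unfolding err_def using assms by (intro estimate_mean_square)
  also have "\<dots> \<le> (\<Sum>C \<in> small_comps k n E. \<delta>\<^sup>2 * real n / 6)"
  proof (rule sum_mono)
    fix C assume "C \<in> small_comps k n E"
    then have "real q ^ card C \<le> real q ^ k"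
      using \<open>q > 0\<close> by (intro power_increasing) (auto simp: small_comps_def)
    then show "real q ^ card C - 1 \<le> \<delta>\<^sup>2 * real n / 6" using assms(5) by linarith
  qed
  also have "\<dots> \<le> real n * (\<delta>\<^sup>2 * real n / 6)"
    using card_small_comps[of k n E] by (simp add: mult_right_mono)
  finally have "measure_pmf.prob ?M {ys. (err ys)\<^sup>2 \<ge> (\<delta> * real n)\<^sup>2} \<le>
      real n * (\<delta>\<^sup>2 * real n / 6) / (\<delta> * real n)\<^sup>2"
    using assms(3,4) by (simp add: divide_right_mono del: upt_Suc)
  also have "\<dots> = 1 / 6" using assms(3,4) by (simp add: field_simps power2_eq_square)
  finally have 1: "measure_pmf.prob ?M {ys. (err ys)\<^sup>2 \<ge> (\<delta> * real n)\<^sup>2} \<le> 1 / 6" .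
  have "measure_pmf.prob ?M {ys. real (length ys) \<ge> real cap} \<le> real n / real q / real cap"
    using integral_Markov_inequality_measure[OF int, of "{}" "\<lambda>ys. real (length ys)" "real cap"] \<open>cap > 0\<close>
    unfolding sample_length_mean[OF assms(2)] by (simp del: upt_Suc)
  also have "\<dots> \<le> 1 / 6"
  proof -
    have "6 * real n \<le> real q * real cap" using of_nat_mono[OF assms(6), where 'a = real] by simp
    then show ?thesis using \<open>q > 0\<close> \<open>cap > 0\<close> by (simp add: field_simps)
  qed
  finally have 2: "measure_pmf.prob ?M {ys. real (length ys) \<ge> real cap} \<le> 1 / 6" .
  have "UNIV - ?G \<subseteq> {ys. (err ys)\<^sup>2 \<ge> (\<delta> * real n)\<^sup>2} \<union> {ys. real (length ys) \<ge> real cap}"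
  proof
    fix ys assume ys: "ys \<in> UNIV - ?G"
    show "ys \<in> {ys. (err ys)\<^sup>2 \<ge> (\<delta> * real n)\<^sup>2} \<union> {ys. real (length ys) \<ge> real cap}"
    proof (cases "length ys \<ge> cap")
      case False
      then have "\<bar>\<delta> * real n\<bar> \<le> \<bar>err ys\<bar>" using ys assms(3,4) by (simp add: err_def)
      then show ?thesis by (simp add: abs_le_square_iff)
    qed simp
  qed
  then have "measure_pmf.prob ?M (UNIV - ?G) \<le>
      measure_pmf.prob ?M ({ys. (err ys)\<^sup>2 \<ge> (\<delta> * real n)\<^sup>2} \<union> {ys. real (length ys) \<ge> real cap})"
    by (intro measure_pmf.finite_measure_mono) auto
  also have "\<dots> \<le> 1 / 6 + 1 / 6"
    using measure_Un_le[of "{ys. (err ys)\<^sup>2 \<ge> (\<delta> * real n)\<^sup>2}" "measure_pmf ?M" "{ys. real (length ys) \<ge> real cap}"] 1 2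
    by (simp del: upt_Suc)
  finally show ?thesis
    using measure_pmf.prob_compl[of ?G ?M] by (simp del: upt_Suc)
qed

section \<open>Memory layout and binary search\<close>

text \<open>Cells below 40 are registers: 2 -- \<open>Q\<close> (moduli are \<open>1..<Q\<close>), 3 -- \<open>J = Q * Q\<close>, 4 -- record
  length \<open>Z\<close>, 5 -- \<open>q\<close>, 6 -- capacity, 7 -- \<open>2 ^ L > n\<close>, 8 -- number of sampled vertices, 9 and 10 --
  vertex arguments, 11 -- index found by the search, 15 -- loop counter, 17 -- root of the
  exploration, 18 -- \<open>J\<close> times the queue length (0 after a failure), 19 -- \<open>q\<close> to the queue length,
  21 -- \<open>k * J\<close>, 22 -- \<open>n + 1\<close>; 0 and 1 hold the output. The queue occupies cells \<open>40..<base k\<close>. The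
  record of the \<open>p\<close>-th sampled vertex consists of its number, a mark and \<open>J\<close> pairs (count, sum), and
  starts at \<open>base k + p * Z\<close>. Index 0 is a sentinel with vertex number 0, so that the binary search
  always ends at a valid record.\<close>

abbreviation reg :: "nat \<Rightarrow> operand" where "reg a \<equiv> At (Direct a)"
abbreviation deref :: "nat \<Rightarrow> operand" where "deref a \<equiv> At (Indirect a)"

definition base :: "nat \<Rightarrow> nat" where "base k = 40 + k"

text \<open>Binary lifting: register 11 is raised by the descending powers of two in register 12
  whenever the entry reached exists and does not exceed the key in register 9.\<close>

definition find_step :: "nat \<Rightarrow> cmd list" where
  "find_step k = [
     Assign (Direct 13) Plus (reg 11) (reg 12),
     Cond (Less (reg 8) (reg 13)) [] [
       Assign (Direct 14) Times (reg 13) (reg 4),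
       Assign (Direct 14) Plus (reg 14) (Const (base k)),
       Cond (Less (reg 9) (deref 14)) [] [Assign (Direct 11) Plus (reg 13) (Const 0)]],
     Assign (Direct 12) Div (reg 12) (Const 2)]"

definition find_prog :: "nat \<Rightarrow> cmd list" where
  "find_prog k = [
     Assign (Direct 11) Plus (Const 0) (Const 0),
     Assign (Direct 12) Plus (reg 7) (Const 0),
     While (Less (Const 0) (reg 12)) (find_step k),
     Assign (Direct 14) Times (reg 11) (reg 4),
     Assign (Direct 14) Plus (reg 14) (Const (base k))]"

definition agree :: "nat set \<Rightarrow> memory \<Rightarrow> memory \<Rightarrow> bool" where
  "agree X m m' \<longleftrightarrow> (\<forall>a. a \<notin> X \<longrightarrow> m a = m' a)"

lemma agree_refl [simp]: "agree X m m" by (simp add: agree_def)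

lemma agree_upd [simp]: "a \<in> X \<Longrightarrow> agree X (m(a := v)) m' \<longleftrightarrow> agree X m m'"
  by (auto simp: agree_def)

lemma agreeD: "agree X m m' \<Longrightarrow> a \<notin> X \<Longrightarrow> m a = m' a" by (simp add: agree_def)

lemma agree_trans: "agree X m m' \<Longrightarrow> agree X m' m'' \<Longrightarrow> agree X m m''" by (simp add: agree_def)

lemma fits_upd [simp]: "fits A m \<Longrightarrow> a < A \<Longrightarrow> fits A (m(a := v))"
  by (auto simp: fits_def)

text \<open>The inequalities with \<open>2 ^ w\<close> exclude overflow of addresses
  (\<open>A_less\<close>), of the search position plus its increment (\<open>L_less\<close>), of
  bucket sums and the accumulated estimate (\<open>n2_less\<close>), and of the merged loop counter
  (\<open>kJ_less\<close>). \<open>q ^ k \<le> n\<close> bounds the weight of a component.\<close>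

locale sketch = ram w inp A for w inp A +
  fixes n k L q cap :: nat
  assumes n_pos: "0 < n" and k_pos: "0 < k" and n_less: "n < 2 ^ L"
    and q_pos: "0 < q" and q_pow: "q ^ k \<le> n"
    and A_eq: "A = base k + Suc cap * (2 * ((L * k + 2) * (L * k + 2)) + 2)"
    and A_less: "A < 2 ^ w" and L_less: "2 * 2 ^ L < (2::nat) ^ w" and n2_less: "n * n + n < 2 ^ w"
    and kJ_less: "k * ((L * k + 2) * (L * k + 2)) < 2 ^ w"
begin

definition "Q = L * k + 2"
definition "J = Q * Q"
definition "Z = 2 * J + 2"
definition "rec i = i * Z + base k"

lemma A_Z: "A = base k + Suc cap * Z"
  by (simp add: A_eq Z_def J_def Q_def)

lemma Q_ge: "2 \<le> Q" by (simp add: Q_def)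
lemma Q_less_J: "Q < J" using Q_ge by (simp add: J_def)

lemma rec_ge: "40 + k \<le> rec i" by (simp add: rec_def base_def)

lemma rec_less: "i \<le> cap \<Longrightarrow> b < Z \<Longrightarrow> rec i + b < A"
proof -
  assume "i \<le> cap" "b < Z"
  then have "i * Z \<le> cap * Z" by (simp add: mult_right_mono)
  then show ?thesis unfolding rec_def A_Z mult_Suc using \<open>b < Z\<close> by linarith
qed

lemma rec_less0: "i \<le> cap \<Longrightarrow> rec i < A"
  using rec_less[of i 0] by (simp add: Z_def)

lemma rec_eq_iff: "b < Z \<Longrightarrow> b' < Z \<Longrightarrow> rec i + b = rec i' + b' \<longleftrightarrow> i = i' \<and> b = b'"
proof
  assume *: "b < Z" "b' < Z" "rec i + b = rec i' + b'"
  then have eq: "i * Z + b = i' * Z + b'" by (simp add: rec_def)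
  have "i = (i * Z + b) div Z" "i' = (i' * Z + b') div Z"
    "b = (i * Z + b) mod Z" "b' = (i' * Z + b') mod Z" using * by auto
  then show "i = i' \<and> b = b'" using eq by metis
qed auto

lemma A_ge: "40 + k \<le> A" by (simp add: A_Z base_def)

lemma numeral_less_A [simp]: "numeral a < (40::nat) \<Longrightarrow> numeral a < A" "0 < A" "Suc 0 < A"
  using A_ge by linarith+

lemma const_mod [simp]: "0 mod (2::nat) ^ w = 0" "Suc 0 mod 2 ^ w = Suc 0" "2 mod (2::nat) ^ w = 2"
  "40 mod (2::nat) ^ w = 40" "base k mod 2 ^ w = base k" "(k - Suc 0) mod 2 ^ w = k - Suc 0"
proof -
  have "41 < (2::nat) ^ w" "base k < 2 ^ w" "k - Suc 0 < 2 ^ w" using A_less k_pos by (simp_all add: A_Z base_def)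
  then show "0 mod (2::nat) ^ w = 0" "Suc 0 mod 2 ^ w = Suc 0" "2 mod (2::nat) ^ w = 2"
    "40 mod (2::nat) ^ w = 40" "base k mod 2 ^ w = base k" "(k - Suc 0) mod 2 ^ w = k - Suc 0"
    by (simp_all only: mod_less)
qed

lemma const_less [simp]: "Suc 0 < 2 ^ w" "2 < (2::nat) ^ w" "0 < (2::nat) ^ w"
proof -
  have "41 < (2::nat) ^ w" using A_less k_pos by (simp add: A_Z base_def)
  then show "Suc 0 < 2 ^ w" "2 < (2::nat) ^ w" "0 < (2::nat) ^ w" by linarith+
qed

lemma L_less_w: "L < w"
proof -
  have "2 ^ Suc L < (2::nat) ^ w" using L_less by simp
  then show ?thesis by (simp only: power_strict_increasing_iff)
qed

lemma w_pos [simp]: "0 < w" using L_less_w by simp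

definition index :: "nat list \<Rightarrow> memory \<Rightarrow> bool" where
  "index xs m \<longleftrightarrow> m 7 = 2 ^ L \<and> m 4 = Z \<and> m 8 = length xs \<and> length xs \<le> cap \<and>
     sorted_wrt (<) xs \<and> set xs \<subseteq> {1..n} \<and> (\<forall>i \<le> length xs. m (rec i) = (0 # xs) ! i)"

definition "find_time = (L + 1) * 10 + 10"

lemma index_length: "index xs m \<Longrightarrow> length xs \<le> n"
proof -
  assume "index xs m"
  then have "distinct xs" "set xs \<subseteq> {1..n}" by (auto simp: index_def strict_sorted_iff)
  then have "length xs = card (set xs)" by (simp add: distinct_card)
  also have "\<dots> \<le> card {1..n}" using \<open>set xs \<subseteq> {1..n}\<close> by (intro card_mono) auto
  finally show ?thesis by simp
qed

lemma index_sorted: "index xs m \<Longrightarrow> sorted_wrt (<) (0 # xs)"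
  by (auto simp: index_def)

lemma find_correct:
  assumes "index xs m" "fits A m" "0 < m 9"
  shows "wp (find_prog k) find_time m (\<lambda>m'. agree {11, 12, 13, 14} m' m \<and> fits A m' \<and>
    m' 11 \<le> length xs \<and> m' 14 = rec (m' 11) \<and> ((0 # xs) ! (m' 11) = m 9 \<longleftrightarrow> m 9 \<in> set xs))"
proof -
  define ids where "ids = (\<lambda>i. (0 # xs) ! i)"
  define s where "s = length xs"
  have idx: "m 7 = 2 ^ L" "m 4 = Z" "m 8 = s" "s \<le> cap" "\<And>i. i \<le> s \<Longrightarrow> m (rec i) = ids i"
    using assms(1) by (auto simp: index_def ids_def s_def)
  have "s \<le> n" using index_length[OF assms(1)] by (simp add: s_def)
  have s_less: "s < 2 ^ L" using \<open>s \<le> n\<close> n_less by linarith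
  \<comment> \<open>The current entry is at most the key, and the entry \<open>2 ^ j\<close> further
    on, if there is one, exceeds it. The start \<open>j = Suc L\<close> makes the second part
    vacuous; \<open>2 ^ j div 2\<close> is 0 at \<open>j = 0\<close>, where the loop ends and the
    next entry exceeds the key.\<close>
  define I where "I j m' \<longleftrightarrow> j \<le> Suc L \<and> agree {11, 12, 13, 14} m' m \<and> fits A m' \<and>
      m' 12 = 2 ^ j div 2 \<and> m' 11 \<le> s \<and> ids (m' 11) \<le> m 9 \<and>
      (m' 11 + 2 ^ j \<le> s \<longrightarrow> m 9 < ids (m' 11 + 2 ^ j))" for j m'
  have recZ: "rec i < 2 ^ w" "i * Z < 2 ^ w" if "i \<le> s" for i
    using rec_less0[of i] A_less that idx(4) unfolding rec_def by linarith+
  have fin: "(0 # xs) ! p = m 9 \<longleftrightarrow> m 9 \<in> set xs"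
    if p: "p \<le> s" "ids p \<le> m 9" "p + 1 \<le> s \<longrightarrow> m 9 < ids (p + 1)" for p
  proof
    assume "(0 # xs) ! p = m 9"
    \<comment> \<open>The key is positive and so cannot match the sentinel.\<close>
    then have "p \<noteq> 0" using assms(3) by (auto intro!: gr0I)
    then obtain p' where "p = Suc p'" by (cases p) auto
    then show "m 9 \<in> set xs" using p(1) \<open>(0 # xs) ! p = m 9\<close> nth_mem[of p' xs] by (simp add: s_def)
  next
    assume "m 9 \<in> set xs"
    then obtain i where i: "i < s" "xs ! i = m 9" by (auto simp: in_set_conv_nth s_def)
    then have i': "ids (Suc i) = m 9" by (simp add: ids_def)
    have mono: "ids a < ids b" if "a < b" "b \<le> s" for a b
      using sorted_wrt_nth_less[OF index_sorted[OF assms(1)], of a b] that by (simp add: ids_def s_def)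
    have "Suc i = p"
    proof (rule linorder_cases[of "Suc i" p])
      assume "Suc i < p" then show ?thesis using mono[of "Suc i" p] p i' by simp
    next
      assume *: "Suc i > p"
      then have "m 9 < ids (p + 1)" using p i by simp
      moreover have "ids (p + 1) \<le> ids (Suc i)"
        using mono[of "p + 1" "Suc i"] * i by (cases "p = i") auto
      ultimately show ?thesis using i' by simp
    qed
    then show "(0 # xs) ! p = m 9" using i' by (simp add: ids_def)
  qed
  have loop: "reaches (While (Less (Const 0) (reg 12)) (find_step k) # [
     Assign (Direct 14) Times (reg 11) (reg 4),
     Assign (Direct 14) Plus (reg 14) (Const (base k))]) (Suc L * Suc 9 + Suc 3) (m(11 := 0, 12 := 2 ^ L))
     (return_pmf ()) (\<lambda>m' _. agree {11, 12, 13, 14} m' m \<and> fits A m' \<and>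
    m' 11 \<le> length xs \<and> m' 14 = rec (m' 11) \<and> ((0 # xs) ! (m' 11) = m 9 \<longleftrightarrow> m 9 \<in> set xs))"
  proof (rule reaches_While[where I = I])
    show "I (Suc L) (m(11 := 0, 12 := 2 ^ L))"
      using s_less assms(2) by (simp add: I_def) (simp add: ids_def)
  next
    show "fits A m'" if "I j m'" for j m' using that by (simp add: I_def)
  next
    fix j m' assume inv: "I j m'" and test: "test_val w inp m' (Less (Const 0) (reg 12))"
    then obtain i where i: "j = Suc i" by (cases j) (auto simp: I_def)
    have ag: "agree {11, 12, 13, 14} m' m" using inv by (simp add: I_def)
    note fr = agreeD[OF ag]
    note inv' = inv[unfolded I_def i]
    have i_le: "(2::nat) ^ i \<le> 2 ^ L" using inv' by (intro power_increasing) auto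
    have sum_less: "m' 11 + 2 ^ i < 2 ^ w" using i_le inv' s_less L_less by linarith
    have fr_rec: "m' (rec a) = ids a" if "a \<le> s" for a
      using fr[of "rec a"] rec_ge[of a] idx(5)[OF that] by simp
    have neq: "rec a \<noteq> 13" "rec a \<noteq> 14" for a using rec_ge[of a] by auto
    show "wp (find_step k) 9 m' (\<lambda>m'. \<exists>i<j. I i m')"
      apply (rule wp_conseq[where Q = "I i"])
      using inv' sum_less
       apply (simp add: find_step_def reaches_simps fr idx recZ fr_rec neq I_def flip: rec_def)
       apply (auto simp: not_less add.assoc mult_2)
      using i by blast
  next
    fix j m' assume inv: "I j m'" and test: "\<not> test_val w inp m' (Less (Const 0) (reg 12))"
    have j: "j = 0"
    proof (rule ccontr)
      assume "j \<noteq> 0"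
      then obtain i where "j = Suc i" by (cases j) auto
      then show False using test inv by (simp add: I_def)
    qed
    have ag: "agree {11, 12, 13, 14} m' m" using inv by (simp add: I_def)
    note fr = agreeD[OF ag]
    note inv' = inv[unfolded I_def j]
    show "wp [
     Assign (Direct 14) Times (reg 11) (reg 4),
     Assign (Direct 14) Plus (reg 14) (Const (base k))] 3 m' (\<lambda>m'. agree {11, 12, 13, 14} m' m \<and> fits A m' \<and>
    m' 11 \<le> length xs \<and> m' 14 = rec (m' 11) \<and> ((0 # xs) ! (m' 11) = m 9 \<longleftrightarrow> m 9 \<in> set xs))"
      using inv' fin[of "m' 11"] by (simp add: reaches_simps fr idx recZ s_def flip: rec_def)
  qed
  show ?thesis
    unfolding find_prog_def find_time_def
    using assms(2) L_less_w by (simp add: reaches_simps idx) (rule reaches_mono_time[OF loop], simp)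
qed

end

section \<open>Updates\<close>

text \<open>One run serves the modulus in register 15: the edited neighbour lies in a single bucket
  per modulus, so an edit touches only \<open>Q - 1\<close> of the \<open>J\<close> buckets.\<close>

definition edit_step :: "cmd list" where
  "edit_step = [
     Assign (Direct 13) Mod (reg 10) (reg 15),
     Assign (Direct 16) Times (reg 15) (reg 2),
     Assign (Direct 13) Plus (reg 13) (reg 16),
     Assign (Direct 13) Plus (reg 13) (reg 13),
     Assign (Direct 13) Plus (reg 13) (reg 14),
     Assign (Direct 13) Plus (reg 13) (Const 2),
     Cond (Equal (Input 1) (Const 1)) [
       Assign (Indirect 13) Plus (deref 13) (Const 1),
       Assign (Direct 13) Plus (reg 13) (Const 1),
       Assign (Indirect 13) Plus (deref 13) (reg 10)] [
       Assign (Indirect 13) Minus (deref 13) (Const 1),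
       Assign (Direct 13) Plus (reg 13) (Const 1),
       Assign (Indirect 13) Minus (deref 13) (reg 10)],
     Assign (Direct 15) Plus (reg 15) (Const 1)]"

definition edit_prog :: "nat \<Rightarrow> cmd list" where
  "edit_prog k = find_prog k @ [
     Cond (Equal (reg 9) (deref 14)) [
       Assign (Direct 15) Plus (Const 1) (Const 0),
       While (Less (reg 15) (reg 2)) edit_step] []]"

definition sketch_update :: "nat \<Rightarrow> cmd list" where
  "sketch_update k =
     [Assign (Direct 9) Plus (Input 2) (Const 0), Assign (Direct 10) Plus (Input 3) (Const 0)] @
     edit_prog k @
     [Assign (Direct 9) Plus (Input 3) (Const 0), Assign (Direct 10) Plus (Input 2) (Const 0)] @
     edit_prog k"

lemma cell_insert:
  "cell Q (insert y X) j =
    (if 0 < j div Q \<and> y mod (j div Q) = j mod Q then insert y (cell Q X j) else cell Q X j)"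
  by (auto simp: cell_def)

lemma cell_remove: "cell Q (X - {y}) j = cell Q X j - {y}"
  by (auto simp: cell_def)

context sketch
begin

definition "cnt p j = rec p + (2 + 2 * j)"
definition "sm p j = rec p + (3 + 2 * j)"
definition "mrk p = rec p + 1"

lemma address_eq [simp]:
  "Suc (rec p) = mrk p" "Suc (cnt p j) = sm p j" "Suc (Suc (rec p + 2 * j)) = cnt p j"
  by (simp_all add: cnt_def sm_def mrk_def)

lemma address_neq [simp]:
  "numeral a < (40::nat) \<Longrightarrow> rec p \<noteq> numeral a" "numeral a < (40::nat) \<Longrightarrow> numeral a \<noteq> rec p"
  "numeral a < (40::nat) \<Longrightarrow> cnt p j \<noteq> numeral a" "numeral a < (40::nat) \<Longrightarrow> numeral a \<noteq> cnt p j"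
  "numeral a < (40::nat) \<Longrightarrow> sm p j \<noteq> numeral a" "numeral a < (40::nat) \<Longrightarrow> numeral a \<noteq> sm p j"
  "numeral a < (40::nat) \<Longrightarrow> mrk p \<noteq> numeral a" "numeral a < (40::nat) \<Longrightarrow> numeral a \<noteq> mrk p"
  using rec_ge[of p] unfolding cnt_def sm_def mrk_def by linarith+

lemma J_less: "J < 2 ^ w"
proof -
  have "Z \<le> Suc cap * Z" by simp
  then show ?thesis using A_less unfolding A_Z by (simp add: Z_def)
qed

lemma rec_rec: "rec p = rec p' \<longleftrightarrow> p = p'"
  using rec_eq_iff[of 0 0 p p'] by (simp add: Z_def)
lemma cnt_cnt: "j < J \<Longrightarrow> j' < J \<Longrightarrow> cnt p j = cnt p' j' \<longleftrightarrow> p = p' \<and> j = j'"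
  unfolding cnt_def by (subst rec_eq_iff) (auto simp: Z_def)
lemma sm_sm: "j < J \<Longrightarrow> j' < J \<Longrightarrow> sm p j = sm p' j' \<longleftrightarrow> p = p' \<and> j = j'"
  unfolding sm_def by (subst rec_eq_iff) (auto simp: Z_def)
lemma cnt_sm: "j < J \<Longrightarrow> j' < J \<Longrightarrow> cnt p j \<noteq> sm p' j'"
  unfolding sm_def cnt_def by (subst rec_eq_iff) (auto simp: Z_def, presburger)
lemma cnt_rec: "j < J \<Longrightarrow> cnt p j \<noteq> rec p'"
  unfolding cnt_def using rec_eq_iff[of "2 + 2 * j" 0 p p'] by (auto simp: Z_def)
lemma sm_rec: "j < J \<Longrightarrow> sm p j \<noteq> rec p'"
  unfolding sm_def using rec_eq_iff[of "3 + 2 * j" 0 p p'] by (auto simp: Z_def)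
lemma cnt_mrk: "j < J \<Longrightarrow> cnt p j \<noteq> mrk p'"
  unfolding cnt_def mrk_def by (subst rec_eq_iff) (auto simp: Z_def)
lemma sm_mrk: "j < J \<Longrightarrow> sm p j \<noteq> mrk p'"
  unfolding sm_def mrk_def by (subst rec_eq_iff) (auto simp: Z_def)
lemma mrk_rec: "mrk p \<noteq> rec p'"
  unfolding mrk_def using rec_eq_iff[of 1 0 p p'] by (auto simp: Z_def J_def Q_def)
lemma mrk_mrk: "mrk p = mrk p' \<longleftrightarrow> p = p'"
  unfolding mrk_def using rec_eq_iff[of 1 1 p p'] by (auto simp: Z_def J_def Q_def)

lemmas address_distinct =
  rec_rec cnt_cnt sm_sm cnt_sm cnt_sm[THEN not_sym] cnt_rec cnt_rec[THEN not_sym] sm_rec sm_rec[THEN not_sym]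
  cnt_mrk cnt_mrk[THEN not_sym] sm_mrk sm_mrk[THEN not_sym] mrk_rec mrk_rec[THEN not_sym] mrk_mrk

lemma address_less: "p \<le> cap \<Longrightarrow> rec p < A" "p \<le> cap \<Longrightarrow> mrk p < A"
   "p \<le> cap \<Longrightarrow> j < J \<Longrightarrow> cnt p j < A" "p \<le> cap \<Longrightarrow> j < J \<Longrightarrow> sm p j < A"
proof -
  have "1 < Z" "j < J \<Longrightarrow> 2 + 2 * j < Z" "j < J \<Longrightarrow> 3 + 2 * j < Z"
    using Q_less_J by (simp_all add: Z_def)
  then show "p \<le> cap \<Longrightarrow> rec p < A" "p \<le> cap \<Longrightarrow> mrk p < A"
   "p \<le> cap \<Longrightarrow> j < J \<Longrightarrow> cnt p j < A" "p \<le> cap \<Longrightarrow> j < J \<Longrightarrow> sm p j < A"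
    unfolding cnt_def sm_def mrk_def using rec_less0[of p] rec_less[of p] by blast+
qed

lemma address_less_word: "p \<le> cap \<Longrightarrow> rec p < 2 ^ w" "p \<le> cap \<Longrightarrow> mrk p < 2 ^ w"
   "p \<le> cap \<Longrightarrow> j < J \<Longrightarrow> cnt p j < 2 ^ w" "p \<le> cap \<Longrightarrow> j < J \<Longrightarrow> sm p j < 2 ^ w"
  using address_less A_less by (meson less_trans)+

definition stores :: "nat \<Rightarrow> nat set \<Rightarrow> nat \<Rightarrow> memory \<Rightarrow> bool" where
  "stores p X j m \<longleftrightarrow> m (cnt p j) = card (cell Q X j) \<and> m (sm p j) = \<Sum>(cell Q X j)"

text \<open>\<open>N\<close> is an arbitrary family of sets rather than \<open>nbrs E\<close>,
  because an update edits the two endpoints one after the other and the state in between is not the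
  neighbourhood map of a graph. Zero marks let the report start from unvisited records.\<close>

definition Rep :: "nat list \<Rightarrow> (nat \<Rightarrow> nat set) \<Rightarrow> memory \<Rightarrow> bool" where
  "Rep xs N m \<longleftrightarrow> index xs m \<and> m 2 = Q \<and> m 3 = J \<and> m 5 = q \<and> m 21 = k * J \<and> fits A m \<and>
     (\<forall>i < length xs. m (mrk (Suc i)) = 0 \<and> (\<forall>j < J. stores (Suc i) (N (xs ! i)) j m))"

lemma cell_bounds:
  assumes "X \<subseteq> {1..n}"
  shows "card (cell Q X j) \<le> n" "\<Sum>(cell Q X j) \<le> n * n"
proof -
  have sub: "cell Q X j \<subseteq> {1..n}" using assms cell_subset by blast
  then show "card (cell Q X j) \<le> n" using card_mono[OF _ sub] by simp
  have "\<Sum>(cell Q X j) \<le> of_nat (card (cell Q X j)) * n"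
    using sub by (intro sum_bounded_above) auto
  also have "\<dots> \<le> n * n" using \<open>card (cell Q X j) \<le> n\<close> by simp
  finally show "\<Sum>(cell Q X j) \<le> n * n" .
qed

text \<open>\<open>j div Q < M\<close> singles out the buckets whose modulus has been processed.
  Among those of modulus \<open>M\<close> only \<open>jj\<close> can contain \<open>y\<close>, so
  all others agree for \<open>X\<close> and \<open>X'\<close>.\<close>

lemma edit_step_correct:
  fixes b :: bool
  assumes X'_def: "X' = (if b then insert y X else X - {y})"
    and "length inp > 1" "b \<longleftrightarrow> inp ! 1 = 1" "b \<longleftrightarrow> y \<notin> X" "X \<subseteq> {1..n}" "y \<in> {1..n}"
    and "fits A m" "p \<le> cap" "m 2 = Q" "m 10 = y" "m 14 = rec p" "m 15 = M" "0 < M" "M < Q"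
    and "\<And>j. j < J \<Longrightarrow> stores p (if j div Q < M then X' else X) j m"
  shows "wp edit_step 11 m (\<lambda>m'. fits A m' \<and> m' 15 = Suc M \<and>
    agree ({13, 15, 16} \<union> cnt p ` {..<J} \<union> sm p ` {..<J}) m' m \<and>
    (\<forall>j < J. stores p (if j div Q < Suc M then X' else X) j m'))"
proof -
  define jj where "jj = y mod M + M * Q"
  have yM: "y mod M < Q" using assms by (meson less_trans mod_less_divisor)
  have div: "jj div Q = M" "jj mod Q = y mod M" using yM by (auto simp: jj_def)
  have "jj < Suc M * Q" using yM by (simp add: jj_def)
  also have "\<dots> \<le> J" unfolding J_def using assms by (intro mult_right_mono) auto
  finally have jj: "jj < J" .
  have "rec p + 2 * jj + 2 < 2 ^ w"
    using address_less_word(3)[OF \<open>p \<le> cap\<close> jj] unfolding cnt_def by linarith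
  moreover have "M * Q \<le> jj" by (simp add: jj_def)
  ultimately have bounds: "M * Q < 2 ^ w" "jj < 2 ^ w" "jj + jj < 2 ^ w" "jj + jj + rec p < 2 ^ w"
    by linarith+
  have adr: "Suc (Suc (jj + jj + rec p)) = cnt p jj" unfolding cnt_def by linarith
  have finX: "finite X" using assms by (auto intro: finite_subset)
  have old: "m (cnt p jj) = card (cell Q X jj)" "m (sm p jj) = \<Sum>(cell Q X jj)"
    using assms(15)[OF jj] div by (auto simp: stores_def)
  have fin: "finite (cell Q X jj)" using finX by (rule finite_cell)
  have rest: "stores p (if j div Q < Suc M then X' else X) j m'"
    if "j < J" "m' (cnt p jj) = card (cell Q X' jj)" "m' (sm p jj) = \<Sum>(cell Q X' jj)"
      "\<And>i. i < J \<Longrightarrow> i \<noteq> jj \<Longrightarrow> m' (cnt p i) = m (cnt p i) \<and> m' (sm p i) = m (sm p i)" for j m'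
  proof (cases "j = jj")
    case True
    then show ?thesis using that div by (simp add: stores_def)
  next
    case False
    have "cell Q X' j = cell Q X j" if "j div Q = M"
    proof -
      have "j mod Q \<noteq> y mod M" using False that by (metis div div_mult_mod_eq)
      then show ?thesis using that assms(3,4) by (auto simp: X'_def cell_insert cell_remove) (auto simp: cell_def)
    qed
    then show ?thesis using that assms(15)[OF \<open>j < J\<close>] False
      by (auto simp: stores_def less_Suc_eq)
  qed
  have Mw: "Suc M < 2 ^ w" using \<open>M < Q\<close> Q_less_J J_less by linarith
  define St where "St m' \<longleftrightarrow> (\<forall>j < J. stores p (if j div Q < Suc M then X' else X) j m')" for m'
  have "y \<le> n" using assms(6) by simp
  then have vals: "Suc (card (cell Q X jj)) < 2 ^ w" "\<Sum>(cell Q X jj) + y < 2 ^ w"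
      "card (cell Q X jj) < 2 ^ w" "\<Sum>(cell Q X jj) < 2 ^ w"
    using cell_bounds[OF assms(5), of jj] n2_less n_pos le_square[of n] by linarith+
  note exec_facts = assms(7-12) assms(2)[simplified] bounds Mw jj adr vals old
    address_less[OF \<open>p \<le> cap\<close>] address_less_word[OF \<open>p \<le> cap\<close>] address_distinct
  show ?thesis
  proof (cases b)
    case True
    have inp1: "inp ! Suc 0 = Suc 0" using True assms(3) by simp
    have new: "card (cell Q X' jj) = Suc (card (cell Q X jj))" "\<Sum>(cell Q X' jj) = \<Sum>(cell Q X jj) + y"
    proof -
      have "y \<notin> cell Q X jj" using True assms(4) cell_subset by blast
      moreover have "cell Q X' jj = insert y (cell Q X jj)"
        using True assms(13) div by (simp add: X'_def cell_insert)
      ultimately show "card (cell Q X' jj) = Suc (card (cell Q X jj))" "\<Sum>(cell Q X' jj) = \<Sum>(cell Q X jj) + y"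
        using fin by simp_all
    qed
    show ?thesis
      unfolding edit_step_def St_def[symmetric]
      apply (simp add: reaches_simps exec_facts inp1 flip: jj_def)
      apply (unfold St_def, intro allI impI rest)
      apply (simp_all add: new old address_distinct jj)
      done
  next
    case False
    have inp1: "inp ! Suc 0 \<noteq> Suc 0" using False assms(3) by simp
    have y: "y \<in> cell Q X jj" using False assms(4,13) div by (auto simp: cell_def)
    then have new: "card (cell Q X' jj) = card (cell Q X jj) - 1" "\<Sum>(cell Q X' jj) = \<Sum>(cell Q X jj) - y"
      using False fin by (auto simp: X'_def cell_remove sum_diff1_nat)
    have ge: "y \<le> \<Sum>(cell Q X jj)" "Suc 0 \<le> card (cell Q X jj)"
      using y fin by (auto intro: member_le_sum[of y _ "\<lambda>x. x", simplified] simp: Suc_le_eq card_gt_0_iff)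
    show ?thesis
      unfolding edit_step_def St_def[symmetric]
      apply (simp add: reaches_simps exec_facts inp1 ge flip: jj_def)
      apply (unfold St_def, intro allI impI rest)
      apply (simp_all add: new old address_distinct jj)
      done
  qed
qed


definition "edit_time = find_time + Q * 12 + 10"

lemma index_agree:
  assumes "index xs m" "\<And>a. a \<in> {4, 7, 8} \<union> range rec \<Longrightarrow> m' a = m a"
  shows "index xs m'"
  using assms unfolding index_def by auto

lemma edit_correct:
  fixes b :: bool
  assumes "length inp > 1" "b \<longleftrightarrow> inp ! 1 = 1" "b \<longleftrightarrow> y \<notin> N x" "\<And>v. N v \<subseteq> {1..n}"
    and "x \<in> {1..n}" "y \<in> {1..n}" "Rep xs N m" "m 9 = x" "m 10 = y"
  shows "wp (edit_prog k) edit_time m (Rep xs (N(x := if b then insert y (N x) else N x - {y})))"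
  unfolding edit_prog_def
proof (rule reaches_append_le[OF find_correct[of xs m]])
  show idx: "index xs m" "fits A m" "0 < m 9" "find_time \<le> edit_time"
    using assms by (auto simp: Rep_def edit_time_def)
  define N' where "N' = N(x := if b then insert y (N x) else N x - {y})"
  fix m1
  assume "agree {11, 12, 13, 14} m1 m \<and> fits A m1 \<and> m1 11 \<le> length xs \<and>
    m1 14 = rec (m1 11) \<and> ((0 # xs) ! m1 11 = m 9) = (m 9 \<in> set xs)"
  then have ag: "agree {11, 12, 13, 14} m1 m" and m1: "fits A m1" "m1 11 \<le> length xs"
    "m1 14 = rec (m1 11)" "(0 # xs) ! m1 11 = x \<longleftrightarrow> x \<in> set xs" using assms by auto
  note fr = agreeD[OF ag]
  define p where "p = m1 11"
  have p: "p \<le> cap" using m1(2) idx(1) by (simp add: p_def index_def)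
  have fr_rep: "m1 (rec i) = m (rec i)" "m1 (mrk i) = m (mrk i)" "m1 (cnt i j) = m (cnt i j)" "m1 (sm i j) = m (sm i j)" for i j
    by (auto intro!: fr)
  have Rep1: "Rep xs N m1"
    using assms(7) m1(1) unfolding Rep_def index_def stores_def by (auto simp: fr fr_rep)
  have id: "m1 (rec p) = (0 # xs) ! p"
    using Rep1 m1(2) by (auto simp: Rep_def index_def p_def)
  show "reaches [Cond (Equal (reg 9) (deref 14)) [
       Assign (Direct 15) Plus (Const 1) (Const 0),
       While (Less (reg 15) (reg 2)) edit_step] []] (edit_time - find_time) m1
       (return_pmf ()) (\<lambda>m' _. Rep xs (N(x := if b then insert y (N x) else N x - {y})) m')"
  proof (cases "x \<in> set xs")
    case False
    have "Rep xs N' m1"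
      using Rep1 False unfolding Rep_def N'_def by (auto simp: in_set_conv_nth)
    then show ?thesis
      using False m1 id assms(8) by (simp add: reaches_simps edit_time_def fr N'_def p_def)
  next
    case True
    then have idx_p: "(0 # xs) ! p = x" using m1(4) by (simp add: p_def)
    then have "p \<noteq> 0" using assms(5) by (auto intro!: gr0I)
    then obtain p' where p': "p = Suc p'" by (cases p) auto
    then have x: "xs ! p' = x" "p' < length xs" using idx_p m1(2) by (auto simp: p_def)
    have uniq: "xs ! i = x \<longleftrightarrow> i = p'" if "i < length xs" for i
      using x that idx(1) by (auto simp: index_def strict_sorted_iff nth_eq_iff_index_eq)
    define I where "I z m' \<longleftrightarrow> fits A m' \<and> 0 < m' 15 \<and> m' 15 \<le> Q \<and> z = Q - m' 15 \<and>
      agree ({13, 15, 16} \<union> cnt p ` {..<J} \<union> sm p ` {..<J}) m' m1 \<and>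
      (\<forall>j < J. stores p (if j div Q < m' 15 then N' x else N x) j m')" for z m'
    have fr_I: "m' a = m1 a" if "I z m'" "a \<in> {2, 3, 4, 5, 7, 8, 10, 14, 21} \<union> range rec \<union> range mrk" for z m' a
    proof (rule agreeD[of "{13, 15, 16} \<union> cnt p ` {..<J} \<union> sm p ` {..<J}" m' m1 a])
      show "agree ({13, 15, 16} \<union> cnt p ` {..<J} \<union> sm p ` {..<J}) m' m1" using that(1) by (simp add: I_def)
      show "a \<notin> {13, 15, 16} \<union> cnt p ` {..<J} \<union> sm p ` {..<J}"
        using that(2) by (auto simp: address_distinct)
    qed
    have fin: "Rep xs N' m'" if inv: "I z m'" "\<not> m' 15 < Q" for z m'
    proof -
      have "m' 15 = Q" using inv by (simp add: I_def)
      have st: "stores (Suc i) (N' (xs ! i)) j m'" if "i < length xs" "j < J" for i j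
      proof (cases "i = p'")
        case True
        have "j div Q < Q" using that(2) by (simp add: J_def less_mult_imp_div_less)
        then show ?thesis using inv that True x p' \<open>m' 15 = Q\<close> by (auto simp: I_def)
      next
        case False
        have "agree ({13, 15, 16} \<union> cnt p ` {..<J} \<union> sm p ` {..<J}) m' m1" using inv(1) by (simp add: I_def)
        from agreeD[OF this, of "cnt (Suc i) j"] agreeD[OF this, of "sm (Suc i) j"]
        have "m' (cnt (Suc i) j) = m1 (cnt (Suc i) j)" "m' (sm (Suc i) j) = m1 (sm (Suc i) j)"
          using False that(2) p' by (auto simp: address_distinct image_iff)
        moreover have "N' (xs ! i) = N (xs ! i)" using uniq[OF that(1)] False by (simp add: N'_def)
        ultimately show ?thesis using Rep1 that by (simp add: Rep_def stores_def)
      qed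
      have regs: "m' 2 = Q" "m' 3 = J" "m' 5 = q" "m' 21 = k * J" "fits A m'"
          "\<And>i. m' (mrk i) = m1 (mrk i)"
        using fr_I[OF inv(1)] Rep1 inv(1) by (simp_all add: Rep_def I_def)
      have "index xs m1" using Rep1 by (simp add: Rep_def)
      then have "index xs m'" by (rule index_agree) (rule fr_I[OF inv(1)], auto)
      then show ?thesis using st regs Rep1 by (simp add: Rep_def)
    qed
    have loop: "wp [While (Less (reg 15) (reg 2)) edit_step] ((Q - 1) * Suc 11 + Suc 0) (m1(15 := Suc 0)) (Rep xs N')"
    proof (rule reaches_While[where I = I])
      \<comment> \<open>The loop starts with modulus 1: the buckets of modulus 0 are empty before
        and after the edit.\<close>
      have "cell Q X j = {}" if "j div Q < Suc 0" for X j using that by (auto simp: cell_def)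
      then show "I (Q - 1) (m1(15 := Suc 0))"
        using Q_ge m1(1) Rep1 p' x by (auto simp: I_def Rep_def stores_def)
    next
      show "fits A m'" if "I z m'" for z m' using that by (simp add: I_def)
    next
      fix z m' assume inv: "I z m'" and test: "test_val w inp m' (Less (reg 15) (reg 2))"
      note inv' = inv[unfolded I_def]
      have Q': "m' 2 = Q" "m' 10 = y" "m' 14 = rec p"
        using fr_I[OF inv] Rep1 assms(9) m1(3) by (auto simp: Rep_def p_def fr)
      have "wp edit_step 11 m' (\<lambda>m''. fits A m'' \<and> m'' 15 = Suc (m' 15) \<and>
          agree ({13, 15, 16} \<union> cnt p ` {..<J} \<union> sm p ` {..<J}) m'' m' \<and>
          (\<forall>j < J. stores p (if j div Q < Suc (m' 15) then N' x else N x) j m''))"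
        by (rule edit_step_correct[of "N' x" b y "N x"])
          (use assms inv' Q' test p in \<open>auto simp: N'_def\<close>)
      then show "wp edit_step 11 m' (\<lambda>m'. \<exists>i<z. I i m')"
      proof (rule wp_conseq)
        fix m'' assume post: "fits A m'' \<and> m'' 15 = Suc (m' 15) \<and>
          agree ({13, 15, 16} \<union> cnt p ` {..<J} \<union> sm p ` {..<J}) m'' m' \<and>
          (\<forall>j < J. stores p (if j div Q < Suc (m' 15) then N' x else N x) j m'')"
        then have "I (Q - m'' 15) m''" "Q - m'' 15 < z"
          using inv' test Q'(1) by (auto simp: I_def intro: agree_trans)
        then show "\<exists>i<z. I i m''" by blast
      qed
    next
      fix z m' assume inv: "I z m'" and test: "\<not> test_val w inp m' (Less (reg 15) (reg 2))"
      then have "Rep xs N' m'" using fin[OF inv] fr_I[OF inv, of 2] Rep1 by (auto simp: Rep_def)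
      then show "wp [] 0 m' (Rep xs N')" using inv by (simp add: reaches_Nil I_def)
    qed
    have "(Q - 1) * Suc 11 + Suc 0 \<le> 8 + Q * 12" by simp
    from reaches_mono_time[OF loop this] show ?thesis
      unfolding N'_def[symmetric]
      using m1 id idx_p assms(8) by (simp add: reaches_simps edit_time_def fr p_def)
  qed
qed


text \<open>The edge is edited as two arcs. Since \<open>x \<noteq> y\<close>, the second edit works
  on a set that the first one left alone, and both together give the new neighbourhood map.\<close>

lemma update_correct:
  assumes "inp = update_input n u" "graph_on n E" "valid_update n E u" "Rep xs (nbrs E) m"
  shows "wp (sketch_update k) (2 * edit_time + 4) m (Rep xs (nbrs (apply_update E u)))"
proof -
  obtain b x y where u: "u = (if b then Insert x y else Delete x y)"
    by (cases u) (metis (full_types))+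
  have inp: "inp = [n, if b then 1 else 0, x, y]" using assms(1) u by simp
  have xy: "x \<in> {1..n}" "y \<in> {1..n}" "x \<noteq> y" "b \<longleftrightarrow> {x, y} \<notin> E"
    using assms(3) u by (auto split: if_splits)
  define N1 where "N1 = (nbrs E)(x := if b then insert y (nbrs E x) else nbrs E x - {y})"
  define N2 where "N2 = N1(y := if b then insert x (N1 y) else N1 y - {x})"
  have N2: "N2 = nbrs (apply_update E u)"
    using xy(3) by (auto simp: N2_def N1_def u nbrs_def fun_eq_iff doubleton_eq_iff)
  have sub: "nbrs E v \<subseteq> {1..n}" "N1 v \<subseteq> {1..n}" for v
    using nbrs_subset[OF assms(2)] xy by (auto simp: N1_def)
  have less: "x < 2 ^ w" "y < 2 ^ w" using xy n2_less by auto
  have args: "2 < length inp" "3 < length inp" "inp ! 2 = x" "inp ! 3 = y" using inp by auto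
  have Rep_fits: "fits A m" if "Rep xs N m" for N m using that by (simp add: Rep_def)
  have Rep_regs: "Rep xs N (m(9 := x', 10 := y'))" if "Rep xs N m" for N m x' y'
    using that unfolding Rep_def index_def stores_def by auto
  have "wp (edit_prog k) edit_time (m(9 := x, 10 := y)) (Rep xs N1)"
    unfolding N1_def using assms(4) xy sub
    by (intro edit_correct Rep_regs) (auto simp: inp nbrs_def)
  then have 1: "wp ([Assign (Direct 9) Plus (Input 2) (Const 0), Assign (Direct 10) Plus (Input 3) (Const 0)] @
      edit_prog k) (edit_time + 2) m (Rep xs N1)"
    using Rep_fits[OF assms(4)] less by (simp add: reaches_simps args)
  have 2: "wp ([Assign (Direct 9) Plus (Input 3) (Const 0), Assign (Direct 10) Plus (Input 2) (Const 0)] @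
      edit_prog k) (edit_time + 2) m' (Rep xs N2)" if "Rep xs N1 m'" for m'
  proof -
    have "wp (edit_prog k) edit_time (m'(9 := y, 10 := x)) (Rep xs N2)"
      unfolding N2_def using that xy sub
      by (intro edit_correct Rep_regs) (auto simp: inp nbrs_def N1_def insert_commute)
    then show ?thesis
      using Rep_fits[OF that] less by (simp add: reaches_simps args)
  qed
  show ?thesis
    unfolding sketch_update_def N2[symmetric] append_assoc[symmetric]
    by (rule reaches_mono_time[OF reaches_append[OF 1 2[unfolded append_assoc[symmetric]]], unfolded append_assoc[symmetric]]) simp_all
qed

end

section \<open>Report\<close>

text \<open>The loops over the queue and over the buckets of a record are merged: iteration \<open>t\<close> inspects
  bucket \<open>t mod J\<close> of the queue entry \<open>t div J\<close>, and a failure resets register 18, which ends the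
  loop. A component is counted only from its least vertex.\<close>

definition append_prog :: "cmd list" where
  "append_prog = [
     Assign (Direct 14) Plus (reg 14) (Const 1),
     Cond (Equal (deref 14) (reg 17)) [] [
       Cond (Less (reg 18) (reg 21)) [
         Assign (Indirect 14) Plus (reg 17) (Const 0),
         Assign (Direct 13) Div (reg 18) (reg 3),
         Assign (Direct 13) Plus (reg 13) (Const 40),
         Assign (Indirect 13) Plus (reg 11) (Const 0),
         Assign (Direct 18) Plus (reg 18) (reg 3),
         Assign (Direct 19) Times (reg 19) (reg 5)] [
         Assign (Direct 18) Plus (Const 0) (Const 0)]]]"

definition visit_cmd :: cmd where
  "visit_cmd = Cond (Equal (reg 9) (deref 14))
     [Cond (Less (reg 11) (reg 17)) [Assign (Direct 18) Plus (Const 0) (Const 0)] append_prog]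
     [Assign (Direct 18) Plus (Const 0) (Const 0)]"

definition explore_step :: "nat \<Rightarrow> cmd list" where
  "explore_step k = [
     Assign (Direct 13) Div (reg 15) (reg 3),
     Assign (Direct 13) Plus (reg 13) (Const 40),
     Assign (Direct 13) Plus (deref 13) (Const 0),
     Assign (Direct 14) Times (reg 13) (reg 4),
     Assign (Direct 14) Plus (reg 14) (Const (base k)),
     Assign (Direct 16) Plus (reg 2) (reg 2),
     Assign (Direct 16) Plus (reg 16) (reg 14),
     Assign (Direct 16) Plus (reg 16) (Const 2),
     Cond (Less (Const (k - 1)) (deref 16)) [Assign (Direct 18) Plus (Const 0) (Const 0)] [
       Assign (Direct 13) Mod (reg 15) (reg 3),
       Assign (Direct 13) Plus (reg 13) (reg 13),
       Assign (Direct 14) Plus (reg 14) (reg 13),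
       Assign (Direct 14) Plus (reg 14) (Const 2),
       Cond (Equal (deref 14) (Const 1)) (
         [Assign (Direct 14) Plus (reg 14) (Const 1),
          Assign (Direct 9) Plus (deref 14) (Const 0)] @
         find_prog k @ [visit_cmd]) []],
     Assign (Direct 15) Plus (reg 15) (Const 1)]"

definition explore_prog :: "nat \<Rightarrow> cmd list" where
  "explore_prog k = [
     Assign (Direct 40) Plus (reg 17) (Const 0),
     Assign (Direct 14) Times (reg 17) (reg 4),
     Assign (Direct 14) Plus (reg 14) (Const (base k)),
     Assign (Direct 14) Plus (reg 14) (Const 1),
     Assign (Indirect 14) Plus (reg 17) (Const 0),
     Assign (Direct 18) Plus (reg 3) (Const 0),
     Assign (Direct 19) Plus (reg 5) (Const 0),
     Assign (Direct 15) Plus (Const 0) (Const 0),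
     While (Less (reg 15) (reg 18)) (explore_step k),
     Cond (Equal (reg 18) (Const 0)) [] [Assign (Direct 0) Plus (reg 0) (reg 19)],
     Assign (Direct 17) Minus (reg 17) (Const 1)]"

definition sketch_report :: "nat \<Rightarrow> cmd list" where
  "sketch_report k = [
     Assign (Direct 0) Plus (Const 0) (Const 0),
     Assign (Direct 17) Plus (reg 8) (Const 0),
     While (Less (Const 0) (reg 17)) (explore_prog k),
     Assign (Direct 1) Plus (Const 1) (Const 0)]"

context sketch
begin

text \<open>\<open>Rep\<close> without the condition on the marks, which the exploration
  overwrites.\<close>

definition Data :: "nat list \<Rightarrow> (nat \<Rightarrow> nat set) \<Rightarrow> memory \<Rightarrow> bool" where
  "Data xs N m \<longleftrightarrow> index xs m \<and> m 2 = Q \<and> m 3 = J \<and> m 5 = q \<and> m 21 = k * J \<and> fits A m \<and>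
     (\<forall>i < length xs. \<forall>j < J. stores (Suc i) (N (xs ! i)) j m)"

definition volatile :: "nat \<Rightarrow> bool" where
  "volatile a \<longleftrightarrow> a \<notin> {2, 3, 4, 5, 7, 8, 21} \<and> a < A \<and> (\<forall>p. a \<noteq> rec p) \<and>
     (\<forall>p. \<forall>j < J. a \<noteq> cnt p j \<and> a \<noteq> sm p j)"

definition buf :: "nat \<Rightarrow> nat" where "buf l = l + 40"

lemma buf_simps [simp]:
  "l + 40 = buf l" "buf l = buf l' \<longleftrightarrow> l = l'"
  "numeral a < (40::nat) \<Longrightarrow> buf l \<noteq> numeral a" "numeral a < (40::nat) \<Longrightarrow> numeral a \<noteq> buf l"
  "buf l \<noteq> 0" "0 \<noteq> buf l"
  unfolding buf_def by linarith+

lemma address_neq0 [simp]: "rec p \<noteq> 0" "cnt p j \<noteq> 0" "sm p j \<noteq> 0" "mrk p \<noteq> 0"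
   "0 \<noteq> rec p" "0 \<noteq> cnt p j" "0 \<noteq> sm p j" "0 \<noteq> mrk p"
  using rec_ge[of p] unfolding cnt_def sm_def mrk_def by linarith+

lemma buf_neq:
  assumes "l < k"
  shows "buf l \<noteq> rec p" "buf l \<noteq> cnt p j" "buf l \<noteq> sm p j" "buf l \<noteq> mrk p" "mrk p \<noteq> buf l" "buf l < A"
  using assms rec_ge[of p] A_ge unfolding buf_def cnt_def sm_def mrk_def by linarith+

lemma volatile_simps [simp]:
  "volatile 0" "volatile 9" "volatile 11" "volatile 12" "volatile 13" "volatile 14" "volatile 15"
  "volatile 16" "volatile 17" "volatile 18" "volatile 19"
  by (simp_all add: volatile_def)

lemma volatile_mrk: "p \<le> cap \<Longrightarrow> volatile (mrk p)"
  by (auto simp: volatile_def address_less address_distinct)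

lemma volatile_buf: "l < k \<Longrightarrow> volatile (buf l)"
  by (auto simp: volatile_def buf_neq)

lemma Data_agree:
  assumes "Data xs N m" "\<And>a. \<not> volatile a \<Longrightarrow> m' a = m a" "fits A m'"
  shows "Data xs N m'"
proof -
  have nv: "\<not> volatile a" if "a \<in> {2, 3, 4, 5, 7, 8, 21} \<union> range rec" for a
    using that by (auto simp: volatile_def)
  have "index xs m" using assms(1) by (simp add: Data_def)
  then have "index xs m'" by (rule index_agree) (rule assms(2), rule nv, blast)
  moreover have "m' (cnt p j) = m (cnt p j)" "m' (sm p j) = m (sm p j)" if "j < J" for p j
    by (rule assms(2), use that in \<open>unfold volatile_def, blast\<close>)+
  moreover have "m' 2 = m 2" "m' 3 = m 3" "m' 5 = m 5" "m' 21 = m 21"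
    by (rule assms(2), rule nv, simp)+
  ultimately show ?thesis using assms(1,3) by (simp add: Data_def stores_def)
qed

lemma Data_upd [simp]: "volatile a \<Longrightarrow> Data xs N m \<Longrightarrow> Data xs N (m(a := v))"
  by (rule Data_agree[of _ _ m]) (auto simp: Data_def volatile_def)

lemma DataD:
  assumes "Data xs N m"
  shows "index xs m" "m 2 = Q" "m 3 = J" "m 4 = Z" "m 5 = q" "m 21 = k * J" "m 8 = length xs" "fits A m"
    "length xs \<le> cap" "length xs \<le> n" "sorted_wrt (<) xs" "set xs \<subseteq> {1..n}"
  using assms index_length by (auto simp: Data_def index_def)

lemma Data_cell:
  assumes "Data xs N m" "0 < p" "p \<le> length xs" "j < J"
  shows "m (cnt p j) = card (cell Q (N (xs ! (p - 1))) j)" "m (sm p j) = \<Sum>(cell Q (N (xs ! (p - 1))) j)"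
proof -
  obtain i where "p = Suc i" using assms(2) by (cases p) auto
  then show "m (cnt p j) = card (cell Q (N (xs ! (p - 1))) j)" "m (sm p j) = \<Sum>(cell Q (N (xs ! (p - 1))) j)"
    using assms by (auto simp: Data_def stores_def)
qed

abbreviation vtx :: "nat list \<Rightarrow> nat \<Rightarrow> nat" where
  "vtx xs p \<equiv> xs ! (p - 1)"

text \<open>A mark is the index of the root that set it. Roots are explored in decreasing order, so
  marks left by earlier roots are larger than the current index and never have to be
  cleared.\<close>

definition marks :: "nat list \<Rightarrow> nat \<Rightarrow> memory \<Rightarrow> bool" where
  "marks xs i m \<longleftrightarrow> (\<forall>p. 0 < p \<longrightarrow> p \<le> length xs \<longrightarrow> m (mrk p) = 0 \<or> i \<le> m (mrk p))"

text \<open>\<open>bs\<close> is the queue of record indices. Soundness is its inclusion in the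
  component of the root; the last conjunct is completeness so far: the vertex isolated by an
  inspected bucket is in the queue, and the owner of the bucket has degree below
  \<open>k\<close>.\<close>

definition exploring ::
    "nat list \<Rightarrow> nat set set \<Rightarrow> nat \<Rightarrow> nat \<Rightarrow> nat list \<Rightarrow> memory \<Rightarrow> bool" where
  "exploring xs E i t bs m \<longleftrightarrow> m 18 = length bs * J \<and> m 19 = q ^ length bs \<and>
     0 < length bs \<and> length bs \<le> k \<and> bs ! 0 = i \<and> distinct bs \<and> set bs \<subseteq> {i..length xs} \<and>
     (\<forall>l < length bs. m (buf l) = bs ! l) \<and>
     (\<forall>p. 0 < p \<longrightarrow> p \<le> length xs \<longrightarrow> (m (mrk p) = i \<longleftrightarrow> p \<in> set bs)) \<and>
     t \<le> length bs * J \<and> vtx xs ` set bs \<subseteq> component E (vtx xs i) \<and>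
     (\<forall>t' < t. card (nbrs E (vtx xs (bs ! (t' div J)))) < k \<and>
        (\<forall>u. cell Q (nbrs E (vtx xs (bs ! (t' div J)))) (t' mod J) = {u} \<longrightarrow> u \<in> vtx xs ` set bs))"

text \<open>Failures are never spurious: apart from a state of \<open>exploring\<close>, register 18
  may be 0 only if the root is not a leader, and then contributing nothing is correct.\<close>

definition explore_inv :: "nat list \<Rightarrow> nat set set \<Rightarrow> nat \<Rightarrow> nat \<Rightarrow> nat \<Rightarrow> memory \<Rightarrow> bool" where
  "explore_inv xs E i tot t m \<longleftrightarrow> Data xs (nbrs E) m \<and> m 17 = i \<and> m 15 = t \<and> m 0 = tot \<and> marks xs i m \<and>
     (m 18 = 0 \<and> \<not> leader k E (set xs) (vtx xs i) \<or> (\<exists>bs. exploring xs E i t bs m))"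

definition "step_time = find_time + 50"

lemma vtx_inj: "sorted_wrt (<) xs \<Longrightarrow> inj_on (vtx xs) {1..length xs}"
  by (auto simp: inj_on_def strict_sorted_iff nth_eq_iff_index_eq)

lemma vtx_mono: "sorted_wrt (<) xs \<Longrightarrow> 0 < p \<Longrightarrow> p < p' \<Longrightarrow> p' \<le> length xs \<Longrightarrow> vtx xs p < vtx xs p'"
  by (auto simp: sorted_wrt_iff_nth_less)

text \<open>A \<open>p\<close> marked with \<open>i\<close> is already in the queue. Otherwise it is
  appended if there is room; if there is none, the queue and \<open>p\<close> give
  \<open>k + 1\<close> distinct vertices of the component, and the root is not a leader.\<close>

lemma append_correct:
  assumes "Data xs (nbrs E) m" "m 17 = i" "0 < i" "m 15 = t" "m 0 = tot" "marks xs i m"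
    and bs: "exploring xs E i t bs m" and t: "t < length bs * J" and G: "graph_on n E"
    and deg: "card (nbrs E (vtx xs (bs ! (t div J)))) < k"
    and cell: "cell Q (nbrs E (vtx xs (bs ! (t div J)))) (t mod J) = {vtx xs p}"
    and p: "m 11 = p" "i \<le> p" "p \<le> length xs" "m 14 = rec p"
  shows "wp append_prog 10 m (\<lambda>m'. m' 15 = t \<and> fits A m' \<and> explore_inv xs E i tot (Suc t) (m'(15 := Suc t)))"
proof -
  note D = DataD[OF assms(1)]
  note B = bs[unfolded exploring_def]
  define len where "len = length bs"
  have len: "0 < len" "len \<le> k" "t < len * J" "m 18 = len * J" "m 19 = q ^ len"
    using B t by (auto simp: len_def)
  have J: "0 < J" using Q_less_J by simp
  have p0: "0 < p" "p \<le> cap" using assms p D by auto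
  have u: "vtx xs p \<in> nbrs E (vtx xs (bs ! (t div J)))" using cell cell_subset by blast
  have tl: "t div J < length bs" using t J by (simp add: less_mult_imp_div_less)
  have comp_p: "vtx xs p \<in> component E (vtx xs i)"
    using B u component_nbrs tl by (metis image_subset_iff nth_mem subsetD)
  show ?thesis
  proof (cases "p \<in> set bs")
    case True
    then have "m (mrk p) = i" using B p p0 by blast
    moreover have "exploring xs E i (Suc t) bs (m(14 := mrk p, 15 := Suc t))"
      using B t deg cell True unfolding exploring_def by (auto simp: less_Suc_eq)
    ultimately show ?thesis
      using assms(1-6) p p0 D unfolding append_prog_def
      by (auto simp: reaches_simps address_less address_less_word explore_inv_def marks_def)
  next
    case False
    then have mp: "m (mrk p) \<noteq> i" using B p p0 by blast
    show ?thesis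
    proof (cases "len < k")
      case True
      then have lim: "len * J < k * J" using J by simp
      have "Suc len * J \<le> k * J" using True by (intro mult_right_mono) auto
      then have lim': "len * J + J < 2 ^ w" using kJ_less by (simp add: J_def Q_def)
      have "q ^ Suc len \<le> q ^ k" using True q_pos by (intro power_increasing) auto
      then have pw: "q ^ len * q < 2 ^ w" using q_pow n2_less by (simp add: mult.commute)
      have lenw: "buf len < 2 ^ w" using buf_neq(6)[OF True] A_less by simp
      have iw: "i < 2 ^ w" "p < 2 ^ w" using p D n2_less by linarith+
      define m2 where "m2 = m(14 := mrk p, mrk p := i, 13 := buf len, buf len := p, 18 := len * J + J, 19 := q ^ len * q, 15 := Suc t)"
      have "exploring xs E i (Suc t) (bs @ [p]) m2"
        unfolding exploring_def
      proof (intro conjI allI impI)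
        show "m2 18 = length (bs @ [p]) * J" "m2 19 = q ^ length (bs @ [p])"
          by (auto simp: m2_def len_def)
        show "0 < length (bs @ [p])" "length (bs @ [p]) \<le> k" using True by (auto simp: len_def)
        show "(bs @ [p]) ! 0 = i" using B by (simp add: nth_append)
        show "distinct (bs @ [p])" using B False by simp
        show "set (bs @ [p]) \<subseteq> {i..length xs}" using B p by simp
        show "m2 (buf l) = (bs @ [p]) ! l" if "l < length (bs @ [p])" for l
          using that B True by (auto simp: m2_def nth_append len_def buf_neq less_Suc_eq)
        show "m2 (mrk p') = i \<longleftrightarrow> p' \<in> set (bs @ [p])" if "0 < p'" "p' \<le> length xs" for p'
          using that B True by (auto simp: m2_def buf_neq address_distinct)
        show "Suc t \<le> length (bs @ [p]) * J" using t J by simp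
        show "vtx xs ` set (bs @ [p]) \<subseteq> component E (vtx xs i)" using B comp_p by auto
      next
        fix t' assume t': "t' < Suc t"
        then have "t' div J < length bs" using t J by (metis dual_order.strict_trans less_mult_imp_div_less less_SucE)
        then have nth: "(bs @ [p]) ! (t' div J) = bs ! (t' div J)" by (simp add: nth_append)
        show "card (nbrs E (vtx xs ((bs @ [p]) ! (t' div J)))) < k"
          unfolding nth using B deg t' by (auto simp: less_Suc_eq)
        fix v assume "cell Q (nbrs E (vtx xs ((bs @ [p]) ! (t' div J)))) (t' mod J) = {v}"
        then show "v \<in> vtx xs ` set (bs @ [p])"
          unfolding nth using B cell t' by (auto simp: less_Suc_eq)
      qed
      moreover have "Data xs (nbrs E) m2" unfolding m2_def
        using assms(1) p0 True by (simp add: volatile_mrk volatile_buf)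
      moreover have "marks xs i m2" using assms(6) True by (auto simp: marks_def m2_def address_distinct buf_neq)
      ultimately have "explore_inv xs E i tot (Suc t) m2"
        using assms True by (auto simp: explore_inv_def m2_def buf_neq)
      then show ?thesis
        using assms(2,4,5) p p0 D mp len lim lim' pw lenw iw True J buf_neq[of len] unfolding append_prog_def m2_def
        by (simp add: reaches_simps address_less address_less_word)
    next
      case False': False
      then have "len = k" using len by simp
      have "\<not> leader k E (set xs) (vtx xs i)"
      proof
        assume lead: "leader k E (set xs) (vtx xs i)"
        have "vtx xs ` (insert p (set bs)) \<subseteq> component E (vtx xs i)" using B comp_p by auto
        moreover have "finite (component E (vtx xs i))" using lead by (auto simp: leader_def intro: finite_subset)
        ultimately have "card (vtx xs ` (insert p (set bs))) \<le> k"
          using lead card_mono unfolding leader_def by (meson order_trans)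
        moreover have "card (vtx xs ` (insert p (set bs))) = card (insert p (set bs))"
        proof (intro card_image inj_on_subset[OF vtx_inj[OF D(11)]])
          have "set bs \<subseteq> {i..length xs}" using B by blast
          then show "insert p (set bs) \<subseteq> {1..length xs}" using p p0 assms(3) by auto
        qed
        moreover have "card (insert p (set bs)) = Suc k"
          using False \<open>len = k\<close> B by (simp add: len_def distinct_card)
        ultimately show False by simp
      qed
      then show ?thesis
        using assms(1-6) p p0 D mp len \<open>len = k\<close> unfolding append_prog_def
        by (simp add: reaches_simps address_less address_less_word explore_inv_def marks_def)
    qed
  qed
qed


text \<open>Two more certificates of failure: an unsampled neighbour shows that the component is not
  contained in the sample, and one with a smaller index shows that the root is not the least vertex,
  since the records are sorted.\<close>

lemma visit_correct:
  assumes "Data xs (nbrs E) m" "m 17 = i" "0 < i" "m 15 = t" "m 0 = tot" "marks xs i m"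
    and bs: "exploring xs E i t bs m" and t: "t < length bs * J" and G: "graph_on n E"
    and deg: "card (nbrs E (vtx xs (bs ! (t div J)))) < k"
    and cell: "cell Q (nbrs E (vtx xs (bs ! (t div J)))) (t mod J) = {m 9}" and tw: "Suc t < 2 ^ w"
    and il: "i \<le> length xs"
  shows "wp (find_prog k @ [visit_cmd, Assign (Direct 15) Plus (reg 15) (Const 1)]) (find_time + 20) m
    (explore_inv xs E i tot (Suc t))"
proof (rule reaches_append_le[OF find_correct[of xs m]])
  define u where "u = m 9"
  have J: "0 < J" using Q_less_J by simp
  note D = DataD[OF assms(1)]
  have tl: "t div J < length bs" using t J by (simp add: less_mult_imp_div_less)
  have u_nbr: "u \<in> nbrs E (vtx xs (bs ! (t div J)))" using cell cell_subset unfolding u_def by blast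
  then have u_range: "u \<in> {1..n}" using nbrs_subset[OF G] by blast
  have u_comp: "u \<in> component E (vtx xs i)"
    using bs u_nbr component_nbrs tl unfolding exploring_def by (metis image_subset_iff nth_mem subsetD)
  show "index xs m" "fits A m" "0 < m 9" "find_time \<le> find_time + 20"
    using D u_range by (auto simp: u_def)
  fix m1
  assume "agree {11, 12, 13, 14} m1 m \<and> fits A m1 \<and> m1 11 \<le> length xs \<and>
    m1 14 = rec (m1 11) \<and> ((0 # xs) ! m1 11 = m 9) = (m 9 \<in> set xs)"
  then have ag: "agree {11, 12, 13, 14} m1 m" and m1: "fits A m1" "m1 11 \<le> length xs"
    "m1 14 = rec (m1 11)" "(0 # xs) ! m1 11 = u \<longleftrightarrow> u \<in> set xs" by (auto simp: u_def)
  note fr = agreeD[OF ag]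
  define p where "p = m1 11"
  have D1: "Data xs (nbrs E) m1"
    by (rule Data_agree[OF assms(1) _ m1(1)]) (auto intro!: fr)
  note D1' = DataD[OF D1]
  have regs: "m1 17 = i" "m1 15 = t" "m1 0 = tot" "m1 9 = u" using assms by (auto simp: fr u_def)
  have marks1: "marks xs i m1" using assms(6) by (simp add: marks_def fr)
  have bs1: "exploring xs E i t bs m1" using bs by (simp add: exploring_def fr)
  have id: "m1 (rec p) = (0 # xs) ! p" using D1'(1) m1(2) by (simp add: index_def p_def)
  have fail: "explore_inv xs E i tot (Suc t) (m1(18 := 0, 15 := Suc t))"
    if "\<not> leader k E (set xs) (vtx xs i)"
    using that D1 regs marks1 by (simp add: explore_inv_def marks_def)
  show "reaches [visit_cmd, Assign (Direct 15) Plus (reg 15) (Const 1)] (find_time + 20 - find_time) m1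
     (return_pmf ()) (\<lambda>m' _. explore_inv xs E i tot (Suc t) m')"
  proof (cases "u \<in> set xs")
    case False
    then have "\<not> leader k E (set xs) (vtx xs i)" using u_comp by (auto simp: leader_def)
    then show ?thesis
      using fail False id m1 regs tw by (simp add: visit_cmd_def reaches_simps p_def)
  next
    case True
    then have up: "(0 # xs) ! p = u" using m1(4) by (simp add: p_def)
    then have "p \<noteq> 0" using u_range by (auto intro!: gr0I)
    then have p: "0 < p" "u = vtx xs p" "p \<le> length xs" using up m1(2) by (auto simp: nth_Cons' p_def)
    show ?thesis
    proof (cases "p < i")
      case True
      then have "u < vtx xs i" using vtx_mono[OF D(11) p(1) True il] p(2) by simp
      then have "\<not> leader k E (set xs) (vtx xs i)" using u_comp by (auto simp: leader_def not_le)
      then show ?thesis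
        using fail True id m1 regs tw up by (simp add: visit_cmd_def reaches_simps p_def)
    next
      case False
      have *: "wp append_prog 10 m1 (\<lambda>m'. m' 15 = t \<and> fits A m' \<and> explore_inv xs E i tot (Suc t) (m'(15 := Suc t)))"
        by (rule append_correct[OF D1 regs(1) assms(3) regs(2,3) marks1 bs1 t G deg])
          (use cell p False m1 in \<open>auto simp: p_def u_def\<close>)
      have "reaches (append_prog @ [Assign (Direct 15) Plus (reg 15) (Const 1)]) 18 m1
        (return_pmf ()) (\<lambda>m' _. explore_inv xs E i tot (Suc t) m')"
        by (rule reaches_append_le[OF *]) (use tw in \<open>auto simp: reaches_simps\<close>)
      then show ?thesis
        using False id m1 regs up by (simp add: visit_cmd_def reaches_simps p_def)
    qed
  qed
qed

text \<open>A bucket of count 1 holds a genuine neighbour, namely its sum, because the sketch is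
  exact. The degree is read from bucket \<open>Q\<close> and tested because isolation is guaranteed
  only for few neighbours; a vertex of degree at least \<open>k\<close> and its neighbours exceed
  the size \<open>k\<close>.\<close>

lemma explore_step_correct:
  assumes inv: "explore_inv xs E i tot t m" and i: "0 < i" "i \<le> length xs"
    and G: "graph_on n E" and t18: "t < m 18"
  shows "wp (explore_step k) step_time m (explore_inv xs E i tot (Suc t))"
proof -
  have inv': "Data xs (nbrs E) m" "m 17 = i" "m 15 = t" "m 0 = tot" "marks xs i m"
    using inv by (auto simp: explore_inv_def)
  obtain bs where bs: "exploring xs E i t bs m" using inv t18 by (auto simp: explore_inv_def)
  note B = bs[unfolded exploring_def]
  note D = DataD[OF inv'(1)]
  have J: "0 < J" using Q_less_J by simp
  have t: "t < length bs * J" using t18 B by simp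
  then have tl: "t div J < length bs" using J by (simp add: less_mult_imp_div_less)
  then have tk: "t div J < k" using B by linarith
  have tj: "t mod J < J" using J by simp
  define p where "p = bs ! (t div J)"
  define v where "v = vtx xs p"
  have "p \<in> set bs" using tl by (simp add: p_def)
  then have "p \<in> {i..length xs}" using B by blast
  then have p: "0 < p" "p \<le> length xs" "p \<le> cap" using i D by auto
  have v_comp: "v \<in> component E (vtx xs i)" using B \<open>p \<in> set bs\<close> by (auto simp: v_def)
  have mp: "m (buf (t div J)) = p" using B tl by (simp add: p_def)
  have bufw: "buf (t div J) < 2 ^ w" using buf_neq(6)[OF tk] A_less by simp
  have "t < k * J" using t B by (meson less_le_trans mult_le_mono1)
  then have tw: "Suc t < 2 ^ w" using kJ_less by (simp add: J_def Q_def)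
  have pw: "p * Z < 2 ^ w" using address_less_word(1)[OF p(3)] unfolding rec_def by linarith
  have "cnt p Q < 2 ^ w" using address_less_word(3)[OF p(3) Q_less_J] .
  then have Qw: "Q + Q < 2 ^ w" "Q + Q + rec p < 2 ^ w" unfolding cnt_def by linarith+
  have adrQ: "Suc (Suc (Q + Q + rec p)) = cnt p Q" unfolding cnt_def by linarith
  have jw: "t mod J + t mod J < 2 ^ w" "rec p + (t mod J + t mod J) < 2 ^ w"
    using address_less_word(3)[OF p(3) tj] unfolding cnt_def by linarith+
  have adrj: "Suc (Suc (rec p + (t mod J + t mod J))) = cnt p (t mod J)" unfolding cnt_def by linarith
  have degQ: "m (cnt p Q) = card (nbrs E v)"
    using Data_cell(1)[OF inv'(1) p(1,2) Q_less_J] cell_degree[of Q "nbrs E v"] Q_ge by (simp add: v_def)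
  have cj: "m (cnt p (t mod J)) = card (cell Q (nbrs E v) (t mod J))"
     "m (sm p (t mod J)) = \<Sum>(cell Q (nbrs E v) (t mod J))"
    using Data_cell[OF inv'(1) p(1,2) tj] by (simp_all add: v_def)
  have "\<Sum>(cell Q (nbrs E v) (t mod J)) \<le> n * n"
    using nbrs_subset[OF G] by (intro cell_bounds) blast
  then have smw: "\<Sum>(cell Q (nbrs E v) (t mod J)) < 2 ^ w" using n2_less by linarith
  have pw': "p < 2 ^ w" using p(2) D(10) n2_less by linarith
  note facts = D(2-8) inv'(2-4) mp bufw tw pw pw' Qw adrQ jw adrj degQ cj smw
    address_less_word[OF p(3)] tj Q_less_J address_less[OF p(3)]
  show ?thesis
  proof (cases "card (nbrs E v) < k")
    case False
    have "\<not> leader k E (set xs) (vtx xs i)"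
    proof
      assume lead: "leader k E (set xs) (vtx xs i)"
      have "insert v (nbrs E v) \<subseteq> component E (vtx xs i)" using v_comp component_nbrs by blast
      moreover have "finite (component E (vtx xs i))" using lead by (auto simp: leader_def intro: finite_subset)
      ultimately have "card (insert v (nbrs E v)) \<le> k"
        using lead card_mono unfolding leader_def by (meson order_trans)
      moreover have "card (insert v (nbrs E v)) = Suc (card (nbrs E v))"
        using nbrs_subset[OF G, of v] finite_nbrs[OF G, of v] by (intro card_insert_disjoint) auto
      ultimately show False using False by simp
    qed
    moreover have "k - Suc 0 < card (nbrs E v)" using False k_pos by linarith
    ultimately show ?thesis
      unfolding explore_step_def step_time_def using inv'(1,5)
      by (simp add: reaches_simps facts flip: rec_def) (simp add: explore_inv_def marks_def facts)
  next
    case deg: True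
    then have degk: "\<not> k - Suc 0 < card (nbrs E v)" by linarith
    show ?thesis
    proof (cases "card (cell Q (nbrs E v) (t mod J)) = Suc 0")
      case False
      define m2 where "m2 = m(16 := cnt p Q, 13 := t mod J + t mod J, 14 := cnt p (t mod J), 15 := Suc t)"
      have "exploring xs E i (Suc t) bs m2"
        using B t deg False unfolding exploring_def m2_def v_def p_def by (auto simp: less_Suc_eq)
      then have "explore_inv xs E i tot (Suc t) m2"
        using inv' by (auto simp: explore_inv_def m2_def marks_def)
      then show ?thesis
        unfolding explore_step_def step_time_def m2_def using degk False
        by (simp add: reaches_simps facts flip: rec_def)
    next
      case True
      define u where "u = \<Sum>(cell Q (nbrs E v) (t mod J))"
      have u: "cell Q (nbrs E v) (t mod J) = {u}"
        using cell_eq_singleton True unfolding u_def by simp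
      define m2 where "m2 = m(16 := cnt p Q, 13 := t mod J + t mod J, 14 := sm p (t mod J), 9 := u)"
      have "wp (find_prog k @ [visit_cmd, Assign (Direct 15) Plus (reg 15) (Const 1)]) (find_time + 20) m2
          (explore_inv xs E i tot (Suc t))"
      proof (rule visit_correct)
        show "exploring xs E i t bs m2" using bs by (simp add: exploring_def m2_def)
        show "marks xs i m2" using inv'(5) by (simp add: marks_def m2_def)
        show "Data xs (nbrs E) m2" using inv'(1) by (simp add: m2_def)
      qed (use inv' i t G deg u tw in \<open>auto simp: m2_def v_def p_def\<close>)
      then have "wp (find_prog k @ [visit_cmd, Assign (Direct 15) Plus (reg 15) (Const 1)]) (34 + find_time) m2
          (explore_inv xs E i tot (Suc t))" by (rule reaches_mono_time) simp
      then show ?thesis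
        unfolding explore_step_def step_time_def m2_def u_def using degk True
        by (simp add: reaches_simps facts flip: rec_def)
    qed
  qed
qed


text \<open>Once the counter has caught up with the queue, all \<open>J\<close> buckets of every
  entry have been inspected. By \<open>ex_singleton_cell\<close> each neighbour is alone in one of
  them, so the queue is closed under neighbours and \<open>component_minimal\<close>
  applies.\<close>

lemma exploring_complete:
  assumes "Data xs (nbrs E) m" "exploring xs E i t bs m" "\<not> t < m 18" "0 < i" "graph_on n E"
  shows "component E (vtx xs i) = vtx xs ` set bs" "card (component E (vtx xs i)) = length bs"
    "leader k E (set xs) (vtx xs i)"
proof -
  note B = assms(2)[unfolded exploring_def]
  note D = DataD[OF assms(1)]
  have J: "0 < J" using Q_less_J by simp
  have t: "t = length bs * J" using B assms(3) by simp
  have sub: "set bs \<subseteq> {1..length xs}"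
  proof -
    have "set bs \<subseteq> {i..length xs}" using B by blast
    then show ?thesis using assms(4) by auto
  qed
  have "nbrs E x \<subseteq> vtx xs ` set bs" if x: "x \<in> vtx xs ` set bs" for x
  proof
    fix u assume u: "u \<in> nbrs E x"
    obtain l where l: "l < length bs" "x = vtx xs (bs ! l)" using x by (auto simp: in_set_conv_nth)
    have bound: "l * J + j < t" if "j < J" for j
    proof -
      have "l * J + j < Suc l * J" using that by simp
      also have "\<dots> \<le> length bs * J" using l(1) by (intro mult_right_mono) auto
      finally show ?thesis using t by simp
    qed
    have div: "(l * J + j) div J = l" "(l * J + j) mod J = j" if "j < J" for j using that by auto
    have proc: "card (nbrs E x) < k \<and> (\<forall>u. cell Q (nbrs E x) j = {u} \<longrightarrow> u \<in> vtx xs ` set bs)" if "j < J" for j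
    proof -
      have "\<forall>t' < t. card (nbrs E (vtx xs (bs ! (t' div J)))) < k \<and>
        (\<forall>u. cell Q (nbrs E (vtx xs (bs ! (t' div J)))) (t' mod J) = {u} \<longrightarrow> u \<in> vtx xs ` set bs)"
        using B by blast
      from this[rule_format, OF bound[OF that]] show ?thesis
        unfolding div[OF that] l(2) by blast
    qed
    have "nbrs E x \<subseteq> {1..n}" using nbrs_subset[OF assms(5)] by blast
    moreover have "card (nbrs E x) \<le> k" using proc[OF J] by simp
    ultimately obtain j where "j < J" "cell Q (nbrs E x) j = {u}"
      using ex_singleton_cell[OF _ n_less u, of k] unfolding Q_def J_def by blast
    then show "u \<in> vtx xs ` set bs" using proc by blast
  qed
  moreover have "i \<in> set bs" using B nth_mem[of 0 bs] by auto
  ultimately have "component E (vtx xs i) \<subseteq> vtx xs ` set bs"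
    by (intro component_minimal) auto
  then show comp: "component E (vtx xs i) = vtx xs ` set bs" using B by blast
  have "card (vtx xs ` set bs) = card (set bs)"
    by (intro card_image inj_on_subset[OF vtx_inj[OF D(11)] sub])
  then show card: "card (component E (vtx xs i)) = length bs" using comp B by (simp add: distinct_card)
  have "vtx xs p \<in> set xs \<and> vtx xs i \<le> vtx xs p" if "p \<in> set bs" for p
  proof -
    have "p \<in> {i..length xs}" using B that by blast
    then show ?thesis using vtx_mono[OF D(11) assms(4), of p] assms(4) by (cases "i = p") auto
  qed
  then show "leader k E (set xs) (vtx xs i)"
    using card B unfolding leader_def comp by auto
qed

definition weight :: "nat list \<Rightarrow> nat set set \<Rightarrow> nat \<Rightarrow> nat" where
  "weight xs E i =
     (if leader k E (set xs) (vtx xs i) then q ^ card (component E (vtx xs i)) else 0)"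

text \<open>Keeps the running total over at most \<open>n\<close> roots within \<open>n * n\<close>,
  so that register 0 does not overflow.\<close>

lemma weight_le: "weight xs E i \<le> n"
proof (cases "leader k E (set xs) (vtx xs i)")
  case True
  then have "q ^ card (component E (vtx xs i)) \<le> q ^ k"
    using q_pos by (intro power_increasing) (auto simp: leader_def)
  then show ?thesis using q_pow by (simp add: weight_def)
qed (simp add: weight_def)

definition "explore_time = k * J * Suc step_time + 20"

lemma explore_correct:
  assumes "Data xs (nbrs E) m" "m 17 = i" "0 < i" "i \<le> length xs" "graph_on n E" "m 0 = tot"
    and "marks xs (Suc i) m" "tot + n < 2 ^ w"
  shows "wp (explore_prog k) explore_time m (\<lambda>m'. Data xs (nbrs E) m' \<and> m' 17 = i - 1 \<and>
    marks xs i m' \<and> m' 0 = tot + weight xs E i)"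
proof -
  define P where "P m' \<longleftrightarrow> Data xs (nbrs E) m' \<and> m' 17 = i - 1 \<and>
    marks xs i m' \<and> m' 0 = tot + weight xs E i" for m'
  note D = DataD[OF assms(1)]
  have i: "i \<le> cap" "i < 2 ^ w" using assms(4) D n2_less by linarith+
  have iZ: "i * Z < 2 ^ w" using address_less_word(1)[OF i(1)] unfolding rec_def by linarith
  have A40: "40 < A" using A_ge k_pos by simp
  have buf40: "buf 0 = 40" unfolding buf_def by (rule add_0)
  have neq40: "mrk p \<noteq> 40" "40 \<noteq> mrk p" for p
    using buf_neq(4,5)[OF k_pos, of p] unfolding buf40 by blast+
  have v40: "volatile 40" using volatile_buf[OF k_pos] by (simp add: buf40)
  have "q ^ 1 \<le> q ^ k" using q_pos k_pos by (intro power_increasing) auto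
  then have qw: "q < 2 ^ w" using q_pow n2_less by simp
  define m1 where "m1 = m(40 := i, 14 := mrk i, mrk i := i, 18 := J, 19 := q, 15 := 0)"
  \<comment> \<open>The limit in register 18 grows with the queue, so the measure counts down from
    its largest possible value \<open>k * J\<close>.\<close>
  define I where "I z m' \<longleftrightarrow> (\<exists>t. explore_inv xs E i tot t m' \<and> t \<le> k * J \<and> z = k * J - t)" for z m'
  have loop: "wp (While (Less (reg 15) (reg 18)) (explore_step k) # [
     Cond (Equal (reg 18) (Const 0)) [] [Assign (Direct 0) Plus (reg 0) (reg 19)],
     Assign (Direct 17) Minus (reg 17) (Const 1)]) (k * J * Suc step_time + Suc 5) m1 P"
  proof (rule reaches_While[where I = I])
    have "m (mrk p) \<noteq> i" if "0 < p" "p \<le> length xs" for p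
      using assms(3,7) that unfolding marks_def by (metis not_less_eq_eq order_refl less_not_refl)
    then have "exploring xs E i 0 [i] m1"
      using assms(3,4) k_pos unfolding exploring_def
      by (auto simp: m1_def buf40 neq40 marks_def address_distinct)
    moreover have "Data xs (nbrs E) m1" using assms(1) i by (simp add: m1_def volatile_mrk v40)
    moreover have "marks xs i m" using assms(7) unfolding marks_def by (meson Suc_leD)
    then have "marks xs i m1" by (simp add: m1_def marks_def neq40 address_distinct)
    ultimately have "explore_inv xs E i tot 0 m1"
      using assms(2,6) neq40 by (auto simp: explore_inv_def m1_def)
    then show "I (k * J) m1" by (auto simp: I_def)
  next
    show "fits A m'" if "I z m'" for z m' using that DataD(8) by (auto simp: I_def explore_inv_def)
  next
    fix z m' assume inv: "I z m'" and test: "test_val w inp m' (Less (reg 15) (reg 18))"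
    obtain t where t: "explore_inv xs E i tot t m'" "t \<le> k * J" "z = k * J - t" using inv by (auto simp: I_def)
    have t18: "t < m' 18" using test t(1) by (simp add: explore_inv_def)
    then obtain bs where "exploring xs E i t bs m'" using t(1) by (auto simp: explore_inv_def)
    then have "m' 18 \<le> k * J" by (auto simp: exploring_def)
    then have "t < k * J" using t18 by simp
    show "wp (explore_step k) step_time m' (\<lambda>m'. \<exists>i<z. I i m')"
    proof (rule wp_conseq[OF explore_step_correct[OF t(1) assms(3,4,5) t18]])
      fix m'' assume "explore_inv xs E i tot (Suc t) m''"
      then have "I (k * J - Suc t) m''" using \<open>t < k * J\<close> by (auto simp: I_def)
      moreover have "k * J - Suc t < z" using t(3) \<open>t < k * J\<close> by simp
      ultimately show "\<exists>i<z. I i m''" by blast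
    qed
  next
    fix z m' assume inv: "I z m'" and test: "\<not> test_val w inp m' (Less (reg 15) (reg 18))"
    obtain t where t: "explore_inv xs E i tot t m'" using inv by (auto simp: I_def)
    then have t18: "\<not> t < m' 18" using test by (simp add: explore_inv_def)
    have inv': "Data xs (nbrs E) m'" "m' 17 = i" "m' 0 = tot" "marks xs i m'" using t by (auto simp: explore_inv_def)
    note D' = DataD[OF inv'(1)]
    have P1: "P (m'(17 := i - Suc 0))" if "weight xs E i = 0"
      using that inv' by (simp add: P_def marks_def)
    have P2: "P (m'(0 := tot + weight xs E i, 17 := i - Suc 0))"
      using inv' by (simp add: P_def marks_def)
    show "wp [Cond (Equal (reg 18) (Const 0)) [] [Assign (Direct 0) Plus (reg 0) (reg 19)],
     Assign (Direct 17) Minus (reg 17) (Const 1)] 5 m' P"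
    proof (cases "m' 18 = 0")
      case True
      then have "\<not> leader k E (set xs) (vtx xs i)"
        using t Q_less_J by (auto simp: explore_inv_def exploring_def)
      then have "P (m'(17 := i - Suc 0))" by (intro P1) (simp add: weight_def)
      then show ?thesis using True inv' D' i assms(3) by (simp add: reaches_simps)
    next
      case False
      then obtain bs where bs: "exploring xs E i t bs m'" using t by (auto simp: explore_inv_def)
      note C = exploring_complete[OF inv'(1) bs t18 assms(3,5)]
      have "m' 19 = weight xs E i" using bs C by (simp add: weight_def exploring_def)
      moreover have "tot + weight xs E i < 2 ^ w" using weight_le[of xs E i] assms(8) by linarith
      ultimately show ?thesis using False inv' D' i assms(3) P2 by (simp add: reaches_simps)
    qed
  qed
  define T where "T = k * J * Suc step_time"
  have "k * J * Suc step_time + Suc 5 \<le> 12 + T" by (simp add: T_def)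
  from reaches_mono_time[OF loop this]
  show ?thesis
    unfolding explore_prog_def explore_time_def P_def[symmetric] m1_def T_def[symmetric]
    using D i iZ A40 assms(2) qw J_less
    by (simp add: reaches_simps address_less address_less_word add.commute[of _ 20] neq40 flip: rec_def)
qed

definition "report_time = cap * Suc explore_time + 10"

lemma report_correct:
  assumes "Rep xs (nbrs E) m" "graph_on n E"
  shows "wp (sketch_report k) report_time m (\<lambda>m'. m' 0 = estimate k q n E (set xs) \<and> m' 1 = 1)"
proof -
  have D0: "Data xs (nbrs E) m" using assms(1) by (auto simp: Rep_def Data_def)
  note D = DataD[OF D0]
  define s where "s = length xs"
  have s: "s \<le> cap" "s \<le> n" "s < 2 ^ w" using D n2_less by (auto simp: s_def)
  \<comment> \<open>Roots run from the last record down to the first; \<open>tot j\<close> is what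
    the roots above \<open>j\<close> have contributed.\<close>
  define tot where "tot j = (\<Sum>i \<in> {Suc j..s}. weight xs E i)" for j
  have tot_le: "tot j + n < 2 ^ w" for j
  proof -
    have "tot j \<le> of_nat (card {Suc j..s}) * n" unfolding tot_def using weight_le by (intro sum_bounded_above) auto
    also have "\<dots> \<le> n * n" using s(2) by (intro mult_right_mono) auto
    finally show ?thesis using n2_less by linarith
  qed
  have tot0: "tot 0 = estimate k q n E (set xs)"
  proof -
    have "bij_betw (vtx xs) {1..s} (set xs)"
      unfolding bij_betw_def
    proof
      show "inj_on (vtx xs) {1..s}" unfolding s_def by (rule vtx_inj[OF D(11)])
      show "vtx xs ` {1..s} = set xs"
      proof safe
        show "vtx xs p \<in> set xs" if "p \<in> {1..s}" for p using that by (auto simp: s_def)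
        show "x \<in> vtx xs ` {1..s}" if x: "x \<in> set xs" for x
        proof -
          obtain l where "l < s" "x = xs ! l" using x by (auto simp: in_set_conv_nth s_def)
          then show ?thesis by (intro image_eqI[of _ _ "Suc l"]) auto
        qed
      qed
    qed
    from sum.reindex_bij_betw[OF this, of "\<lambda>v. if leader k E (set xs) v then q ^ card (component E v) else 0"]
    have "tot 0 = (\<Sum>v \<in> set xs. if leader k E (set xs) v then q ^ card (component E v) else 0)"
      by (simp add: tot_def weight_def)
    also have "\<dots> = (\<Sum>v | v \<in> set xs \<and> leader k E (set xs) v. q ^ card (component E v))"
      by (simp add: sum.If_cases Int_def)
    finally show ?thesis using estimate_leaders[OF assms(2) D(12)] by simp
  qed
  define I where "I j m' \<longleftrightarrow> Data xs (nbrs E) m' \<and> m' 17 = j \<and> j \<le> s \<and> marks xs (Suc j) m' \<and> m' 0 = tot j" for j m'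
  define P where "P m' \<longleftrightarrow> m' 0 = estimate k q n E (set xs) \<and> m' 1 = 1" for m' :: memory
  have loop: "wp (While (Less (Const 0) (reg 17)) (explore_prog k) # [
     Assign (Direct 1) Plus (Const 1) (Const 0)]) (s * Suc explore_time + Suc 3) (m(0 := 0, 17 := s)) P"
  proof (rule reaches_While[where I = I])
    show "I s (m(0 := 0, 17 := s))" using D0 assms(1) by (auto simp: I_def tot_def marks_def Rep_def gr0_conv_Suc s_def)
  next
    show "fits A m'" if "I z m'" for z m' using that DataD(8) by (auto simp: I_def)
  next
    fix j m' assume inv: "I j m'" and test: "test_val w inp m' (Less (Const 0) (reg 17))"
    have j: "0 < j" "j \<le> length xs" using inv test by (auto simp: I_def s_def)
    have "wp (explore_prog k) explore_time m' (\<lambda>m''. Data xs (nbrs E) m'' \<and> m'' 17 = j - 1 \<and>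
        marks xs j m'' \<and> m'' 0 = tot j + weight xs E j)"
      using inv j tot_le assms(2) by (intro explore_correct) (auto simp: I_def)
    then show "wp (explore_prog k) explore_time m' (\<lambda>m'. \<exists>i<j. I i m')"
    proof (rule wp_conseq)
      fix m'' assume post: "Data xs (nbrs E) m'' \<and> m'' 17 = j - 1 \<and> marks xs j m'' \<and> m'' 0 = tot j + weight xs E j"
      have "{j..s} = insert j {Suc j..s}" using j by (auto simp: s_def)
      then have "tot (j - 1) = tot j + weight xs E j" using j by (simp add: tot_def)
      then have "I (j - 1) m''" using post j by (simp add: I_def s_def)
      moreover have "j - 1 < j" using j by simp
      ultimately show "\<exists>i<j. I i m''" by blast
    qed
  next
    fix j m' assume inv: "I j m'" and test: "\<not> test_val w inp m' (Less (Const 0) (reg 17))"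
    then have "fits A m'" "m' 0 = tot 0" using DataD(8) by (auto simp: I_def)
    then show "wp [Assign (Direct 1) Plus (Const 1) (Const 0)] 3 m' P"
      by (simp add: reaches_simps P_def tot0)
  qed
  define T where "T = cap * Suc explore_time"
  have "s * Suc explore_time + Suc 3 \<le> 8 + T"
    using mult_le_mono1[OF s(1), of "Suc explore_time"] by (simp add: T_def)
  from reaches_mono_time[OF loop this]
  show ?thesis
    unfolding sketch_report_def report_time_def P_def[symmetric] T_def[symmetric]
    using D s by (simp add: reaches_simps s_def add.commute[of _ 10])
qed

end

section \<open>Initialisation\<close>

definition sample_tail :: "nat \<Rightarrow> cmd list" where
  "sample_tail k = [
     Assign (Direct 13) Mod (reg 13) (reg 5),
     Cond (Equal (reg 13) (Const 0)) [
       Cond (Less (reg 8) (reg 6)) [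
         Assign (Direct 8) Plus (reg 8) (Const 1),
         Assign (Direct 14) Times (reg 8) (reg 4),
         Assign (Direct 14) Plus (reg 14) (Const (base k)),
         Assign (Indirect 14) Plus (reg 9) (Const 0)] []] [],
     Assign (Direct 9) Plus (reg 9) (Const 1)]"

definition sample_step :: "nat \<Rightarrow> cmd list" where
  "sample_step k = Random (Direct 13) # sample_tail k"

definition size_prog :: "nat \<Rightarrow> cmd list" where
  "size_prog k = [
     Assign (Direct 22) Plus (Input 0) (Const 1),
     Assign (Direct 7) Plus (Const 1) (Const 0),
     Assign (Direct 12) Plus (Const 0) (Const 0),
     While (Less (reg 7) (reg 22)) [
       Assign (Direct 7) Plus (reg 7) (reg 7),
       Assign (Direct 12) Plus (reg 12) (Const 1)],
     Assign (Direct 2) Times (reg 12) (Const k),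
     Assign (Direct 2) Plus (reg 2) (Const 2),
     Assign (Direct 3) Times (reg 2) (reg 2),
     Assign (Direct 4) Plus (reg 3) (reg 3),
     Assign (Direct 4) Plus (reg 4) (Const 2),
     Assign (Direct 21) Times (Const k) (reg 3),
     Assign (Direct 9) Plus (Input 0) (Const 0)]"

text \<open>Takes a \<open>k\<close>-th root up to a factor of two without computing powers of
  \<open>q\<close>: each division by \<open>2 ^ k\<close> doubles \<open>q\<close>, until the
  quotient drops below \<open>2 ^ k\<close>.\<close>

definition rate_prog :: "nat \<Rightarrow> cmd list" where
  "rate_prog k = [
     Assign (Direct 5) Plus (Const 1) (Const 0),
     While (Less (Const (2 ^ k - 1)) (reg 9)) [
       Assign (Direct 9) Div (reg 9) (Const (2 ^ k)),
       Assign (Direct 5) Plus (reg 5) (reg 5)],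
     Assign (Direct 6) Div (Input 0) (reg 5),
     Assign (Direct 6) Plus (reg 6) (Const 1),
     Assign (Direct 6) Times (reg 6) (Const 6),
     Assign (Direct 9) Plus (Const 1) (Const 0)]"

text \<open>\<open>\<sigma>\<close> single halvings replace one division by
  \<open>2 ^ \<sigma>\<close>: constants are reduced modulo \<open>2 ^ w\<close>, and the word
  length may not depend on \<open>t\<close>, so \<open>2 ^ \<sigma>\<close> need not fit into a
  word.\<close>

definition sketch_init :: "nat \<Rightarrow> nat \<Rightarrow> cmd list" where
  "sketch_init k \<sigma> = size_prog k @ replicate \<sigma> (Assign (Direct 9) Div (reg 9) (Const 2)) @
     rate_prog k @ [While (Less (reg 9) (reg 22)) (sample_step k)]"

section \<open>Rounding to powers of two\<close>

definition size_exp :: "nat \<Rightarrow> nat" where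
  "size_exp n = (LEAST l. n < 2 ^ l)"

definition rate_exp :: "nat \<Rightarrow> nat \<Rightarrow> nat" where
  "rate_exp k M = (LEAST a. M div (2 ^ k) ^ a < 2 ^ k)"

text \<open>For positive \<open>k\<close> this is the \<open>k\<close>-th root of \<open>M\<close>
  rounded down to a power of two, and 1 for \<open>M = 0\<close>.\<close>

definition rate :: "nat \<Rightarrow> nat \<Rightarrow> nat" where
  "rate k M = 2 ^ rate_exp k M"

definition capacity :: "nat \<Rightarrow> nat \<Rightarrow> nat" where
  "capacity q n = (n div q + 1) * 6"

lemma size_exp: "n < 2 ^ size_exp n"
  unfolding size_exp_def by (rule LeastI[of _ n]) (rule less_exp)

lemma size_exp_minimal: "l < size_exp n \<Longrightarrow> 2 ^ l \<le> n"
  using not_less_Least[of l "\<lambda>l. n < 2 ^ l"] by (simp add: size_exp_def)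

lemma rate_exp:
  assumes "0 < k"
  shows "M div (2 ^ k) ^ rate_exp k M < 2 ^ k"
  unfolding rate_exp_def
proof (rule LeastI[of _ M])
  have "M < 2 ^ M" by (rule less_exp)
  also have "\<dots> \<le> 2 ^ (k * M)" using assms by (intro power_increasing) auto
  finally have "M < (2 ^ k) ^ M" by (simp add: power_mult)
  then show "M div (2 ^ k) ^ M < 2 ^ k" by simp
qed

lemma rate_exp_minimal: "a < rate_exp k M \<Longrightarrow> 2 ^ k \<le> M div (2 ^ k) ^ a"
  using not_less_Least[of a "\<lambda>a. M div (2 ^ k) ^ a < 2 ^ k"] by (simp add: rate_exp_def)

text \<open>The exponent before the least one still leaves a quotient of at least
  \<open>2 ^ k\<close>. Rate 1 is excluded because it also occurs for \<open>M = 0\<close>.\<close>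

lemma rate_upper:
  assumes "rate k M \<noteq> 1"
  shows "rate k M ^ k \<le> M"
proof -
  obtain b where b: "rate_exp k M = Suc b" using assms by (cases "rate_exp k M") (auto simp: rate_def)
  then have "2 ^ k * (2 ^ k) ^ b \<le> M"
    using rate_exp_minimal[of b k M] by (simp add: less_eq_div_iff_mult_less_eq)
  then show ?thesis by (simp add: rate_def b power_mult_distrib power_mult[symmetric] mult.commute power_add[symmetric])
qed

lemma rate_lower:
  assumes "0 < k"
  shows "M < (2 * rate k M) ^ k"
proof -
  have "M < 2 ^ k * (2 ^ k) ^ rate_exp k M"
    using rate_exp[OF assms, of M] by (simp add: div_less_iff_less_mult)
  then show ?thesis by (simp add: rate_def power_mult_distrib power_mult[symmetric] mult.commute)
qed

context sketch
begin

text \<open>\<open>ys\<close> is the full sample, including vertices dropped beyond the capacity, so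
  that its distribution is exactly \<open>sample\<close>; the memory holds
  \<open>take cap ys\<close>. The last conjunct makes all marks and sketches zero, as fits the empty
  graph.\<close>

definition sampling :: "nat \<Rightarrow> nat list \<Rightarrow> memory \<Rightarrow> bool" where
  "sampling v ys m \<longleftrightarrow> m 9 = v \<and> m 22 = Suc n \<and> m 6 = cap \<and> m 2 = Q \<and> m 3 = J \<and> m 5 = q \<and>
     m 21 = k * J \<and> fits A m \<and> index (take cap ys) m \<and>
     sorted_wrt (<) ys \<and> set ys \<subseteq> {1..<v} \<and> (\<forall>a \<ge> 40. a \<notin> range rec \<longrightarrow> m a = 0)"

lemma sampling_Rep: "sampling v ys m \<Longrightarrow> Rep (take cap ys) (nbrs {}) m"
proof -
  assume s: "sampling v ys m"
  have "m (mrk p) = 0" "j < J \<Longrightarrow> m (cnt p j) = 0" "j < J \<Longrightarrow> m (sm p j) = 0" for p j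
  proof -
    have "40 \<le> mrk p" "40 \<le> cnt p j" "40 \<le> sm p j"
      using rec_ge[of p] unfolding mrk_def cnt_def sm_def by linarith+
    then show "m (mrk p) = 0" "j < J \<Longrightarrow> m (cnt p j) = 0" "j < J \<Longrightarrow> m (sm p j) = 0"
      using s by (auto simp: sampling_def address_distinct)
  qed
  then show ?thesis using s by (auto simp: Rep_def sampling_def stores_def cell_def nbrs_def)
qed

lemma index_upd: "a \<notin> {4, 7, 8} \<union> range rec \<Longrightarrow> index xs m \<Longrightarrow> index xs (m(a := x))"
  by (erule index_agree) auto

lemma sampling_skip:
  assumes "sampling v ys m"
  shows "sampling (Suc v) ys (m(13 := x, 9 := Suc v))"
proof -
  note S = assms[unfolded sampling_def]
  have "index (take cap ys) (m(13 := x, 9 := Suc v))" using S by (intro index_upd) auto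
  moreover have "set ys \<subseteq> {1..<Suc v}" using S by fastforce
  ultimately show ?thesis by (simp add: sampling_def S)
qed

lemma sampling_drop:
  assumes "sampling v ys m" "cap \<le> length ys" "0 < v"
  shows "sampling (Suc v) (ys @ [v]) (m(13 := x, 9 := Suc v))"
proof -
  note S = assms(1)[unfolded sampling_def]
  have "index (take cap ys) (m(13 := x, 9 := Suc v))" using S by (intro index_upd) auto
  moreover have "set (ys @ [v]) \<subseteq> {1..<Suc v}" using S assms(3) by fastforce
  moreover have "sorted_wrt (<) (ys @ [v])" using S by (auto simp: sorted_wrt_append)
  ultimately show ?thesis using assms(2) by (simp add: sampling_def S)
qed

lemma sampling_add:
  assumes "sampling v ys m" "length ys < cap" "0 < v" "v \<le> n"
  shows "sampling (Suc v) (ys @ [v])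
    (m(13 := x, 8 := Suc (length ys), 14 := rec (Suc (length ys)), rec (Suc (length ys)) := v, 9 := Suc v))"
    (is "sampling _ _ ?m")
proof -
  note S = assms(1)[unfolded sampling_def]
  have ys: "index ys m" using S assms(2) by simp
  have sorted: "sorted_wrt (<) (ys @ [v])" using S by (auto simp: sorted_wrt_append)
  have sub: "set (ys @ [v]) \<subseteq> {1..<Suc v}" using S assms(3) by fastforce
  moreover have "{1..<Suc v} \<subseteq> {1..n}" using assms(4) by auto
  ultimately have subn: "set (ys @ [v]) \<subseteq> {1..n}" by blast
  have "?m (rec i) = (0 # ys @ [v]) ! i" if i: "i \<le> Suc (length ys)" for i
  proof (cases "i = Suc (length ys)")
    case False
    then have "m (rec i) = (0 # ys) ! i" using ys i by (auto simp: index_def)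
    also have "\<dots> = ((0 # ys) @ [v]) ! i" using False i by (subst nth_append) auto
    finally show ?thesis using False by (simp add: rec_rec)
  qed (simp add: nth_append)
  then have idx: "index (ys @ [v]) ?m"
    using ys sorted subn assms(2) by (simp add: index_def)
  have "take cap (ys @ [v]) = ys @ [v]" using assms(2) by simp
  moreover have "?m a = 0" if "40 \<le> a" "a \<notin> range rec" for a
    using that S by auto
  ultimately show ?thesis
    using idx sorted sub rec_less0[of "Suc (length ys)"] assms(2) by (simp add: sampling_def S)
qed

text \<open>The random word of an iteration drives the machine and \<open>sample\<close> alike;
  skipping, storing and dropping a vertex each preserve \<open>sampling\<close>.\<close>

lemma sample_loop:
  assumes "sampling v ys m" "0 < v" "v \<le> Suc n"
  shows "reaches [While (Less (reg 9) (reg 22)) (sample_step k)] ((Suc n - v) * 20 + 5) m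
    (sample w q [v..<Suc n] ys) (\<lambda>m ys. Rep (take cap ys) (nbrs {}) m)"
  using assms
proof (induction "Suc n - v" arbitrary: v ys m)
  case 0
  then have v: "v = Suc n" by simp
  have "reaches [] 4 m (return_pmf ys) (\<lambda>m ys. Rep (take cap ys) (nbrs {}) m)"
    using 0 by (auto simp: reaches_Nil sampling_Rep) (simp add: sampling_def)
  then show ?case
    using 0 v by (intro reaches_While_False) (auto simp: sampling_def)
next
  case (Suc d)
  then have v: "v \<le> n" "0 < v" by auto
  note S = Suc.prems(1)[unfolded sampling_def]
  have upt: "[v..<Suc n] = v # [Suc v..<Suc n]" using v by (simp add: upt_conv_Cons del: upt_Suc)
  have m8: "m 8 = (if length ys < cap then length ys else cap)" using S by (auto simp: index_def min_def)
  have vw: "Suc v < 2 ^ w" "v < 2 ^ w" using v n2_less le_square[of n] n_pos by linarith+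
  have IH: "reaches [While (Less (reg 9) (reg 22)) (sample_step k)] T m'
      (sample w q [Suc v..<Suc n] ys') (\<lambda>m ys. Rep (take cap ys) (nbrs {}) m)"
    if "sampling (Suc v) ys' m'" "(n - v) * 20 + 5 \<le> T" for T ys' m'
    by (rule reaches_mono_time[OF Suc.hyps(1)]) (use Suc.hyps(2) v that in auto)
  define T where "T = (n - v) * 20"
  have T: "(Suc n - v) * 20 + 5 = 25 + T" using v by (simp add: T_def Suc_diff_le)
  show ?case
    unfolding T upt sample.simps
  proof (rule reaches_While_True)
    show "fits A m" "test_val w inp m (Less (reg 9) (reg 22))" "0 < 25 + T" using S v by auto
    define W where "W = [While (Less (reg 9) (reg 22)) (sample_step k)]"
    have unfold: "sample_step k @ W = Random (Direct 13) # (sample_tail k @ W)" by (simp add: sample_step_def)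
    have "reaches (sample_step k @ W) (25 + T - 1) m
       (bind_pmf (pmf_of_set {..<2 ^ w}) (\<lambda>r. sample w q [Suc v..<Suc n] (if r mod q = 0 then ys @ [v] else ys)))
       (\<lambda>m ys. Rep (take cap ys) (nbrs {}) m)"
      unfolding unfold
    proof (rule reaches_Random)
      show "fits A m" "0 < 25 + T - 1" using S by auto
      fix r :: nat assume "r < 2 ^ w"
      have facts: "m 9 = v" "m 22 = Suc n" "m 6 = cap" "m 5 = q" "m 4 = Z" "fits A m"
        using S by (simp_all add: index_def)
      show "reaches (sample_tail k @ W) (25 + T - 1 - 1) (m(address m (Direct 13) := r))
           (sample w q [Suc v..<Suc n] (if r mod q = 0 then ys @ [v] else ys))
           (\<lambda>m ys. Rep (take cap ys) (nbrs {}) m)"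
      proof (cases "r mod q = 0")
        case False
        from IH[OF sampling_skip[OF Suc.prems(1), of "r mod q"], of "T + 20", folded W_def]
        show ?thesis
          unfolding sample_tail_def using False vw
          by (simp add: reaches_simps facts T_def del: upt_Suc) (rule reaches_mono_time, assumption, simp)
      next
        case r: True
        show ?thesis
        proof (cases "length ys < cap")
          case True
          have p: "Suc (length ys) \<le> cap" using True by simp
          have pw: "Suc (length ys) * Z < 2 ^ w" "Suc (length ys) < 2 ^ w"
            using address_less_word(1)[OF p] unfolding rec_def Z_def by auto
          from IH[OF sampling_add[OF Suc.prems(1) True v(2,1), of "r mod q"], of "T + 15", folded W_def]
          show ?thesis
            unfolding sample_tail_def using r vw True pw address_less_word(1)[OF p] address_less(1)[OF p]
            by (simp add: reaches_simps facts m8 T_def del: upt_Suc mult_Suc flip: rec_def)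
              (rule reaches_mono_time, assumption, simp)
        next
          case False
          from IH[OF sampling_drop[OF Suc.prems(1) _ v(2), of "r mod q"], of "T + 15", folded W_def]
          show ?thesis
            unfolding sample_tail_def using r vw False
            by (simp add: reaches_simps facts m8 T_def del: upt_Suc) (rule reaches_mono_time, assumption, simp)
        qed
      qed
    qed
    then show "reaches (sample_step k @ [While (Less (reg 9) (reg 22)) (sample_step k)]) (25 + T - 1) m
       (bind_pmf (pmf_of_set {..<2 ^ w}) (\<lambda>r. sample w q [Suc v..<Suc n] (if r mod q = 0 then ys @ [v] else ys)))
       (\<lambda>m ys. Rep (take cap ys) (nbrs {}) m)"
      by (simp add: W_def del: upt_Suc)
  qed
qed

lemma halve_correct:
  "fits A m \<Longrightarrow> wp (replicate \<sigma> (Assign (Direct 9) Div (reg 9) (Const 2))) \<sigma> m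
     (\<lambda>m'. m' = m(9 := m 9 div 2 ^ \<sigma>))"
proof (induction \<sigma> arbitrary: m)
  case 0
  then show ?case by (simp add: reaches_Nil)
next
  case (Suc \<sigma>)
  have "wp (replicate \<sigma> (Assign (Direct 9) Div (reg 9) (Const 2))) \<sigma> (m(9 := m 9 div 2))
     (\<lambda>m'. m' = m(9 := m 9 div 2 div 2 ^ \<sigma>))"
  proof -
    have "fits A (m(9 := m 9 div 2))" using Suc.prems by simp
    from Suc.IH[OF this] show ?thesis by (simp only: fun_upd_upd fun_upd_same)
  qed
  then show ?case using Suc.prems
    by (simp add: reaches_simps div_mult2_eq fun_upd_other del: fun_upd_apply)
qed

lemma k_mod [simp]: "k mod 2 ^ w = k"
  using A_ge A_less by (intro mod_less) linarith

lemma size_correct: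
  assumes "inp = [n]" "L = size_exp n"
  shows "wp (size_prog k) (L * 3 + 15) (\<lambda>_. 0) (\<lambda>m'. m' =
    (\<lambda>_. 0)(22 := Suc n, 7 := 2 ^ L, 12 := L, 2 := Q, 3 := J, 4 := Z, 21 := k * J, 9 := n))"
proof -
  define P where "P m' \<longleftrightarrow> m' =
    (\<lambda>_. 0)(22 := Suc n, 7 := 2 ^ L, 12 := L, 2 := Q, 3 := J, 4 := Z, 21 := k * J, 9 := n)" for m' :: memory
  have arg: "inp \<noteq> []" "inp ! 0 = n" using assms(1) by simp_all
  define I where "I z m' \<longleftrightarrow> (\<exists>l \<le> L. z = L - l \<and> m' = (\<lambda>_. 0)(22 := Suc n, 7 := 2 ^ l, 12 := l))" for z and m' :: memory
  have fits0: "fits A (\<lambda>_. 0)" by (simp add: fits_def)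
  have nw: "Suc n < 2 ^ w" "n < 2 ^ w" using n2_less le_square[of n] n_pos by linarith+
  have Jw: "Q < 2 ^ w" "J < 2 ^ w" "J + J < 2 ^ w" "Suc (Suc (J + J)) < 2 ^ w" "k * J < 2 ^ w"
  proof -
    have "Z \<le> A" unfolding A_Z by simp
    then have "Suc (Suc (J + J)) < 2 ^ w" using A_less by (simp add: Z_def)
    then show "Q < 2 ^ w" "J < 2 ^ w" "J + J < 2 ^ w" "Suc (Suc (J + J)) < 2 ^ w"
      using Q_less_J by linarith+
    show "k * J < 2 ^ w" using kJ_less by (simp add: J_def Q_def)
  qed
  have eqs: "Suc (Suc (L * k)) = Q" "Q * Q = J" "Suc (Suc (J + J)) = Z" by (simp_all add: Q_def J_def Z_def)
  have Lk: "L * k < 2 ^ w" using Jw(1) by (simp add: Q_def)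
  have loop: "wp (While (Less (reg 7) (reg 22)) [
       Assign (Direct 7) Plus (reg 7) (reg 7),
       Assign (Direct 12) Plus (reg 12) (Const 1)] # [
     Assign (Direct 2) Times (reg 12) (Const k),
     Assign (Direct 2) Plus (reg 2) (Const 2),
     Assign (Direct 3) Times (reg 2) (reg 2),
     Assign (Direct 4) Plus (reg 3) (reg 3),
     Assign (Direct 4) Plus (reg 4) (Const 2),
     Assign (Direct 21) Times (Const k) (reg 3),
     Assign (Direct 9) Plus (Input 0) (Const 0)]) (L * Suc 2 + Suc 8)
     ((\<lambda>_. 0)(22 := Suc n, 7 := Suc 0, 12 := 0)) P"
  proof (rule reaches_While[where I = I])
    show "I L ((\<lambda>_. 0)(22 := Suc n, 7 := Suc 0, 12 := 0))" by (auto simp: I_def intro!: exI[of _ 0])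
    show "fits A m'" if "I z m'" for z m' using that fits0 by (auto simp: I_def)
  next
    fix z m' assume inv: "I z m'" and test: "test_val w inp m' (Less (reg 7) (reg 22))"
    then obtain l where l: "l \<le> L" "z = L - l" "m' = (\<lambda>_. 0)(22 := Suc n, 7 := 2 ^ l, 12 := l)" by (auto simp: I_def)
    have "2 ^ l < Suc n" using test l(3) by simp
    then have "2 ^ l < (2::nat) ^ L" using n_less by linarith
    then have "l < L" by simp
    have "2 ^ l + 2 ^ l < (2::nat) ^ w" using \<open>2 ^ l < 2 ^ L\<close> L_less by linarith
    moreover have "Suc l < 2 ^ w" using \<open>l < L\<close> L_less_w less_exp[of w] by linarith
    moreover have "I (L - Suc l) ((\<lambda>_. 0)(22 := Suc n, 7 := 2 ^ l + 2 ^ l, 12 := Suc l))"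
      using \<open>l < L\<close> by (auto simp: I_def mult_2 intro!: exI[of _ "Suc l"])
    then have "\<exists>i < z. I i ((\<lambda>_. 0)(22 := Suc n, 7 := 2 ^ l + 2 ^ l, 12 := Suc l))"
      using \<open>l < L\<close> l(2) by (intro exI[of _ "L - Suc l"]) auto
    ultimately show "wp [Assign (Direct 7) Plus (reg 7) (reg 7), Assign (Direct 12) Plus (reg 12) (Const 1)] 2 m' (\<lambda>m'. \<exists>i<z. I i m')"
      unfolding l(3) using fits0 by (simp add: reaches_simps)
  next
    fix z m' assume inv: "I z m'" and test: "\<not> test_val w inp m' (Less (reg 7) (reg 22))"
    then obtain l where l: "l \<le> L" "m' = (\<lambda>_. 0)(22 := Suc n, 7 := 2 ^ l, 12 := l)" by (auto simp: I_def)
    have "\<not> l < L" using size_exp_minimal[of l n] test l(2) assms(2) by auto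
    then have "l = L" using l(1) by simp
    show "wp [
     Assign (Direct 2) Times (reg 12) (Const k),
     Assign (Direct 2) Plus (reg 2) (Const 2),
     Assign (Direct 3) Times (reg 2) (reg 2),
     Assign (Direct 4) Plus (reg 3) (reg 3),
     Assign (Direct 4) Plus (reg 4) (Const 2),
     Assign (Direct 21) Times (Const k) (reg 3),
     Assign (Direct 9) Plus (Input 0) (Const 0)] 8 m' P"
      unfolding l(2) \<open>l = L\<close> 
      by (simp add: reaches_simps arg eqs fits0 Jw[unfolded eqs] Lk nw) (simp add: P_def)
  qed
  have "L * Suc 2 + Suc 8 \<le> L * 3 + 12" by simp
  from reaches_mono_time[OF loop this] show ?thesis
    unfolding size_prog_def P_def[symmetric] using fits0 nw
    by (simp add: reaches_simps arg add.commute[of _ 12] add.commute[of _ 15])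
qed

lemma rate_correct:
  assumes "inp = [n]" "k < w" "q = rate k (m 9)" "cap = capacity q n" "fits A m" "m 9 \<le> n"
  shows "wp (rate_prog k) (rate_exp k (m 9) * 3 + 10) m (\<lambda>m'. m' = m(5 := q, 6 := cap, 9 := Suc 0))"
proof -
  have arg: "inp \<noteq> []" "inp ! 0 = n" using assms(1) by simp_all
  define M where "M = m 9"
  define e where "e = rate_exp k M"
  define P where "P m' \<longleftrightarrow> m' = m(5 := q, 6 := cap, 9 := Suc 0)" for m'
  define I where "I z m' \<longleftrightarrow> (\<exists>a \<le> e. z = e - a \<and> m' = m(5 := 2 ^ a, 9 := M div (2 ^ k) ^ a))" for z m'
  have q: "q = 2 ^ e" using assms(3) by (simp add: rate_def e_def M_def)
  have "q ^ 1 \<le> q ^ k" using q_pos k_pos by (intro power_increasing) auto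
  then have "q \<le> n" using q_pow by simp
  then have qw: "2 ^ e < (2::nat) ^ w" using q n2_less by linarith
  have const_eqs: "(2 ^ k - Suc 0) mod 2 ^ w = 2 ^ k - Suc 0" "2 ^ k mod (2::nat) ^ w = 2 ^ k" "6 mod (2::nat) ^ w = 6"
  proof -
    have *: "2 ^ k < (2::nat) ^ w" using assms(2) by simp
    have "2 ^ k - Suc 0 < (2::nat) ^ w" using * by (rule le_less_trans[rotated]) simp
    then show "(2 ^ k - Suc 0) mod 2 ^ w = 2 ^ k - Suc 0" by (rule mod_less)
    show "2 ^ k mod (2::nat) ^ w = 2 ^ k" using * by (rule mod_less)
    have "6 < (2::nat) ^ w" using A_ge A_less by linarith
    then show "6 mod (2::nat) ^ w = 6" by (rule mod_less)
  qed
  have capA: "cap < A" unfolding A_Z Z_def using mult_le_mono2[of 1 "2 * J + 2" "Suc cap"] by (simp add: base_def)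
  then have capw: "cap < 2 ^ w" using A_less by simp
  have cap: "Suc (n div 2 ^ e) * 6 = cap" using assms(4) by (simp add: capacity_def q)
  have "Suc (n div 2 ^ e) \<le> cap" unfolding cap[symmetric] by simp
  then have capw': "Suc (n div 2 ^ e) < 2 ^ w" using capw by linarith
  have loop: "wp (While (Less (Const (2 ^ k - 1)) (reg 9)) [
       Assign (Direct 9) Div (reg 9) (Const (2 ^ k)),
       Assign (Direct 5) Plus (reg 5) (reg 5)] # [
     Assign (Direct 6) Div (Input 0) (reg 5),
     Assign (Direct 6) Plus (reg 6) (Const 1),
     Assign (Direct 6) Times (reg 6) (Const 6),
     Assign (Direct 9) Plus (Const 1) (Const 0)]) (e * Suc 2 + Suc 5) (m(5 := Suc 0)) P"
  proof (rule reaches_While[where I = I])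
    show "I e (m(5 := Suc 0))" by (auto simp: I_def M_def fun_eq_iff intro!: exI[of _ 0])
    show "fits A m'" if "I z m'" for z m' using that assms(5) by (auto simp: I_def)
  next
    fix z m' assume inv: "I z m'" and test: "test_val w inp m' (Less (Const (2 ^ k - 1)) (reg 9))"
    then obtain a where a: "a \<le> e" "z = e - a" "m' = m(5 := 2 ^ a, 9 := M div (2 ^ k) ^ a)" by (auto simp: I_def)
    have "2 ^ k \<le> M div (2 ^ k) ^ a" using test a(3) const_eqs by (simp add: Suc_le_eq)
    then have "a \<noteq> e" using rate_exp[OF k_pos, of M] by (auto simp: e_def)
    then have "a < e" using a(1) by simp
    then have "2 ^ Suc a \<le> (2::nat) ^ e" by (intro power_increasing) auto
    then have "2 ^ a + 2 ^ a \<le> (2::nat) ^ e" by simp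
    then have "2 ^ a + 2 ^ a < (2::nat) ^ w" using qw by linarith
    moreover have "I (e - Suc a) (m(9 := M div (2 ^ k) ^ a div 2 ^ k, 5 := 2 ^ a + 2 ^ a))"
      using \<open>a < e\<close> unfolding I_def
      by (intro exI[of _ "Suc a"]) (auto simp: fun_eq_iff mult_2 div_mult2_eq[symmetric] mult.commute)
    then have "\<exists>i < z. I i (m(9 := M div (2 ^ k) ^ a div 2 ^ k, 5 := 2 ^ a + 2 ^ a))"
      using \<open>a < e\<close> a(2) by (intro exI[of _ "e - Suc a"]) auto
    ultimately show "wp [Assign (Direct 9) Div (reg 9) (Const (2 ^ k)), Assign (Direct 5) Plus (reg 5) (reg 5)] 2 m' (\<lambda>m'. \<exists>i<z. I i m')"
      unfolding a(3) using assms(5) const_eqs by (simp add: reaches_simps fun_upd_twist[of 5 9])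
  next
    fix z m' assume inv: "I z m'" and test: "\<not> test_val w inp m' (Less (Const (2 ^ k - 1)) (reg 9))"
    then obtain a where a: "a \<le> e" "m' = m(5 := 2 ^ a, 9 := M div (2 ^ k) ^ a)" by (auto simp: I_def)
    have "M div (2 ^ k) ^ a < 2 ^ k" using test a(2) const_eqs by (simp add: not_less) (metis Suc_pred le_imp_less_Suc pos2 zero_less_power)
    then have "e \<le> a" unfolding e_def rate_exp_def by (rule Least_le)
    then have "a = e" using a(1) by simp
    show "wp [Assign (Direct 6) Div (Input 0) (reg 5),
     Assign (Direct 6) Plus (reg 6) (Const 1),
     Assign (Direct 6) Times (reg 6) (Const 6),
     Assign (Direct 9) Plus (Const 1) (Const 0)] 5 m' P"
      unfolding a(2) \<open>a = e\<close> using assms(5) const_eqs capw capw'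
      by (simp add: reaches_simps arg cap del: mult_Suc) (simp add: P_def q fun_eq_iff)
  qed
  have "e * Suc 2 + Suc 5 \<le> e * 3 + 9" by simp
  from reaches_mono_time[OF loop this] show ?thesis
    unfolding rate_prog_def P_def[symmetric] M_def[symmetric] e_def[symmetric] using assms(5)
    by (simp add: reaches_simps add.commute[of _ 9] add.commute[of _ 10])
qed

lemma init_correct:
  assumes "inp = [n]" "k < w" "L = size_exp n" "q = rate k (n div 2 ^ \<sigma>)" "cap = capacity q n"
  shows "\<exists>T. reaches (sketch_init k \<sigma>) T (\<lambda>_. 0) (sample w q [1..<Suc n] [])
    (\<lambda>m ys. Rep (take cap ys) (nbrs {}) m)"
proof -
  define m1 :: memory where "m1 = (\<lambda>_. 0)(22 := Suc n, 7 := 2 ^ L, 12 := L, 2 := Q, 3 := J, 4 := Z, 21 := k * J, 9 := n)"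
  define m2 where "m2 = m1(9 := n div 2 ^ \<sigma>)"
  define m3 where "m3 = m2(5 := q, 6 := cap, 9 := Suc 0)"
  have fits0: "fits A (\<lambda>_. 0)" by (simp add: fits_def)
  then have fits1: "fits A m1" "fits A m2" by (simp_all add: m1_def m2_def)
  have "sampling 1 [] m3"
    unfolding sampling_def index_def using fits0
    by (auto simp: m3_def m2_def m1_def)
  from sample_loop[OF this]
  have loop: "reaches [While (Less (reg 9) (reg 22)) (sample_step k)] (n * 20 + 5) m3
    (sample w q [1..<Suc n] []) (\<lambda>m ys. Rep (take cap ys) (nbrs {}) m)" by simp
  have rate: "wp (rate_prog k) (rate_exp k (m2 9) * 3 + 10) m2 (\<lambda>m'. m' = m3)"
    unfolding m3_def
  proof (rule rate_correct[of m2])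
    show "fits A m2" by (rule fits1(2))
  qed (use assms in \<open>simp_all add: m2_def\<close>)
  have halve: "wp (replicate \<sigma> (Assign (Direct 9) Div (reg 9) (Const 2))) \<sigma> m1 (\<lambda>m'. m' = m2)"
    using halve_correct[OF fits1(1), of \<sigma>] by (simp add: m2_def) (simp add: m1_def)
  have size: "wp (size_prog k) (L * 3 + 15) (\<lambda>_. 0) (\<lambda>m'. m' = m1)"
    unfolding m1_def using assms by (intro size_correct)
  have "reaches (rate_prog k @ [While (Less (reg 9) (reg 22)) (sample_step k)]) (rate_exp k (m2 9) * 3 + 10 + (n * 20 + 5)) m2
    (sample w q [1..<Suc n] []) (\<lambda>m ys. Rep (take cap ys) (nbrs {}) m)"
    by (rule reaches_append[OF rate]) (use loop in simp)
  then have rest: "reaches (replicate \<sigma> (Assign (Direct 9) Div (reg 9) (Const 2)) @ rate_prog k @ [While (Less (reg 9) (reg 22)) (sample_step k)])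
    (\<sigma> + (rate_exp k (m2 9) * 3 + 10 + (n * 20 + 5))) m1
    (sample w q [1..<Suc n] []) (\<lambda>m ys. Rep (take cap ys) (nbrs {}) m)"
    by (intro reaches_append[OF halve]) (simp del: upt_Suc)
  have "reaches (sketch_init k \<sigma>) (L * 3 + 15 + (\<sigma> + (rate_exp k (m2 9) * 3 + 10 + (n * 20 + 5)))) (\<lambda>_. 0)
    (sample w q [1..<Suc n] []) (\<lambda>m ys. Rep (take cap ys) (nbrs {}) m)"
    unfolding sketch_init_def by (rule reaches_append[OF size]) (use rest in \<open>simp del: upt_Suc\<close>)
  then show ?thesis by blast
qed

end

section \<open>Resource bounds and the theorem\<close>

definition sketch_size :: "nat \<Rightarrow> nat \<Rightarrow> nat \<Rightarrow> nat" where
  "sketch_size k L cap = base k + Suc cap * (2 * ((L * k + 2) * (L * k + 2)) + 2)"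

lemma real_div_le: "real (a div b) \<le> real a / real b"
  by (cases "b = 0") (auto simp: le_divide_eq simp flip: of_nat_mult)

lemma rate_pos: "0 < rate k M" by (simp add: rate_def)

lemma rate_le:
  assumes "0 < k" "0 < n" "M \<le> n"
  shows "rate k M ^ k \<le> n" "rate k M \<le> n"
proof -
  show *: "rate k M ^ k \<le> n"
    using rate_upper[of k M] assms by (cases "rate k M = 1") auto
  have "rate k M ^ 1 \<le> rate k M ^ k" using assms(1) rate_pos[of k M] by (intro power_increasing) auto
  then show "rate k M \<le> n" using * by simp
qed

lemma size_exp_le: "n < 2 ^ l \<Longrightarrow> size_exp n \<le> l"
  unfolding size_exp_def by (rule Least_le)

lemma size_exp_pred: "0 < n \<Longrightarrow> 2 ^ size_exp n \<le> 2 * n" "size_exp n \<le> n"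
proof -
  show "size_exp n \<le> n" by (rule size_exp_le) (rule less_exp)
  assume "0 < n"
  then have "size_exp n \<noteq> 0" using size_exp[of n] by (intro notI) simp
  then obtain l where l: "size_exp n = Suc l" by (cases "size_exp n") auto
  then have "2 ^ l \<le> n" using size_exp_minimal[of l n] by simp
  then show "2 ^ size_exp n \<le> 2 * n" by (simp add: l)
qed

lemma le_power_ceiling_log: "n + 1 \<le> 2 ^ nat \<lceil>log 2 (real (n + 1))\<rceil>"
proof -
  define e where "e = nat \<lceil>log 2 (real (n + 1))\<rceil>"
  have "log 2 (real (n + 1)) \<le> real e" unfolding e_def by linarith
  then have "real (n + 1) \<le> 2 powr real e" by (subst (asm) log_le_iff) auto
  also have "\<dots> = real (2 ^ e)" by (simp add: powr_realpow)
  finally show ?thesis unfolding e_def[symmetric] by (simp only: of_nat_le_iff)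
qed

lemma word_length_power: "(n + 1) ^ c \<le> 2 ^ word_length c n"
proof -
  have "(n + 1) ^ c \<le> (2 ^ nat \<lceil>log 2 (real (n + 1))\<rceil>) ^ c"
    by (rule power_mono[OF le_power_ceiling_log]) simp
  then show ?thesis by (simp add: word_length_def power_mult[symmetric] mult.commute)
qed

text \<open>Everything must fit into a word already for \<open>n = 1\<close>, so constants are
  traded for powers of \<open>x = n + 1 \<ge> 2\<close>: \<open>k + 2 \<le> x ^ (k + 1)\<close> and
  \<open>100 \<le> x ^ 7\<close>. The resulting exponents, at most \<open>2 * k + 12\<close> or
  \<open>3 * k + 5\<close>, stay below \<open>4 * k + 20\<close>. The factor also gives
  \<open>k < w\<close>, which makes the constant \<open>2 ^ k\<close> representable.\<close>

lemma sketch_parameters: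
  assumes "0 < n" "0 < k" "M \<le> n" "w = word_length (4 * k + 20) n"
    and "L = size_exp n" "q = rate k M" "cap = capacity q n" "A = sketch_size k L cap"
  shows "sketch w A n k L q cap" "k < w" "n < 2 ^ w"
proof -
  define x where "x = n + 1"
  define y where "y = k + 2"
  have x: "2 \<le> x" "n \<le> x" using assms(1) by (auto simp: x_def)
  have W: "x ^ (4 * k + 20) \<le> 2 ^ w" unfolding x_def assms(4) by (rule word_length_power)
  have y: "y \<le> x ^ (k + 1)"
  proof -
    have "y \<le> 2 ^ (k + 1)" unfolding y_def by (induction k) auto
    also have "\<dots> \<le> x ^ (k + 1)" using x by (intro power_mono) auto
    finally show ?thesis .
  qed
  have c100: "100 \<le> x ^ 7"
  proof -
    have "(100::nat) \<le> 2 ^ 7" by simp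
    also have "\<dots> \<le> x ^ 7" using x by (intro power_mono) auto
    finally show ?thesis .
  qed
  have big: "x ^ e < 2 ^ w" if "e < 4 * k + 20" for e
    using power_strict_increasing[OF that, of x] x(1) W by linarith
  have L: "L \<le> n" "2 ^ L \<le> 2 * n" using size_exp_pred[of n] assms by auto
  have yx1: "1 \<le> y" "1 \<le> x" using x by (auto simp: y_def)
  have Lk: "L * k + 2 \<le> y * x"
  proof -
    have "L * k + 2 \<le> n * k + 2" using L(1) by simp
    also have "\<dots> \<le> (k + 2) * (n + 1)" by (simp add: algebra_simps)
    finally show ?thesis by (simp add: y_def x_def)
  qed
  then have J: "(L * k + 2) * (L * k + 2) \<le> y ^ 2 * x ^ 2"
    using mult_mono[OF Lk Lk] by (simp add: power2_eq_square algebra_simps)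
  have cap: "Suc cap \<le> 7 * x"
  proof -
    define r where "r = n div q"
    have "r \<le> n" by (simp add: r_def)
    moreover have "Suc cap = 6 * r + 7" by (simp add: assms(7) capacity_def r_def)
    ultimately show ?thesis by (simp add: x_def)
  qed
  have one: "1 \<le> y ^ 2 * x ^ 2" using yx1 by simp
  have "Suc cap * (2 * ((L * k + 2) * (L * k + 2)) + 2) \<le> (7 * x) * (4 * (y ^ 2 * x ^ 2))"
    using cap J one by (intro mult_mono) linarith+
  also have "\<dots> = 28 * (y ^ 2 * x ^ 3)" by (simp add: power2_eq_square power3_eq_cube algebra_simps)
  finally have 1: "Suc cap * (2 * ((L * k + 2) * (L * k + 2)) + 2) \<le> 28 * (y ^ 2 * x ^ 3)" .
  have 2: "base k \<le> 40 * (y ^ 2 * x ^ 3)"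
  proof -
    have "base k \<le> 40 * y" by (simp add: base_def y_def)
    also have "\<dots> \<le> 40 * (y ^ 2 * x ^ 3)" using yx1 by (simp add: power2_eq_square)
    finally show ?thesis .
  qed
  have "A \<le> 100 * (y ^ 2 * x ^ 3)" using 1 2 assms(8) unfolding sketch_size_def by linarith
  also have "\<dots> \<le> x ^ 7 * ((x ^ (k + 1)) ^ 2 * x ^ 3)"
    using c100 y by (intro mult_mono power_mono) auto
  also have "\<dots> = x ^ (7 + ((k + 1) * 2 + 3))" by (simp only: power_add power_mult)
  also have "\<dots> < 2 ^ w" by (rule big) simp
  finally have A: "A < 2 ^ w" .
  have "k * ((L * k + 2) * (L * k + 2)) \<le> y * (y ^ 2 * x ^ 2)" by (rule mult_mono[OF _ J]) (auto simp: y_def)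
  also have "\<dots> \<le> x ^ (k + 1) * ((x ^ (k + 1)) ^ 2 * x ^ 2)" using y by (intro mult_mono power_mono) auto
  also have "\<dots> = x ^ ((k + 1) + ((k + 1) * 2 + 2))" by (simp only: power_add power_mult)
  also have "\<dots> < 2 ^ w" by (rule big) simp
  finally have kJ: "k * ((L * k + 2) * (L * k + 2)) < 2 ^ w" .
  have "n * n + n \<le> x ^ 2" by (simp add: x_def power2_eq_square)
  also have "\<dots> < 2 ^ w" by (rule big) simp
  finally have n2: "n * n + n < 2 ^ w" .
  have "2 * 2 ^ L \<le> 4 * x" using L x by simp
  also have "\<dots> \<le> x ^ 7 * x" using c100 by (intro mult_right_mono) auto
  also have "\<dots> = x ^ 8" by (simp add: eval_nat_numeral)
  also have "\<dots> < 2 ^ w" by (rule big) simp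
  finally have L2: "2 * 2 ^ L < (2::nat) ^ w" .
  show "sketch w A n k L q cap"
    by unfold_locales
      (use assms A kJ n2 L2 rate_le[OF assms(2,1,3)] rate_pos size_exp in \<open>auto simp: sketch_size_def\<close>)
  show "n < 2 ^ w" using n2 by simp
  have "0 < log 2 (real (n + 1))" using assms(1) by simp
  then have "1 \<le> nat \<lceil>log 2 (real (n + 1))\<rceil>" by linarith
  then have "(4 * k + 20) * 1 \<le> w" unfolding assms(4) word_length_def by (intro mult_left_mono) auto
  then show "k < w" by simp
qed

section \<open>Coupling the algorithm with the sample\<close>

definition sketch_alg :: "nat \<Rightarrow> nat \<Rightarrow> stream_alg" where
  "sketch_alg k \<sigma> = \<lparr>init_prog = sketch_init k \<sigma>, update_prog = sketch_update k, report_prog = sketch_report k\<rparr>"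

lemma sketch_alg_sel [simp]:
  "init_prog (sketch_alg k \<sigma>) = sketch_init k \<sigma>" "update_prog (sketch_alg k \<sigma>) = sketch_update k"
  "report_prog (sketch_alg k \<sigma>) = sketch_report k"
  by (simp_all add: sketch_alg_def)

lemma memory_after_snoc:
  "memory_after w n A (\<sigma> @ [u]) = bind_pmf (memory_after w n A \<sigma>) (exec w (update_input n u) (update_prog A))"
  by (simp add: memory_after_def)

context
  fixes n k \<sigma> w L q cap A :: nat and M :: nat
  assumes n: "0 < n" and k: "0 < k" and M: "M = n div 2 ^ \<sigma>" and w: "w = word_length (4 * k + 20) n"
    and L: "L = size_exp n" and q: "q = rate k M" and cap: "cap = capacity q n" and A: "A = sketch_size k L cap"
begin

lemma sketch: "sketch w A n k L q cap" and k_less_w: "k < w" and n_less_word: "n < 2 ^ w"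
  using sketch_parameters[OF n k _ w L q cap A] M by auto

abbreviation "rep ys E m \<equiv> sketch.Rep A n k L q cap (take cap ys) (nbrs E) m"

text \<open>The sample is fixed during initialisation; afterwards each update is deterministic and
  keeps \<open>ys\<close>, so the coupling passes along the stream with
  \<open>return_pmf ys\<close>.\<close>

lemma memory_after_rep:
  "valid_stream n \<tau> \<Longrightarrow> rel_pmf (\<lambda>m ys. rep ys (stream_graph \<tau>) m)
     (memory_after w n (sketch_alg k \<sigma>) \<tau>) (sample w q [1..<Suc n] [])"
proof (induction \<tau> rule: rev_induct)
  case Nil
  interpret sketch w "[n]" A n k L q cap by (rule sketch)
  obtain T where "reaches (sketch_init k \<sigma>) T (\<lambda>_. 0) (sample w q [1..<Suc n] [])
      (\<lambda>m ys. Rep (take cap ys) (nbrs {}) m)"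
    using init_correct[OF refl k_less_w L _ cap, of \<sigma>] q M by blast
  from reaches_exec[OF this] show ?case by (simp add: memory_after_def stream_graph_def del: upt_Suc)
next
  case (snoc u \<tau>)
  then have valid: "valid_stream n \<tau>" "valid_update n (stream_graph \<tau>) u" by (auto simp: valid_stream_snoc)
  interpret sketch w "update_input n u" A n k L q cap by (rule sketch)
  have "rel_pmf (\<lambda>m ys. rep ys (stream_graph (\<tau> @ [u])) m)
     (bind_pmf (memory_after w n (sketch_alg k \<sigma>) \<tau>) (exec w (update_input n u) (sketch_update k)))
     (bind_pmf (sample w q [1..<Suc n] []) return_pmf)"
  proof (rule rel_pmf_bindI[OF snoc.IH[OF valid(1)]])
    fix m ys assume "rep ys (stream_graph \<tau>) m"
    from wp_exec[OF update_correct[OF refl graph_on_stream[OF valid(1)] valid(2) this]]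
    show "rel_pmf (\<lambda>m ys. rep ys (stream_graph (\<tau> @ [u])) m)
        (exec w (update_input n u) (sketch_update k) m) (return_pmf ys)"
      by (simp add: rel_pmf_return_pmf2 stream_graph_def)
  qed
  then show ?case by (simp add: memory_after_snoc bind_return_pmf' del: upt_Suc)
qed

lemma memory_after_set:
  assumes "valid_stream n \<tau>" "m \<in> set_pmf (memory_after w n (sketch_alg k \<sigma>) \<tau>)"
  shows "\<exists>ys. rep ys (stream_graph \<tau>) m"
  using rel_pmf_fst[OF memory_after_rep[OF assms(1)] assms(2)] .

lemma output_dist_eq:
  assumes "valid_stream n \<tau>"
  shows "output_dist w n (sketch_alg k \<sigma>) \<tau> =
    map_pmf (\<lambda>ys. real (estimate k q n (stream_graph \<tau>) (set (take cap ys)))) (sample w q [1..<Suc n] [])"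
proof -
  interpret sketch w "[n]" A n k L q cap by (rule sketch)
  have "rel_pmf (\<lambda>m ys. m 0 = estimate k q n (stream_graph \<tau>) (set (take cap ys)) \<and> m 1 = 1)
     (bind_pmf (memory_after w n (sketch_alg k \<sigma>) \<tau>) (exec w [n] (sketch_report k)))
     (bind_pmf (sample w q [1..<Suc n] []) return_pmf)"
  proof (rule rel_pmf_bindI[OF memory_after_rep[OF assms]])
    fix m ys assume "rep ys (stream_graph \<tau>) m"
    from wp_exec[OF report_correct[OF this graph_on_stream[OF assms]]]
    show "rel_pmf (\<lambda>m ys. m 0 = estimate k q n (stream_graph \<tau>) (set (take cap ys)) \<and> m 1 = 1)
        (exec w [n] (sketch_report k) m) (return_pmf ys)"
      by (simp add: rel_pmf_return_pmf2)
  qed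
  \<comment> \<open>With denominator 1 the coupling becomes equality of outcomes, and
    \<open>rel_pmf (=)\<close> is equality of distributions.\<close>
  then have "rel_pmf (=) (output_dist w n (sketch_alg k \<sigma>) \<tau>)
     (map_pmf (\<lambda>ys. real (estimate k q n (stream_graph \<tau>) (set (take cap ys)))) (sample w q [1..<Suc n] []))"
    unfolding output_dist_def pmf.rel_map bind_return_pmf' sketch_alg_sel
    by (rule pmf.rel_mono_strong) simp
  then show ?thesis by (simp add: pmf.rel_eq)
qed

lemma init_ok: "init_terminates w n (sketch_alg k \<sigma>)"
  and init_space: "real (w * A) \<le> B \<Longrightarrow> runs_in_space w [n] (sketch_init k \<sigma>) (\<lambda>_. 0) B"
proof -
  interpret sketch w "[n]" A n k L q cap by (rule sketch)
  obtain T where T: "reaches (sketch_init k \<sigma>) T (\<lambda>_. 0) (sample w q [1..<Suc n] [])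
      (\<lambda>m ys. Rep (take cap ys) (nbrs {}) m)"
    using init_correct[OF refl k_less_w L _ cap, of \<sigma>] q M by blast
  show "init_terminates w n (sketch_alg k \<sigma>)"
    unfolding init_terminates_def using reaches_halts[OF T] by auto
  show "real (w * A) \<le> B \<Longrightarrow> runs_in_space w [n] (sketch_init k \<sigma>) (\<lambda>_. 0) B"
    by (rule reaches_runs_in_space[OF T])
qed

lemma space_ok:
  assumes "real (w * A) \<le> B"
  shows "has_space w n (sketch_alg k \<sigma>) B"
  unfolding has_space_def sketch_alg_sel
proof (intro conjI allI impI ballI)
  show "runs_in_space w [n] (sketch_init k \<sigma>) (\<lambda>_. 0) B" using init_space[OF assms] .
next
  fix \<tau> u m assume "valid_stream n (\<tau> @ [u])" and m: "m \<in> set_pmf (memory_after w n (sketch_alg k \<sigma>) \<tau>)"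
  then have valid: "valid_stream n \<tau>" "valid_update n (stream_graph \<tau>) u" by (auto simp: valid_stream_snoc)
  interpret sketch w "update_input n u" A n k L q cap by (rule sketch)
  obtain ys where "rep ys (stream_graph \<tau>) m" using memory_after_set[OF valid(1) m] by blast
  from update_correct[OF refl graph_on_stream[OF valid(1)] valid(2) this]
  show "runs_in_space w (update_input n u) (sketch_update k) m B"
    using assms by (rule reaches_runs_in_space)
next
  fix \<tau> m assume valid: "valid_stream n \<tau>" and m: "m \<in> set_pmf (memory_after w n (sketch_alg k \<sigma>) \<tau>)"
  interpret sketch w "[n]" A n k L q cap by (rule sketch)
  obtain ys where "rep ys (stream_graph \<tau>) m" using memory_after_set[OF valid m] by blast
  from report_correct[OF this graph_on_stream[OF valid]]
  show "runs_in_space w [n] (sketch_report k) m B" using assms by (rule reaches_runs_in_space)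
qed

lemma update_time_ok:
  assumes "real (2 * sketch.edit_time k L + 4) \<le> B"
  shows "has_update_time w n (sketch_alg k \<sigma>) B"
  unfolding has_update_time_def sketch_alg_sel
proof (intro allI impI ballI)
  fix \<tau> u m assume "valid_stream n (\<tau> @ [u])" and m: "m \<in> set_pmf (memory_after w n (sketch_alg k \<sigma>) \<tau>)"
  then have valid: "valid_stream n \<tau>" "valid_update n (stream_graph \<tau>) u" by (auto simp: valid_stream_snoc)
  interpret sketch w "update_input n u" A n k L q cap by (rule sketch)
  obtain ys where "rep ys (stream_graph \<tau>) m" using memory_after_set[OF valid(1) m] by blast
  from update_correct[OF refl graph_on_stream[OF valid(1)] valid(2) this]
  show "runs_in_time w (update_input n u) (sketch_update k) m B"
    using assms by (rule reaches_runs_in_time)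
qed

lemma report_time_ok:
  assumes "real (sketch.report_time k L cap) \<le> B"
  shows "has_report_time w n (sketch_alg k \<sigma>) B"
  unfolding has_report_time_def sketch_alg_sel
proof (intro allI impI ballI)
  fix \<tau> m assume valid: "valid_stream n \<tau>" and m: "m \<in> set_pmf (memory_after w n (sketch_alg k \<sigma>) \<tau>)"
  interpret sketch w "[n]" A n k L q cap by (rule sketch)
  obtain ys where "rep ys (stream_graph \<tau>) m" using memory_after_set[OF valid m] by blast
  from report_correct[OF this graph_on_stream[OF valid]]
  show "runs_in_time w [n] (sketch_report k) m B" using assms by (rule reaches_runs_in_time)
qed

lemma estimates_ok:
  assumes "k = nat \<lfloor>1 / \<epsilon>\<rfloor>" "0 < \<epsilon>" "0 < \<delta>" "6 / \<delta>\<^sup>2 \<le> 2 ^ \<sigma>"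
  shows "estimates_small_components w n (sketch_alg k \<sigma>) \<epsilon> (\<delta> * real n)"
  unfolding estimates_small_components_def
proof (intro allI impI)
  fix \<tau> assume valid: "valid_stream n \<tau>"
  define E where "E = stream_graph \<tau>"
  obtain a where a: "q = 2 ^ a" using q by (auto simp: rate_def)
  have "q \<le> n" using rate_le(2)[OF k n, of M] M q by simp
  then have "2 ^ a < (2::nat) ^ w" using a n_less_word by linarith
  then have dvd: "q dvd 2 ^ w" unfolding a by (intro le_imp_power_dvd) simp
  have "real q ^ k - 1 \<le> \<delta>\<^sup>2 * real n / 6"
  \<comment> \<open>For \<open>q = 1\<close> every vertex is sampled and the left side is 0;
    \<open>q ^ k \<le> M\<close> would fail there if \<open>M = 0\<close>.\<close>
  proof (cases "q = 1")
    case False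
    then have "q ^ k \<le> M" using rate_upper[of k M] q by simp
    then have "real q ^ k \<le> real M" using of_nat_mono[of "q ^ k" M, where 'a = real] by simp
    also have "real M \<le> real n / 2 ^ \<sigma>" unfolding M using real_div_le[of n "2 ^ \<sigma>"] by simp
    also have "\<dots> \<le> real n / (6 / \<delta>\<^sup>2)" using assms(3,4) by (intro divide_left_mono) auto
    finally show ?thesis by (simp add: field_simps)
  qed simp
  moreover have "6 * n \<le> q * cap"
  proof -
    have "0 < q" using rate_pos q by simp
    then have "n \<le> q * (n div q) + q"
      using mult_div_mod_eq[of q n] mod_less_divisor[of q n] by linarith
    then show ?thesis by (simp add: cap capacity_def algebra_simps)
  qed
  ultimately have "2 / 3 \<le> measure_pmf.prob (sample w q [1..<Suc n] [])
     {ys. \<bar>real (estimate k q n E (set (take cap ys))) - real (card (small_comps k n E))\<bar> \<le> \<delta> * real n}"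
    using graph_on_stream[OF valid] dvd n assms(3) unfolding E_def by (intro sample_concentration) auto
  then show "measure_pmf.prob (output_dist w n (sketch_alg k \<sigma>) \<tau>)
      {Y. \<bar>Y - real (num_small_components \<epsilon> n (stream_graph \<tau>))\<bar> \<le> \<delta> * real n} \<ge> 2 / 3"
    unfolding output_dist_eq[OF valid] num_small_components_eq[OF assms(1,2)] E_def
    by (simp add: measure_map_pmf vimage_def del: upt_Suc)
qed

text \<open>The exponent 3 arises because \<open>J\<close> is of order \<open>l ^ 2\<close>, and a
  further factor \<open>l\<close> comes from the binary search in the report time and from the word
  length in the space. \<open>\<kappa>\<close> is chosen such that
  \<open>Q \<le> \<kappa> * l\<close>; rounding the logarithm up costs a factor 2, as
  \<open>1 \<le> l\<close>.\<close>

lemma resource_bounds: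
  fixes \<kappa> l :: real
  defines "\<kappa> \<equiv> 2 * real k + 2" and "l \<equiv> log 2 (real n + 1)"
  shows "real (2 * sketch.edit_time k L + 4) \<le> (104 + 24 * \<kappa>) * l ^ 3"
    and "real (sketch.report_time k L cap) \<le> real n / real q * ((1092 * real k * \<kappa>\<^sup>2 + 262) * l ^ 3)"
    and "real (w * A) \<le> real n / real q * ((8 * real k + 40) * (40 + real k + 52 * \<kappa>\<^sup>2) * l ^ 3)"
proof -
  interpret sketch w "[n]" A n k L q cap by (rule sketch)
  have l1: "1 \<le> l" using n by (simp add: l_def le_log_iff)
  define l0 where "l0 = nat \<lceil>log 2 (real (n + 1))\<rceil>"
  have "real l0 \<le> l + 1" using l1 unfolding l0_def l_def by (simp add: add.commute) linarith
  then have l0: "real l0 \<le> 2 * l" using l1 by linarith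
  have "n < 2 ^ l0" using le_power_ceiling_log[of n] by (simp add: l0_def)
  then have "L \<le> l0" unfolding L by (rule size_exp_le)
  then have L2: "real L \<le> 2 * l" using l0 by linarith
  have \<kappa>: "1 \<le> \<kappa>" by (simp add: \<kappa>_def)
  have Ql: "real Q \<le> \<kappa> * l"
  proof -
    have "real L * real k \<le> 2 * l * real k" using L2 by (rule mult_right_mono) simp
    then show ?thesis using l1 by (simp add: Q_def \<kappa>_def algebra_simps)
  qed
  have Jl: "real J \<le> \<kappa>\<^sup>2 * l\<^sup>2"
  proof -
    have "real Q * real Q \<le> (\<kappa> * l) * (\<kappa> * l)" using Ql by (intro mult_mono) auto
    then show ?thesis by (simp add: J_def power2_eq_square algebra_simps)
  qed
  have pows: "1 \<le> l\<^sup>2" "l \<le> l ^ 3" "1 \<le> l ^ 3" "1 \<le> \<kappa>\<^sup>2" "1 \<le> \<kappa>\<^sup>2 * l\<^sup>2"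
  proof -
    show "1 \<le> l\<^sup>2" "1 \<le> l ^ 3" "1 \<le> \<kappa>\<^sup>2" using l1 \<kappa> by (auto intro: one_le_power)
    show "l \<le> l ^ 3" using power_increasing[of 1 3 l] l1 by simp
    show "1 \<le> \<kappa>\<^sup>2 * l\<^sup>2" using mult_mono[of 1 "\<kappa>\<^sup>2" 1 "l\<^sup>2"] \<open>1 \<le> l\<^sup>2\<close> \<open>1 \<le> \<kappa>\<^sup>2\<close> by simp
  qed
  have find: "real find_time \<le> 40 * l" using L2 l1 by (simp add: find_time_def)
  have "real (2 * edit_time + 4) \<le> (104 + 24 * \<kappa>) * l"
    using find Ql l1 by (simp add: edit_time_def algebra_simps)
  also have "\<dots> \<le> (104 + 24 * \<kappa>) * l ^ 3" using pows \<kappa> by (intro mult_left_mono) auto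
  finally show "real (2 * edit_time + 4) \<le> (104 + 24 * \<kappa>) * l ^ 3" .
  define nq where "nq = real n / real q"
  have "0 < q" "q \<le> n" using rate_pos q rate_le(2)[OF k n, of M] M by auto
  then have nq1: "1 \<le> nq" by (simp add: nq_def)
  have capq: "real cap \<le> 12 * nq"
  proof -
    have "real (n div q) \<le> nq" unfolding nq_def by (rule real_div_le)
    then show ?thesis using nq1 by (simp add: cap capacity_def)
  qed
  have step: "real (Suc step_time) \<le> 91 * l" using find l1 by (simp add: step_time_def)
  have "real (Suc explore_time) \<le> (91 * real k * \<kappa>\<^sup>2 + 21) * l ^ 3"
  proof -
    have "real k * real J * real (Suc step_time) \<le> real k * (\<kappa>\<^sup>2 * l\<^sup>2) * (91 * l)"
      using Jl step l1 by (intro mult_mono) auto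
    also have "\<dots> = (91 * real k * \<kappa>\<^sup>2) * l ^ 3" by (simp add: power2_eq_square power3_eq_cube)
    finally have "real (k * J * Suc step_time) \<le> (91 * real k * \<kappa>\<^sup>2) * l ^ 3" by (simp only: of_nat_mult)
    moreover have "real (Suc explore_time) = real (k * J * Suc step_time) + 21"
      unfolding explore_time_def by simp
    ultimately show ?thesis using pows(3) by (simp add: algebra_simps)
  qed
  then have "real cap * real (Suc explore_time) \<le> (12 * nq) * ((91 * real k * \<kappa>\<^sup>2 + 21) * l ^ 3)"
    using capq nq1 by (intro mult_mono) auto
  moreover have "10 \<le> nq * (10 * l ^ 3)" using mult_mono[OF nq1 pows(3)] nq1 by simp
  moreover have "real report_time = real cap * real (Suc explore_time) + 10"
    unfolding report_time_def by (simp only: of_nat_add of_nat_mult of_nat_numeral)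
  ultimately show "real report_time \<le> real n / real q * ((1092 * real k * \<kappa>\<^sup>2 + 262) * l ^ 3)"
    unfolding nq_def[symmetric] by (simp add: algebra_simps)
  have "real w \<le> (8 * real k + 40) * l"
  proof -
    have "real w = (4 * real k + 20) * real l0" by (simp add: w word_length_def l0_def)
    also have "\<dots> \<le> (4 * real k + 20) * (2 * l)" using l0 by (intro mult_left_mono) auto
    finally show ?thesis by (simp add: algebra_simps)
  qed
  moreover have "real A \<le> nq * ((40 + real k + 52 * \<kappa>\<^sup>2) * l\<^sup>2)"
  proof -
    have "real Z \<le> 4 * (\<kappa>\<^sup>2 * l\<^sup>2)" using Jl pows(5) by (simp add: Z_def)
    moreover have "real (Suc cap) \<le> 13 * nq" using capq nq1 by simp
    ultimately have "real (Suc cap) * real Z \<le> (13 * nq) * (4 * (\<kappa>\<^sup>2 * l\<^sup>2))"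
      using nq1 by (intro mult_mono) auto
    moreover have "(40 + real k) * 1 \<le> (40 + real k) * (nq * l\<^sup>2)"
      using mult_mono[OF nq1 pows(1)] nq1 by (intro mult_left_mono) auto
    moreover have "real A = (40 + real k) + real (Suc cap) * real Z"
      unfolding A_Z base_def by (simp only: of_nat_add of_nat_mult of_nat_numeral)
    ultimately show ?thesis by (simp add: algebra_simps)
  qed
  ultimately have "real w * real A \<le> ((8 * real k + 40) * l) * (nq * ((40 + real k + 52 * \<kappa>\<^sup>2) * l\<^sup>2))"
    using l1 by (intro mult_mono) auto
  then show "real (w * A) \<le> real n / real q * ((8 * real k + 40) * (40 + real k + 52 * \<kappa>\<^sup>2) * l ^ 3)"
    unfolding nq_def[symmetric] by (simp add: power2_eq_square power3_eq_cube mult_ac)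
qed

text \<open>\<open>(2 * q) ^ k\<close> is at least \<open>M + 1\<close> and so at least
  \<open>n / 2 ^ \<sigma>\<close>. Raising to the power \<open>\<epsilon>\<close> and using
  \<open>k * \<epsilon> \<le> 1\<close> gives
  \<open>(n / 2 ^ \<sigma>) powr \<epsilon> \<le> 2 * q\<close>; this is the origin of
  \<open>n powr (1 - \<epsilon>)\<close>.\<close>

lemma expected_sample_size:
  assumes "0 < \<epsilon>" "real k * \<epsilon> \<le> 1"
  shows "real n / real q \<le> 2 * real n powr (1 - \<epsilon>) * (2 ^ \<sigma>) powr \<epsilon>"
proof -
  have "0 < q" using rate_pos q by simp
  define b :: real where "b = 2 * real q"
  have b: "1 \<le> b" using \<open>0 < q\<close> by (simp add: b_def)
  have "M < (2 * q) ^ k" using rate_lower[OF k, of M] q by simp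
  then have "real (Suc M) \<le> real ((2 * q) ^ k)" by (intro of_nat_mono) simp
  then have "real M + 1 \<le> b ^ k" by (simp add: b_def)
  moreover have "real n / 2 ^ \<sigma> \<le> real M + 1"
  proof -
    have "n < (M + 1) * 2 ^ \<sigma>" unfolding M by (simp add: dividend_less_div_times)
    then have "real n \<le> real ((M + 1) * 2 ^ \<sigma>)" by (intro of_nat_mono) simp
    then show ?thesis by (simp add: divide_le_eq algebra_simps)
  qed
  ultimately have "real n / 2 ^ \<sigma> \<le> b powr real k" using b by (simp add: powr_realpow)
  then have "(real n / 2 ^ \<sigma>) powr \<epsilon> \<le> (b powr real k) powr \<epsilon>"
    using assms(1) by (intro powr_mono2) auto
  also have "\<dots> = b powr (real k * \<epsilon>)" by (simp add: powr_powr)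
  also have "\<dots> \<le> b powr 1" using b assms(2) by (intro powr_mono) auto
  finally have "real n powr \<epsilon> / (2 ^ \<sigma>) powr \<epsilon> \<le> b" using b by (simp add: powr_divide)
  then have "real n powr \<epsilon> \<le> b * (2 ^ \<sigma>) powr \<epsilon>" by (simp add: divide_le_eq)
  then have "real n powr (1 - \<epsilon>) * real n powr \<epsilon> \<le> real n powr (1 - \<epsilon>) * (b * (2 ^ \<sigma>) powr \<epsilon>)"
    by (intro mult_left_mono) auto
  moreover have "real n powr (1 - \<epsilon>) * real n powr \<epsilon> = real n"
    using n by (simp add: powr_add[symmetric])
  ultimately show ?thesis using \<open>0 < q\<close> by (simp add: b_def divide_le_eq mult_ac)
qed

end

section \<open>The dependence on the accuracy exponent\<close>

lemma entropy_bound: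
  fixes \<epsilon> :: real
  assumes "0 < \<epsilon>"
  shows "2 * \<epsilon> * ln (1 / \<epsilon>) \<le> 1"
proof -
  \<comment> \<open>Applying \<open>ln x \<le> x - 1\<close> at \<open>1 / \<epsilon>\<close> itself
    would only give the bound 2; at \<open>1 / s\<close> it leaves
    \<open>s - s * s \<le> 1 / 4\<close>, which suffices.\<close>
  define s where "s = sqrt \<epsilon>"
  have s: "0 < s" "\<epsilon> = s * s" using assms by (auto simp: s_def)
  have "ln (1 / s) \<le> 1 / s - 1" using s(1) by (intro ln_le_minus_one) auto
  then have "s * s * ln (1 / s) \<le> s * s * (1 / s - 1)" by (intro mult_left_mono) auto
  also have "\<dots> = s - s * s" using s(1) by (simp add: field_simps)
  also have "\<dots> \<le> 1 / 4" using sum_squares_ge_zero[of "s - 1 / 2" 0] by (simp add: algebra_simps power2_eq_square)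
  finally have "s * s * ln (1 / s) \<le> 1 / 4" .
  moreover have "ln (1 / \<epsilon>) = 2 * ln (1 / s)" using s by (simp add: ln_div ln_mult)
  ultimately show ?thesis using s(2) by simp
qed

text \<open>\<open>2 ^ \<sigma>\<close> is what Chebyshev's inequality demands for relative error
  \<open>\<epsilon> powr t\<close>, rounded up to a power of two, which turns 6 into at most 12. Its
  power \<open>\<epsilon>\<close> is at most \<open>12 powr \<epsilon> * exp (t * (2 * \<epsilon> *
  ln (1 / \<epsilon>)))\<close>, and \<open>entropy_bound\<close> reduces this to the factor
  \<open>exp t\<close>.\<close>

lemma shift_bounds:
  fixes \<epsilon> t :: real
  assumes "0 < \<epsilon>" "\<epsilon> < 1" "1 \<le> t"
  shows "\<exists>\<sigma>::nat. 6 / (\<epsilon> powr t)\<^sup>2 \<le> 2 ^ \<sigma> \<and> (2 ^ \<sigma>) powr \<epsilon> \<le> 12 * exp t"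
proof -
  define z where "z = 6 / (\<epsilon> powr t)\<^sup>2"
  have "\<epsilon> powr t \<le> 1" using assms by (simp add: powr_le1)
  then have "(\<epsilon> powr t)\<^sup>2 \<le> 1" using assms by (simp add: power_le_one)
  then have z: "1 < z" using assms by (simp add: z_def less_divide_eq)
  define \<sigma> where "\<sigma> = nat \<lceil>log 2 z\<rceil>"
  have "0 < log 2 z" using z by simp
  then have \<sigma>: "log 2 z \<le> real \<sigma>" "real \<sigma> \<le> log 2 z + 1" unfolding \<sigma>_def by linarith+
  have lo: "z \<le> 2 ^ \<sigma>" using \<sigma>(1) z by (subst (asm) log_le_iff) (auto simp: powr_realpow)
  have "(2::real) powr real \<sigma> \<le> 2 powr (log 2 z + 1)" using \<sigma>(2) by (intro powr_mono) auto
  then have hi: "2 ^ \<sigma> \<le> 2 * z" using z by (simp add: powr_add powr_realpow)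
  have "(2 ^ \<sigma>) powr \<epsilon> \<le> (2 * z) powr \<epsilon>" using hi assms by (intro powr_mono2) auto
  also have "\<dots> = 12 powr \<epsilon> * ((\<epsilon> powr t)\<^sup>2) powr (- \<epsilon>)"
    using assms by (simp add: z_def powr_divide powr_minus_divide)
  also have "((\<epsilon> powr t)\<^sup>2) powr (- \<epsilon>) = exp (t * (2 * \<epsilon> * ln (1 / \<epsilon>)))"
    using assms by (simp add: powr_def ln_mult power2_eq_square ln_div exp_add[symmetric] algebra_simps)
  also have "12 powr \<epsilon> * exp (t * (2 * \<epsilon> * ln (1 / \<epsilon>))) \<le> 12 powr 1 * exp (t * 1)"
    using entropy_bound[OF assms(1)] assms by (intro mult_mono powr_mono) (auto simp: mult_left_le)
  finally show ?thesis using lo unfolding z_def by auto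
qed

section \<open>The empty program and the theorem\<close>

lemma run_Nil: "run w inp T ([], m) = return_pmf ([], m)"
  by (rule ram.run_halted)

lemma exec_Nil: "exec w inp [] m = return_pmf m"
  by (simp add: exec_def run_Nil)

lemma num_small_components_le: "num_small_components \<epsilon> n E \<le> n"
proof -
  have "num_small_components \<epsilon> n E \<le> card (component E ` {1..n})"
    unfolding num_small_components_def by (rule card_mono) (auto simp: components_eq)
  also have "\<dots> \<le> n" using card_image_le[of "{1..n}" "component E"] by simp
  finally show ?thesis .
qed

lemma empty_alg:
  assumes "A = \<lparr>init_prog = [], update_prog = [], report_prog = []\<rparr>" "real n \<le> \<delta>" "0 \<le> B" "0 \<le> B'"
  shows "init_terminates w n A" "estimates_small_components w n A \<epsilon> \<delta>"
    "has_space w n A B" "has_report_time w n A B" "has_update_time w n A B'"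
proof -
  have sel: "init_prog A = []" "update_prog A = []" "report_prog A = []" by (simp_all add: assms(1))
  have mem: "memory_after w n A \<sigma> = return_pmf (\<lambda>_. 0)" for \<sigma>
    by (induction \<sigma> rule: rev_induct) (auto simp: memory_after_def sel exec_Nil bind_return_pmf)
  have halts: "halts_within w inp [] m 0" for inp m by (simp add: halts_within_def)
  show "init_terminates w n A" using halts by (auto simp: init_terminates_def sel)
  show "has_report_time w n A B" "has_update_time w n A B'"
    using halts assms(3,4) sel by (auto simp: has_report_time_def has_update_time_def runs_in_time_def intro!: exI[of _ 0])
  show "has_space w n A B" by (simp add: has_space_def runs_in_space_def mem sel run_Nil)
  have "output_dist w n A \<sigma> = return_pmf 0" for \<sigma>
    by (simp add: output_dist_def mem sel exec_Nil bind_return_pmf)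
  moreover have "real (num_small_components \<epsilon> n E) \<le> \<delta>" for E
    using num_small_components_le[of \<epsilon> n E] assms(2) by linarith
  ultimately show "estimates_small_components w n A \<epsilon> \<delta>"
    by (simp add: estimates_small_components_def measure_return_pmf)
qed

theorem theorem3p1:
  fixes \<epsilon> :: real
  assumes "\<epsilon> > 0"
  shows "\<exists>(K::real) (d::nat) (c::nat). K > 0 \<and> c \<ge> 1 \<and>
    (\<forall>t::real. t \<ge> 1 \<longrightarrow> (\<exists>A::stream_alg. \<forall>n::nat. n \<ge> 1 \<longrightarrow>
       (let w = word_length c n;
            B = K * (exp t * real n powr (1 - \<epsilon>) * log 2 (real n + 1) ^ d)
        in init_terminates w n A \<and>
           estimates_small_components w n A \<epsilon> (\<epsilon> powr t * real n) \<and>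
           has_space w n A B \<and>
           has_report_time w n A B \<and>
           has_update_time w n A (K * log 2 (real n + 1) ^ d))))"
proof (cases "\<epsilon> < 1")
  case False
  define A where "A = \<lparr>init_prog = [], update_prog = [], report_prog = []\<rparr>"
  show ?thesis
  proof (rule exI[of _ 1], rule exI[of _ 0], rule exI[of _ 1], intro conjI allI impI)
    fix t :: real assume "1 \<le> t"
    then have "1 \<le> \<epsilon> powr t" using False by (intro ge_one_powr_ge_zero) auto
    then have "real n \<le> \<epsilon> powr t * real n" for n
      using mult_right_mono[of 1 "\<epsilon> powr t" "real n"] by simp
    then show "\<exists>A::stream_alg. \<forall>n::nat. n \<ge> 1 \<longrightarrow>
       (let w = word_length 1 n;
            B = 1 * (exp t * real n powr (1 - \<epsilon>) * log 2 (real n + 1) ^ 0)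
        in init_terminates w n A \<and>
           estimates_small_components w n A \<epsilon> (\<epsilon> powr t * real n) \<and>
           has_space w n A B \<and>
           has_report_time w n A B \<and>
           has_update_time w n A (1 * log 2 (real n + 1) ^ 0))"
      unfolding Let_def by (intro exI[of _ A] allI impI conjI empty_alg[OF A_def]) auto
  qed auto
next
  case True
  define k where "k = nat \<lfloor>1 / \<epsilon>\<rfloor>"
  have k: "0 < k" using True assms by (simp add: k_def)
  have "real k \<le> 1 / \<epsilon>" using assms by (simp add: k_def)
  then have k\<epsilon>: "real k * \<epsilon> \<le> 1" using assms by (simp add: le_divide_eq)
  define \<kappa> where "\<kappa> = 2 * real k + 2"
  define K1 where "K1 = 104 + 24 * \<kappa>"
  define K2 where "K2 = 1092 * real k * \<kappa>\<^sup>2 + 262"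
  define K3 where "K3 = (8 * real k + 40) * (40 + real k + 52 * \<kappa>\<^sup>2)"
  \<comment> \<open>24 is the factor 2 lost in rounding \<open>q\<close> down times the 12 of
    \<open>shift_bounds\<close>; it concerns the two bounds proportional to the sample size, while
    \<open>K1\<close> bounds the update time.\<close>
  define K where "K = K1 + 24 * K2 + 24 * K3"
  have Kpos: "0 < K1" "0 < K2" "0 < K3" using k by (auto simp: K1_def K2_def K3_def \<kappa>_def intro!: mult_pos_pos add_pos_nonneg)
  show ?thesis
  proof (rule exI[of _ K], rule exI[of _ 3], rule exI[of _ "4 * k + 20"], intro conjI allI impI)
    show "0 < K" "1 \<le> 4 * k + 20" using Kpos by (auto simp: K_def)
    fix t :: real assume t: "1 \<le> t"
    obtain \<sigma> where \<sigma>: "6 / (\<epsilon> powr t)\<^sup>2 \<le> 2 ^ \<sigma>" "(2 ^ \<sigma>) powr \<epsilon> \<le> 12 * exp t"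
      using shift_bounds[OF assms True t] by blast
    have "let w = word_length (4 * k + 20) n;
            B = K * (exp t * real n powr (1 - \<epsilon>) * log 2 (real n + 1) ^ 3)
        in init_terminates w n (sketch_alg k \<sigma>) \<and>
           estimates_small_components w n (sketch_alg k \<sigma>) \<epsilon> (\<epsilon> powr t * real n) \<and>
           has_space w n (sketch_alg k \<sigma>) B \<and>
           has_report_time w n (sketch_alg k \<sigma>) B \<and>
           has_update_time w n (sketch_alg k \<sigma>) (K * log 2 (real n + 1) ^ 3)" if "1 \<le> n" for n
    proof -
      have n: "0 < n" using that by simp
      define w where "w = word_length (4 * k + 20) n"
      define M where "M = n div 2 ^ \<sigma>"
      define L where "L = size_exp n"
      define q where "q = rate k M"
      define cap where "cap = capacity q n"
      define S where "S = sketch_size k L cap"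
      note params = n k M_def w_def L_def q_def cap_def S_def
      define l where "l = log 2 (real n + 1)"
      have l: "0 \<le> l ^ 3" by (simp add: l_def)
      define G where "G = exp t * real n powr (1 - \<epsilon>)"
      have "real n / real q \<le> 2 * real n powr (1 - \<epsilon>) * (2 ^ \<sigma>) powr \<epsilon>"
        by (rule expected_sample_size[OF params assms k\<epsilon>])
      also have "\<dots> \<le> 2 * real n powr (1 - \<epsilon>) * (12 * exp t)" using \<sigma>(2) by (intro mult_left_mono) auto
      finally have nq: "real n / real q \<le> 24 * G" by (simp add: G_def mult.commute)
      have G: "0 \<le> G" by (simp add: G_def)
      have bound: "real n / real q * (C * l ^ 3) \<le> K * (G * l ^ 3)" if "0 \<le> C" "24 * C \<le> K" for C
      proof -
        have "real n / real q * (C * l ^ 3) \<le> 24 * G * (C * l ^ 3)"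
          using nq that l by (intro mult_right_mono) auto
        also have "\<dots> = 24 * C * (G * l ^ 3)" by simp
        also have "\<dots> \<le> K * (G * l ^ 3)" using that G l by (intro mult_right_mono) auto
        finally show ?thesis .
      qed
      note R = resource_bounds[OF params, folded \<kappa>_def l_def, folded K1_def K2_def K3_def]
      have "K1 * l ^ 3 \<le> K * l ^ 3" using Kpos l by (intro mult_right_mono) (auto simp: K_def)
      then have "has_update_time w n (sketch_alg k \<sigma>) (K * l ^ 3)"
        using R(1) by (intro update_time_ok[OF params]) linarith
      moreover have "has_report_time w n (sketch_alg k \<sigma>) (K * (G * l ^ 3))"
        using R(2) bound[of K2] Kpos by (intro report_time_ok[OF params]) (auto simp: K_def)
      moreover have "has_space w n (sketch_alg k \<sigma>) (K * (G * l ^ 3))"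
        using R(3) bound[of K3] Kpos by (intro space_ok[OF params]) (auto simp: K_def)
      moreover have "estimates_small_components w n (sketch_alg k \<sigma>) \<epsilon> (\<epsilon> powr t * real n)"
        using assms \<sigma>(1) by (intro estimates_ok[OF params]) (auto simp: k_def)
      moreover have "init_terminates w n (sketch_alg k \<sigma>)" by (rule init_ok[OF params])
      ultimately show ?thesis by (simp add: Let_def w_def l_def G_def)
    qed
    then show "\<exists>A::stream_alg. \<forall>n::nat. n \<ge> 1 \<longrightarrow>
       (let w = word_length (4 * k + 20) n;
            B = K * (exp t * real n powr (1 - \<epsilon>) * log 2 (real n + 1) ^ 3)
        in init_terminates w n A \<and>
           estimates_small_components w n A \<epsilon> (\<epsilon> powr t * real n) \<and>
           has_space w n A B \<and>
           has_report_time w n A B \<and>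
           has_update_time w n A (K * log 2 (real n + 1) ^ 3))" by blast
  qed
qed

end
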